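(* Let $k\geq 1$ be an integer and $d=3k+1$. Then the data consisting of $\widetilde\Sigma=\Sigma=S$, the degree $d$, and the three partitions of $d$ $$(3^{k},1),\quad (3^{k},1),\quad (3^{k},1)$$ form a candidate surface branched cover, and it is realizable if and only if $d$ can be expressed as $x^2+xy+y^2$ for some $x,y\in\mathbb{N}$.
   Context: $\mathbb{N}$ denotes the non-negative integers and $S$ the 2-sphere. A partition of $d$ is a finite unordered list (multiset) of positive integers with sum $d$; $\ell(\Pi)$ is the number of entries of $\Pi$; $(a^m,b,\ldots)$ means that $a$ is repeated $m$ times. For closed connected orientable surfaces $\widetilde\Sigma,\Sigma$, a branched cover $f:\widetilde\Sigma\to\Sigma$ is a map locally modelled on $(\mathbb{C},0)\to(\mathbb{C},0)$, $z\mapsto z^k$ with $k\geq 1$; $k$ is the local degree at the source point, and a point of $\Sigma$ having a preimage with local degree $>1$ is a branching point. The degree $d$ of $f$ is the degree of the genuine cover obtained by removing the branching points and their preimages; the local degrees at the preimages of a branching point form a partition of $d$. A candidate surface branched cover consists of closed connected orientable surfaces $\widetilde\Sigma,\Sigma$, integers $d\geq 2$ and $n\geq 1$, and an unordered collection (repetitions allowed) $\Pi_1,\ldots,\Pi_n$ of partitions of $d$ satisfying the Riemann-Hurwitz condition $\chi(\widetilde\Sigma)-\sum_i\ell(\Pi_i)=d\,(\chi(\Sigma)-n)$. It is realizable if there is a degree-$d$ branched cover $f:\widetilde\Sigma\to\Sigma$ with $n$ branching points whose associated partitions of local degrees are $\Pi_1,\ldots,\Pi_n$. *)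

theory Defs
  imports "HOL-Homology.Homology" "HOL-Library.Multiset"
begin

text \<open>Closed surfaces\<close>

(* No axiom of second countability: it follows from compactness and the existence of charts. *)
definition closed_connected_surface :: "'a topology \<Rightarrow> bool" where
  "closed_connected_surface X \<longleftrightarrow>
     topspace X \<noteq> {} \<and> compact_space X \<and> connected_space X \<and> Hausdorff_space X \<and>
     (\<forall>x\<in>topspace X. \<exists>U D. openin X U \<and> x \<in> U \<and> open (D :: complex set) \<and>
        subtopology X U homeomorphic_space top_of_set D)"

(* The usual homological definition for topological manifolds: a choice, at each point x, of a
   generator of H_2(X, X - {x}) such that near every point the chosen generators are the images
   of one class in H_2(X, X - U). *)
definition orientable_surface :: "'a topology \<Rightarrow> bool" where
  "orientable_surface X \<longleftrightarrow>
     (\<exists>\<mu>. (\<forall>x\<in>topspace X.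
             \<mu> x \<in> carrier (relative_homology_group 2 X (topspace X - {x})) \<and>
             generate (relative_homology_group 2 X (topspace X - {x})) {\<mu> x} =
               carrier (relative_homology_group 2 X (topspace X - {x}))) \<and>
          (\<forall>x\<in>topspace X. \<exists>U. openin X U \<and> x \<in> U \<and>
             (\<exists>m\<in>carrier (relative_homology_group 2 X (topspace X - U)).
                \<forall>y\<in>U. hom_induced 2 X (topspace X - U) X (topspace X - {y}) id m = \<mu> y)))"

(* Meant for abelian groups, written multiplicatively as in the homology library. *)
definition int_independent :: "('a, 'b) monoid_scheme \<Rightarrow> 'a set \<Rightarrow> bool" where
  "int_independent G A \<longleftrightarrow>
     A \<subseteq> carrier G \<and>
     (\<forall>c :: 'a \<Rightarrow> int. (\<Otimes>\<^bsub>G\<^esub>a\<in>A. a [^]\<^bsub>G\<^esub> c a) = \<one>\<^bsub>G\<^esub> \<longrightarrow> (\<forall>a\<in>A. c a = 0))"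

(* Rank over the integers; unspecified if there are arbitrarily large independent sets. *)
definition int_rank :: "('a, 'b) monoid_scheme \<Rightarrow> nat" where
  "int_rank G = (GREATEST n. \<exists>A. finite A \<and> card A = n \<and> int_independent G A)"

definition betti_number :: "nat \<Rightarrow> 'a topology \<Rightarrow> nat" where
  "betti_number p X = int_rank (homology_group (int p) X)"

(* For a closed surface only the Betti numbers with p \<le> 2 can be non-zero, so the sum is finite. *)
definition euler_characteristic :: "'a topology \<Rightarrow> int" where
  "euler_characteristic X = (\<Sum>p | betti_number p X \<noteq> 0. (-1) ^ p * int (betti_number p X))"

text \<open>Branched covers\<close>

(* Near x the map f is z^k in suitable complex coordinates centred at x and f x. *)
definition locally_power_map ::
  "'a topology \<Rightarrow> 'b topology \<Rightarrow> ('a \<Rightarrow> 'b) \<Rightarrow> 'a \<Rightarrow> nat \<Rightarrow> bool" where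
  "locally_power_map X Y f x k \<longleftrightarrow>
     k \<ge> 1 \<and>
     (\<exists>U V D E \<phi> \<psi>.
        openin X U \<and> x \<in> U \<and> openin Y V \<and> f ` U \<subseteq> V \<and>
        open (D :: complex set) \<and> open (E :: complex set) \<and>
        homeomorphic_map (subtopology X U) (top_of_set D) \<phi> \<and> \<phi> x = 0 \<and>
        homeomorphic_map (subtopology Y V) (top_of_set E) \<psi> \<and> \<psi> (f x) = 0 \<and>
        (\<forall>u\<in>U. \<psi> (f u) = \<phi> u ^ k))"

definition branched_cover :: "'a topology \<Rightarrow> 'b topology \<Rightarrow> ('a \<Rightarrow> 'b) \<Rightarrow> bool" where
  "branched_cover X Y f \<longleftrightarrow>
     continuous_map X Y f \<and> (\<forall>x\<in>topspace X. \<exists>k. locally_power_map X Y f x k)"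

definition local_degree :: "'a topology \<Rightarrow> 'b topology \<Rightarrow> ('a \<Rightarrow> 'b) \<Rightarrow> 'a \<Rightarrow> nat" where
  "local_degree X Y f x = (THE k. locally_power_map X Y f x k)"

definition fibre :: "'a topology \<Rightarrow> ('a \<Rightarrow> 'b) \<Rightarrow> 'b \<Rightarrow> 'a set" where
  "fibre X f y = {x \<in> topspace X. f x = y}"

definition branching_points :: "'a topology \<Rightarrow> 'b topology \<Rightarrow> ('a \<Rightarrow> 'b) \<Rightarrow> 'b set" where
  "branching_points X Y f = {y \<in> topspace Y. \<exists>x\<in>fibre X f y. local_degree X Y f x > 1}"

(* The number of sheets over the complement of the branching points. *)
definition has_degree :: "'a topology \<Rightarrow> 'b topology \<Rightarrow> ('a \<Rightarrow> 'b) \<Rightarrow> nat \<Rightarrow> bool" where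
  "has_degree X Y f d \<longleftrightarrow>
     (\<forall>y\<in>topspace Y - branching_points X Y f. finite (fibre X f y) \<and> card (fibre X f y) = d)"

definition local_degrees_over ::
  "'a topology \<Rightarrow> 'b topology \<Rightarrow> ('a \<Rightarrow> 'b) \<Rightarrow> 'b \<Rightarrow> nat multiset" where
  "local_degrees_over X Y f y = image_mset (local_degree X Y f) (mset_set (fibre X f y))"

text \<open>Branch data\<close>

definition is_partition_of :: "nat multiset \<Rightarrow> nat \<Rightarrow> bool" where
  "is_partition_of P d \<longleftrightarrow> 0 \<notin># P \<and> sum_mset P = d"

(* X covers Y; the number n of branching points is the size of the multiset Ps. *)
definition candidate_surface_branched_cover ::
  "'a topology \<Rightarrow> 'b topology \<Rightarrow> nat \<Rightarrow> nat multiset multiset \<Rightarrow> bool" where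
  "candidate_surface_branched_cover X Y d Ps \<longleftrightarrow>
     closed_connected_surface X \<and> orientable_surface X \<and>
     closed_connected_surface Y \<and> orientable_surface Y \<and>
     d \<ge> 2 \<and> size Ps \<ge> 1 \<and> (\<forall>P\<in>#Ps. is_partition_of P d) \<and>
     euler_characteristic X - (\<Sum>P\<in>#Ps. int (size P)) =
       int d * (euler_characteristic Y - int (size Ps))"

definition realizable ::
  "'a topology \<Rightarrow> 'b topology \<Rightarrow> nat \<Rightarrow> nat multiset multiset \<Rightarrow> bool" where
  "realizable X Y d Ps \<longleftrightarrow>
     (\<exists>f. branched_cover X Y f \<and> has_degree X Y f d \<and> finite (branching_points X Y f) \<and>
          image_mset (local_degrees_over X Y f) (mset_set (branching_points X Y f)) = Ps)"

end

theory Submission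
  imports Defs "HOL-Complex_Analysis.Complex_Analysis" "HOL-Combinatorics.Permutations"
    "HOL-Computational_Algebra.Fundamental_Theorem_Algebra"
begin

text \<open>The sphere with three cone points of order 3 is the quotient of the plane by the group of
  rotations \<open>z \<mapsto> \<omega>\<^sup>j z + m\<close> with \<open>m \<in> \<int>[\<omega>]\<close>. If \<open>d = x\<^sup>2 + x y + y\<^sup>2\<close>, then \<open>d\<close> is the norm of
  \<open>\<alpha> = x - y \<omega>\<close>, and multiplication by \<open>\<alpha>\<close> descends to a map of degree \<open>d\<close> on the quotient. It is
  branched only over the cone points. Since \<open>3\<close> does not divide \<open>d\<close>, the fibre of a cone point
  contains exactly one cone point, which has local degree 1, and the other local degrees are 3.

  Conversely, cut the target along the arcs of a circle through the three branching points. Crossing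
  the arcs gives permutations \<open>a, b\<close> of the \<open>d\<close> sheets with \<open>a\<^sup>3 = b\<^sup>3 = (b a)\<^sup>3 = 1\<close> that generate a
  transitive group, and \<open>a\<close> has a fixed point. So this group is a quotient of the rotation group
  above, and the stabilizer of the fixed point in the translation lattice is an ideal of
  \<open>\<int>[\<omega>]\<close> of index \<open>d\<close>. It is principal, hence \<open>d\<close> is the norm of an Eisenstein integer, and
  multiplying that integer by a unit brings the norm into the required form.\<close>

section \<open>The two-sphere\<close>

text \<open>The charts of a branched cover are only topological, so a circle around a branching
  point may wind in an unknown way in its chart. Monodromy is encoded by continuous sections over
  slit planes: with the branching points at 0, 1 and infinity, the plane without two of the three
  real intervals is simply connected, and comparing two sections on the lower half plane permutes
  the fibre over \<open>\<i>\<close>. The relation between the three loops becomes an identity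
  between such comparisons.

  For the converse the quotient of the plane has to be exhibited as a sphere. The three characters
  used have product 1 and are permuted cyclically by omega; their sum E and the imaginary part t of
  their Vandermonde product map the quotient onto the surface \<open>t^2 = sextic E\<close> in
  \<open>complex \<times> real\<close>. This surface meets every ray from the origin exactly once,
  so radial projection gives the unit sphere. Degrees are counted arithmetically: a point of a fibre
  receives as many cosets modulo \<alpha> as its local degree, and the number of cosets is the norm
  of \<alpha>.\<close>

lemma int_rank_trivial_group:
  assumes "trivial_group G"
  shows "int_rank G = 0"
proof -
  interpret group G using assms by (simp add: trivial_group_def)
  have car: "carrier G = {\<one>\<^bsub>G\<^esub>}" using assms by (simp add: trivial_group_def)
  have "comm_group G"
    by (rule group_comm_groupI) (use car in auto)
  then interpret comm_group G .
  have ind0: "int_independent G {}" by (simp add: int_independent_def)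
  have "A = {}" if A: "int_independent G A" for A
  proof (rule ccontr)
    assume "A \<noteq> {}"
    with A car have "A = {\<one>\<^bsub>G\<^esub>}" by (auto simp: int_independent_def)
    moreover have "(\<Otimes>\<^bsub>G\<^esub>a\<in>{\<one>\<^bsub>G\<^esub>}. a [^]\<^bsub>G\<^esub> (1::int)) = \<one>\<^bsub>G\<^esub>" by simp
    ultimately show False using A unfolding int_independent_def
      by (auto dest: spec[of _ "\<lambda>_. 1"])
  qed
  with ind0 show ?thesis unfolding int_rank_def
    by (intro Greatest_equality) auto
qed

lemma int_rank_integer_group:
  assumes "comm_group G" "G \<cong> integer_group"
  shows "int_rank G = 1"
proof -
  interpret comm_group G by fact
  obtain h where h: "h \<in> iso G integer_group" using assms(2) by (auto simp: is_iso_def)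
  interpret gh: group_hom G integer_group h
    using h by (auto simp: group_hom_def group_hom_axioms_def iso_def)
  have inj: "inj_on h (carrier G)" and sur: "h ` carrier G = UNIV"
    using h by (auto simp: iso_def bij_betw_def)
  have hpow: "h (x [^]\<^bsub>G\<^esub> (n::int)) = h x * n" if "x \<in> carrier G" for x n
    using gh.hom_int_pow[OF that, of n] by simp
  have h0: "x = \<one>\<^bsub>G\<^esub>" if "x \<in> carrier G" "h x = 0" for x
    using inj that by (metis gh.hom_one inj_onD one_closed one_integer_group)
  obtain g where g: "g \<in> carrier G" "h g = 1" using sur by (metis UNIV_I image_iff)
  have "int_independent G {g}" unfolding int_independent_def
  proof (intro conjI allI impI)
    fix c :: "'a \<Rightarrow> int" assume "(\<Otimes>\<^bsub>G\<^esub>a\<in>{g}. a [^]\<^bsub>G\<^esub> c a) = \<one>\<^bsub>G\<^esub>"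
    then have "h (g [^]\<^bsub>G\<^esub> c g) = 0" using g by simp
    then show "\<forall>a\<in>{g}. c a = 0" using hpow[OF g(1)] g by simp
  qed (use g in auto)
  moreover have "card A \<le> 1" if fin: "finite A" and A: "int_independent G A" for A
  proof (rule ccontr)
    assume "\<not> card A \<le> 1"
    then obtain a b where ab: "a \<in> A" "b \<in> A" "a \<noteq> b"
      using card_le_Suc0_iff_eq fin by (metis One_nat_def)
    have AG: "A \<subseteq> carrier G" using A by (simp add: int_independent_def)
    \<comment> \<open>Under the isomorphism h this is the relation h a * h b - h b * h a = 0, which
      is non-trivial unless h a and h b both vanish.\<close>
    define c where "c = (\<lambda>x. if x = a then h b else if x = b then - h a else 0)"
    have "(\<Otimes>\<^bsub>G\<^esub>x\<in>A. x [^]\<^bsub>G\<^esub> c x) = (\<Otimes>\<^bsub>G\<^esub>x\<in>{a,b}. x [^]\<^bsub>G\<^esub> c x)"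
      using fin ab AG
      by (intro finprod_mono_neutral_cong) (auto simp: c_def Pi_def)
    also have "\<dots> = a [^]\<^bsub>G\<^esub> h b \<otimes>\<^bsub>G\<^esub> b [^]\<^bsub>G\<^esub> (- h a)"
      using ab AG by (subst finprod_insert) (auto simp: c_def Pi_def)
    also have "\<dots> = \<one>\<^bsub>G\<^esub>"
    proof (rule h0)
      have "a \<in> carrier G" "b \<in> carrier G" using ab AG by auto
      then show "h (a [^]\<^bsub>G\<^esub> h b \<otimes>\<^bsub>G\<^esub> b [^]\<^bsub>G\<^esub> (- h a)) = 0"
        by (simp only: gh.hom_mult int_pow_closed hpow) simp
    qed (use ab AG in auto)
    finally have "\<forall>x\<in>A. c x = 0" using A unfolding int_independent_def by blast
    then have "h a = 0" "h b = 0"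
      using ab by (auto simp: c_def dest: bspec[of A _ a] bspec[of A _ b])
    then show False using ab AG h0 by blast
  qed
  ultimately show ?thesis unfolding int_rank_def
    by (intro Greatest_equality) (auto intro!: exI[of _ "{g}"])
qed

text \<open>Gives a metric model: \<open>nsphere 2\<close> consists of functions
  \<open>nat \<Rightarrow> real\<close>, while \<open>complex \<times> real\<close> is a Euclidean
  space of dimension 3 with a complex coordinate, the form in which the quotient map will be
  written.\<close>

lemma homeomorphic_nsphere_2:
  obtains h g where "homeomorphic_maps (nsphere 2) (top_of_set (sphere (0::complex \<times> real) 1)) h g"
proof -
  have card: "card (Basis :: (complex \<times> real) set) = 3"
    by simp
  show ?thesis
    using homeomorphic_maps_nsphere_euclidean_sphere
      [OF independent_Basis, where 'n="complex \<times> real", OF orthogonal_Basis card _ norm_Basis] that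
    by auto
qed

lemma sphere_minus_point_homeomorphic_plane:
  assumes "p \<in> sphere (0::complex \<times> real) 1"
  shows "(sphere 0 1 - {p}) homeomorphic (UNIV :: complex set)"
  by (rule homeomorphic_punctured_sphere_affine) (use assms in \<open>auto simp: aff_dim_UNIV\<close>)

lemma nsphere_2_minus_point_homeomorphic_plane:
  assumes "x \<in> topspace (nsphere 2)"
  shows "subtopology (nsphere 2) (topspace (nsphere 2) - {x}) homeomorphic_space top_of_set (UNIV :: complex set)"
proof -
  let ?S = "sphere (0::complex \<times> real) 1"
  obtain h g where hg: "homeomorphic_maps (nsphere 2) (top_of_set ?S) h g"
    by (rule homeomorphic_nsphere_2)
  then have hm: "homeomorphic_map (nsphere 2) (top_of_set ?S) h"
    using homeomorphic_maps_map by blast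
  have hx: "h x \<in> ?S"
    using hm assms homeomorphic_imp_surjective_map by fastforce
  have inj: "inj_on h (topspace (nsphere 2))" and sur: "h ` topspace (nsphere 2) = ?S"
    using hm homeomorphic_imp_injective_map homeomorphic_imp_surjective_map by fastforce+
  have "homeomorphic_map (subtopology (nsphere 2) (topspace (nsphere 2) - {x}))
          (subtopology (top_of_set ?S) (?S - {h x})) h"
  proof (rule homeomorphic_map_subtopologies[OF hm])
    show "h ` (topspace (nsphere 2) \<inter> (topspace (nsphere 2) - {x})) = topspace (top_of_set ?S) \<inter> (?S - {h x})"
      using inj sur assms by (auto simp: inj_on_def)
  qed
  then have "subtopology (nsphere 2) (topspace (nsphere 2) - {x}) homeomorphic_space top_of_set (?S - {h x})"
    by (metis Diff_subset homeomorphic_map_imp_homeomorphic_space inf.absorb_iff2 subtopology_subtopology)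
  moreover have "top_of_set (?S - {h x}) homeomorphic_space top_of_set (UNIV :: complex set)"
  proof -
    obtain f f' where f: "homeomorphism (?S - {h x}) (UNIV :: complex set) f f'"
      using sphere_minus_point_homeomorphic_plane[OF hx] unfolding homeomorphic_def by blast
    then have "homeomorphic_maps (top_of_set (?S - {h x})) (top_of_set (UNIV :: complex set)) f f'"
      unfolding homeomorphic_maps_def homeomorphism_def continuous_map_in_subtopology
        by (simp, blast)
    then show ?thesis unfolding homeomorphic_space_def by (intro exI)
  qed
  ultimately show ?thesis by (rule homeomorphic_space_trans)
qed

lemma contractible_space_nsphere_2_minus_point:
  assumes "x \<in> topspace (nsphere 2)"
  shows "contractible_space (subtopology (nsphere 2) (topspace (nsphere 2) - {x}))"
  using homeomorphic_space_contractibility[OF nsphere_2_minus_point_homeomorphic_plane[OF assms]]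
  by (simp only: contractible_space_top_of_set contractible_UNIV)

lemma Hausdorff_nsphere_2: "Hausdorff_space (nsphere 2)"
proof -
  obtain h g where "homeomorphic_maps (nsphere 2) (top_of_set (sphere (0::complex \<times> real) 1)) h g"
    by (rule homeomorphic_nsphere_2)
  then have "nsphere 2 homeomorphic_space top_of_set (sphere (0::complex \<times> real) 1)"
    unfolding homeomorphic_space_def by blast
  then show ?thesis by (simp add: homeomorphic_Hausdorff_space Hausdorff_space_subtopology)
qed

lemma path_connected_space_nsphere_2: "path_connected_space (nsphere 2)"
proof -
  have "path_connected (sphere (0::complex \<times> real) 1)"
    by (rule path_connected_sphere) auto
  moreover obtain h g where "homeomorphic_maps (nsphere 2) (top_of_set (sphere (0::complex \<times> real) 1)) h g"
    by (rule homeomorphic_nsphere_2)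
  ultimately show ?thesis
    using homeomorphic_path_connected_space[of "nsphere 2"] path_connected_space_euclidean_subtopology
    unfolding homeomorphic_space_def by blast
qed

lemma betti_number_nsphere_2: "betti_number p (nsphere 2) = (if p = 0 \<or> p = 2 then 1 else 0)"
proof (cases "p = 0")
  case True
  have "homology_group 0 (nsphere 2) \<cong> integer_group"
    by (simp add: isomorphic_integer_zeroth_homology_group path_connected_space_nsphere_2)
  with True show ?thesis
    by (simp add: betti_number_def int_rank_integer_group)
next
  case False
  then have eq: "homology_group (int p) (nsphere 2) = reduced_homology_group (int p) (nsphere 2)"
    by (simp add: un_reduced_homology_group)
  show ?thesis
  proof (cases "p = 2")
    case True
    then have "homology_group (int p) (nsphere 2) \<cong> integer_group"
      using reduced_homology_group_nsphere(1)[of 2] eq by simp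
    with True show ?thesis
      by (simp add: betti_number_def int_rank_integer_group)
  next
    case p2: False
    then have "trivial_group (homology_group (int p) (nsphere 2))"
      using reduced_homology_group_nsphere(2)[of "int p" 2] eq by simp
    with p2 False show ?thesis
      by (simp add: betti_number_def int_rank_trivial_group)
  qed
qed

lemma euler_characteristic_nsphere_2: "euler_characteristic (nsphere 2) = 2"
proof -
  have "{p. betti_number p (nsphere 2) \<noteq> 0} = {0, 2}"
    by (auto simp: betti_number_nsphere_2)
  then show ?thesis
    by (simp add: euler_characteristic_def betti_number_nsphere_2)
qed

text \<open>Deleting a point leaves a contractible plane, so the map from H_2 of the sphere to each
  local group is an isomorphism. The images of one generator m are therefore local generators, and
  the whole sphere serves as the neighbourhood U of every point.\<close>

lemma orientable_surface_nsphere_2: "orientable_surface (nsphere 2)"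
proof -
  let ?X = "nsphere 2" let ?S = "topspace (nsphere 2)"
  let ?R = "\<lambda>x. relative_homology_group 2 ?X (?S - {x})"
  let ?i = "\<lambda>x. hom_induced 2 ?X {} ?X (?S - {x}) id"
  have "cyclic_group (homology_group 2 ?X)"
    using cyclic_reduced_homology_group_nsphere[of 2 2] by (simp add: un_reduced_homology_group)
  then obtain m where m: "m \<in> carrier (homology_group 2 ?X)"
     "generate (homology_group 2 ?X) {m} = carrier (homology_group 2 ?X)"
    unfolding cyclic_group_def
    by (metis carrier_subgroup_generated Int_absorb1 empty_subsetI insert_subset)
  have iso: "?i x \<in> iso (homology_group 2 ?X) (?R x)" if x: "x \<in> ?S" for x
  proof -
    \<comment> \<open>The isomorphism needs a non-empty contractible subspace, hence a second point;
      a one-point sphere would be contractible.\<close>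
    have "?S \<noteq> {x}"
      using non_contractible_space_nsphere[of 2] contractible_space_subtopology_singleton[of "nsphere 2" x]
      by (metis subtopology_topspace)
    then have "?S \<inter> (?S - {x}) \<noteq> {}"
      using x by blast
    then show ?thesis
      using iso_reduced_homology_by_contractible
        [OF contractible_space_nsphere_2_minus_point[OF x], of 2]
      by (simp add: un_reduced_homology_group)
  qed
  have "generate (?R x) {?i x m} = carrier (?R x)" if x: "x \<in> ?S" for x
  proof -
    interpret group_hom "homology_group 2 ?X" "?R x" "?i x"
      by (meson group_hom_axioms_def group_hom_def hom_induced_hom group_relative_homology_group)
    have "?i x ` generate (homology_group 2 ?X) {m} = generate (?R x) (?i x ` {m})"
      using m(1) by (intro generate_img[symmetric]) auto
    then show ?thesis using m(2) iso[OF x] by (auto simp: iso_def bij_betw_def)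
  qed
  moreover have "?i x m \<in> carrier (?R x)" for x
    by (simp add: hom_induced_carrier)
  ultimately show ?thesis
    unfolding orientable_surface_def using m(1)
    by (intro exI[of _ "\<lambda>x. ?i x m"] conjI ballI exI[of _ "?S"] bexI[of _ m]) simp_all
qed

section \<open>Local degrees\<close>

lemma homeomorphic_map_subtopology_preimage:
  assumes "homeomorphic_map (subtopology X U) (top_of_set D) \<phi>" "U \<subseteq> topspace X" "B \<subseteq> D"
  shows "homeomorphic_map (subtopology X {u\<in>U. \<phi> u \<in> B}) (top_of_set B) \<phi>"
proof -
  have im: "\<phi> ` U = D"
    using homeomorphic_imp_surjective_map[OF assms(1)] assms(2) by (simp add: Int_absorb1)
  have eq: "topspace (subtopology X U) \<inter> {u\<in>U. \<phi> u \<in> B} = {u\<in>U. \<phi> u \<in> B}"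
    "U \<inter> {u\<in>U. \<phi> u \<in> B} = {u\<in>U. \<phi> u \<in> B}" "D \<inter> B = B"
    using assms(2,3) by auto
  have "homeomorphic_map (subtopology (subtopology X U) {u\<in>U. \<phi> u \<in> B}) (subtopology (top_of_set D) B) \<phi>"
  proof (rule homeomorphic_map_subtopologies[OF assms(1)])
    show "\<phi> ` (topspace (subtopology X U) \<inter> {u\<in>U. \<phi> u \<in> B}) = topspace (top_of_set D) \<inter> B"
      unfolding eq topspace_euclidean_subtopology using im assms(3) by blast
  qed
  then show ?thesis unfolding subtopology_subtopology eq .
qed

lemma openin_chart_preimage:
  assumes "homeomorphic_map (subtopology X U) (top_of_set D) \<phi>" "openin X U" "open B"
  shows "openin X {u\<in>U. \<phi> u \<in> B}"
proof -
  have "continuous_map (subtopology X U) euclidean \<phi>"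
    using homeomorphic_imp_continuous_map[OF assms(1)] continuous_map_in_subtopology by blast
  then have "openin (subtopology X U) {u \<in> topspace (subtopology X U). \<phi> u \<in> B}"
    using assms(3) openin_continuous_map_preimage[of "subtopology X U" euclidean \<phi> B] by simp
  moreover have "topspace (subtopology X U) = U"
    using openin_subset[OF assms(2)] by auto
  ultimately have "openin (subtopology X U) {u \<in> U. \<phi> u \<in> B}" by metis
  then show ?thesis unfolding openin_open_subtopology[OF assms(2)] by simp
qed

lemma open_chart_image:
  assumes "homeomorphic_map (subtopology X U) (top_of_set D) \<phi>" "openin X U" "open D" "openin X W" "W \<subseteq> U"
  shows "open (\<phi> ` W)"
proof -
  have "openin (subtopology X U) W"
    using assms openin_open_subtopology[OF assms(2)] by simp
  then have "openin (top_of_set D) (\<phi> ` W)"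
    using homeomorphic_imp_open_map[OF assms(1)] by (auto simp: open_map_def)
  then show ?thesis using openin_open_eq[OF \<open>open D\<close>] by simp
qed

lemma locally_power_map_in_topspace:
  assumes "locally_power_map X Y f x k"
  shows "x \<in> topspace X" "f x \<in> topspace Y"
proof -
  obtain U V where "openin X U" "x \<in> U" "openin Y V" "f ` U \<subseteq> V"
    using assms unfolding locally_power_map_def by blast
  then show "x \<in> topspace X" "f x \<in> topspace Y"
    using openin_subset[of X U] openin_subset[of Y V] by auto
qed

text \<open>Charts are shrunk to round discs of the matching radii r and r^k. Then every k-th root
  of a point of the target disc lies in the source disc, which the counting of preimages relies on.
  W and N allow the discs to be as small as desired.\<close>

lemma locally_power_map_disc:
  assumes "locally_power_map X Y f x k" "openin X W" "x \<in> W" "openin Y N" "f x \<in> N"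
  obtains U V \<phi> \<psi> r where "r > 0" "openin X U" "x \<in> U" "U \<subseteq> W" "openin Y V" "f x \<in> V" "V \<subseteq> N"
    "homeomorphic_map (subtopology X U) (top_of_set (ball (0::complex) r)) \<phi>" "\<phi> x = 0"
    "homeomorphic_map (subtopology Y V) (top_of_set (ball (0::complex) (r ^ k))) \<psi>" "\<psi> (f x) = 0"
    "f ` U \<subseteq> V" "\<And>u. u \<in> U \<Longrightarrow> \<psi> (f u) = \<phi> u ^ k"
proof -
  from assms(1) obtain U V D E \<phi> \<psi> where 1: "k \<ge> 1" "openin X U" "x \<in> U" "openin Y V" "f ` U \<subseteq> V"
    "open (D :: complex set)" "open (E :: complex set)"
    "homeomorphic_map (subtopology X U) (top_of_set D) \<phi>" "\<phi> x = 0"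
    "homeomorphic_map (subtopology Y V) (top_of_set E) \<psi>" "\<psi> (f x) = 0"
    "\<forall>u\<in>U. \<psi> (f u) = \<phi> u ^ k"
    unfolding locally_power_map_def by (elim conjE exE)
  have UX: "U \<subseteq> topspace X" and VY: "V \<subseteq> topspace Y" using 1 by (auto dest: openin_subset)
  have imU: "\<phi> ` U = D" and imV: "\<psi> ` V = E"
    using homeomorphic_imp_surjective_map[OF 1(8)] homeomorphic_imp_surjective_map[OF 1(10)] UX VY
    by (simp_all add: Int_absorb1)
  have injU: "inj_on \<phi> U" and injV: "inj_on \<psi> V"
    using homeomorphic_imp_injective_map[OF 1(8)] homeomorphic_imp_injective_map[OF 1(10)] UX VY
    by (simp_all add: Int_absorb1)
  have fxV: "f x \<in> V" using 1 by auto
  have "open (\<phi> ` (U \<inter> W))" "open (\<psi> ` (V \<inter> N))"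
    by (rule open_chart_image[OF 1(8) 1(2) 1(6)] open_chart_image[OF 1(10) 1(4) 1(7)]; use 1 assms in auto)+
  moreover have "0 \<in> \<phi> ` (U \<inter> W)" "0 \<in> \<psi> ` (V \<inter> N)"
    using 1 assms fxV by (force intro: image_eqI[of _ \<phi> x] image_eqI[of _ \<psi> "f x"])+
  ultimately obtain r1 r2 where r12: "r1 > 0" "ball 0 r1 \<subseteq> \<phi> ` (U \<inter> W)" "r2 > 0" "ball 0 r2 \<subseteq> \<psi> ` (V \<inter> N)"
    by (meson openE)
  \<comment> \<open>The bound 1 gives r^k \<le> r, so that a single radius fits into both
    charts.\<close>
  define r where "r = min 1 (min r1 r2)"
  have r: "r > 0" "r \<le> 1" "r \<le> r1" "r \<le> r2" using r12 by (auto simp: r_def)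
  have rk: "r ^ k \<le> r2"
    using power_decreasing[of 1 k r] r 1(1) by simp
  define U' V' where "U' = {u\<in>U. \<phi> u \<in> ball 0 r}" and "V' = {v\<in>V. \<psi> v \<in> ball 0 (r^k)}"
  have sub: "ball 0 r \<subseteq> D" "ball 0 (r ^ k) \<subseteq> E"
    using r12 r rk imU imV subset_ball[of r r1 0] subset_ball[OF rk, of 0] by blast+
  show ?thesis
  proof
    show "r > 0" by (fact r(1))
    show "openin X U'" "openin Y V'" unfolding U'_def V'_def
      by (rule openin_chart_preimage; use 1 in auto)+
    show "x \<in> U'" "f x \<in> V'" using 1(3,9,11) r fxV by (simp_all add: U'_def V'_def)
    show "homeomorphic_map (subtopology X U') (top_of_set (ball (0::complex) r)) \<phi>"
      "homeomorphic_map (subtopology Y V') (top_of_set (ball (0::complex) (r^k))) \<psi>"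
      unfolding U'_def V'_def
      by (rule homeomorphic_map_subtopology_preimage; use 1 UX VY sub in blast)+
    show "U' \<subseteq> W"
    proof
      fix u assume u: "u \<in> U'"
      then have "\<phi> u \<in> \<phi> ` (U \<inter> W)" using r12 r by (auto simp: U'_def subset_iff)
      then obtain v where "v \<in> U \<inter> W" "\<phi> u = \<phi> v" by blast
      then show "u \<in> W" using u injU by (auto simp: U'_def inj_on_def)
    qed
    show "V' \<subseteq> N"
    proof
      fix u assume u: "u \<in> V'"
      then have "\<psi> u \<in> \<psi> ` (V \<inter> N)" using r12 rk by (auto simp: V'_def subset_iff)
      then obtain v where "v \<in> V \<inter> N" "\<psi> u = \<psi> v" by blast
      then show "u \<in> N" using u injV by (auto simp: V'_def inj_on_def)
    qed
    show "f ` U' \<subseteq> V'"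
      using 1 r by (auto simp: U'_def V'_def norm_power intro!: power_strict_mono)
  qed (use 1 in \<open>auto simp: U'_def\<close>)
qed

text \<open>A non-zero number has exactly k distinct k-th roots, so the local degree is the number
  of preimages of a nearby point. The last clause provides such points arbitrarily close to f x and
  thus keeps the count from being vacuous.\<close>

lemma locally_power_map_count:
  assumes "locally_power_map X Y f x k" "openin X W" "x \<in> W"
  obtains U V where "openin X U" "x \<in> U" "U \<subseteq> W" "openin Y V" "f x \<in> V"
    "\<And>y. y \<in> V \<Longrightarrow> y \<noteq> f x \<Longrightarrow> finite {u\<in>U. f u = y} \<and> card {u\<in>U. f u = y} = k"
    "\<And>N. openin Y N \<Longrightarrow> f x \<in> N \<Longrightarrow> \<exists>y\<in>N \<inter> V. y \<noteq> f x"
proof -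
  have k: "k \<ge> 1" using assms(1) by (simp add: locally_power_map_def)
  have oY: "openin Y (topspace Y)" by simp
  have fxY: "f x \<in> topspace Y"
    by (rule locally_power_map_in_topspace[OF assms(1)])
  obtain U V \<phi> \<psi> r where 1: "r > 0" "openin X U" "x \<in> U" "U \<subseteq> W" "openin Y V" "f x \<in> V"
    "homeomorphic_map (subtopology X U) (top_of_set (ball (0::complex) r)) \<phi>" "\<phi> x = 0"
    "homeomorphic_map (subtopology Y V) (top_of_set (ball (0::complex) (r ^ k))) \<psi>" "\<psi> (f x) = 0"
    "f ` U \<subseteq> V" "\<And>u. u \<in> U \<Longrightarrow> \<psi> (f u) = \<phi> u ^ k"
    by (rule locally_power_map_disc[OF assms oY fxY]) blast
  have UX: "U \<subseteq> topspace X" and VY: "V \<subseteq> topspace Y" using 1 by (auto dest: openin_subset)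
  have imU: "\<phi> ` U = ball 0 r" and imV: "\<psi> ` V = ball 0 (r^k)"
    using homeomorphic_imp_surjective_map[OF 1(7)] homeomorphic_imp_surjective_map[OF 1(9)] UX VY
    by (simp_all add: Int_absorb1)
  have injU: "inj_on \<phi> U" and injV: "inj_on \<psi> V"
    using homeomorphic_imp_injective_map[OF 1(7)] homeomorphic_imp_injective_map[OF 1(9)] UX VY
    by (simp_all add: Int_absorb1)
  show ?thesis
  proof
    fix y assume y: "y \<in> V" "y \<noteq> f x"
    then have nz: "\<psi> y \<noteq> 0" using injV 1(6,10) by (metis inj_onD)
    have "norm (\<psi> y) < r ^ k" using y imV by auto
    have bij: "bij_betw \<phi> {u\<in>U. f u = y} {z. z ^ k = \<psi> y}"
    proof (rule bij_betw_imageI)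
      show "inj_on \<phi> {u\<in>U. f u = y}" using injU by (auto simp: inj_on_def)
      show "\<phi> ` {u\<in>U. f u = y} = {z. z ^ k = \<psi> y}"
      proof (intro equalityI subsetI)
        fix z assume "z \<in> {z. z ^ k = \<psi> y}"
        then have zk: "z ^ k = \<psi> y" by simp
        then have "norm z ^ k < r ^ k" using \<open>norm (\<psi> y) < r ^ k\<close> by (metis norm_power)
        then have "norm z < r" using 1(1) power_less_imp_less_base less_imp_le by blast
        then obtain u where u: "u \<in> U" "\<phi> u = z" using imU by (metis imageE mem_ball_0)
        then have "\<psi> (f u) = \<psi> y" using 1 zk by simp
        then have "f u = y" using injV y u 1(11) by (meson image_subset_iff inj_onD)
        then show "z \<in> \<phi> ` {u\<in>U. f u = y}" using u by auto
      qed (use 1 in auto)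
    qed
    have "finite {z. z ^ k = \<psi> y}" "card {z. z ^ k = \<psi> y} = k"
      using k nz by (auto intro: finite_nth_roots card_nth_roots)
    then show "finite {u\<in>U. f u = y} \<and> card {u\<in>U. f u = y} = k"
      using bij_betw_finite[OF bij] bij_betw_same_card[OF bij] by simp
  next
    fix N assume N: "openin Y N" "f x \<in> N"
    have "open (\<psi> ` (V \<inter> N))" by (rule open_chart_image[OF 1(9)]) (use 1 N in auto)
    moreover have "0 \<in> \<psi> ` (V \<inter> N)" using 1 N by (force intro: image_eqI[of _ \<psi> "f x"])
    ultimately have "\<psi> ` (V \<inter> N) \<noteq> {0}" using not_open_singleton by metis
    then obtain w where "w \<in> \<psi> ` (V \<inter> N)" "w \<noteq> 0" using \<open>0 \<in> \<psi> ` (V \<inter> N)\<close> by blast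
    then obtain y where "y \<in> V" "y \<in> N" "\<psi> y \<noteq> 0" by blast
    moreover have "\<psi> (f x) = 0" by fact
    ultimately have "y \<in> N \<inter> V" "y \<noteq> f x" by auto
    then show "\<exists>y\<in>N \<inter> V. y \<noteq> f x" by blast
  qed (use 1 in auto)
qed

text \<open>The neighbourhood for k is chosen inside the one for l, so a common nearby value has at
  most as many preimages in it. By symmetry the exponent is unique, which makes the description in
  \<open>local_degree\<close> meaningful.\<close>

lemma locally_power_map_le:
  assumes "locally_power_map X Y f x k" "locally_power_map X Y f x l"
  shows "k \<le> l"
proof -
  have "x \<in> topspace X"
    by (rule locally_power_map_in_topspace[OF assms(1)])
  then obtain U V where U: "openin X U" "x \<in> U" "openin Y V" "f x \<in> V"
    "\<And>y. y \<in> V \<Longrightarrow> y \<noteq> f x \<Longrightarrow> finite {u\<in>U. f u = y} \<and> card {u\<in>U. f u = y} = l"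
    by (rule locally_power_map_count[OF assms(2) openin_topspace]) blast
  obtain U' V' where U': "openin X U'" "x \<in> U'" "U' \<subseteq> U" "openin Y V'" "f x \<in> V'"
    "\<And>y. y \<in> V' \<Longrightarrow> y \<noteq> f x \<Longrightarrow> finite {u\<in>U'. f u = y} \<and> card {u\<in>U'. f u = y} = k"
    "\<And>N. openin Y N \<Longrightarrow> f x \<in> N \<Longrightarrow> \<exists>y\<in>N \<inter> V'. y \<noteq> f x"
    by (rule locally_power_map_count[OF assms(1) U(1,2)]) blast
  obtain y where y: "y \<in> V" "y \<in> V'" "y \<noteq> f x" using U'(7)[OF U(3,4)] by blast
  have "card {u\<in>U'. f u = y} \<le> card {u\<in>U. f u = y}"
    using U(5)[OF y(1,3)] U'(3) by (intro card_mono) auto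
  then show ?thesis using U(5)[OF y(1,3)] U'(6)[OF y(2,3)] by simp
qed

lemma local_degree_eq:
  "locally_power_map X Y f x k \<Longrightarrow> local_degree X Y f x = k"
  unfolding local_degree_def
  by (rule the_equality) (auto intro: antisym locally_power_map_le[of X Y f x])

lemma branched_cover_local_degree:
  assumes "branched_cover X Y f" "x \<in> topspace X"
  shows "locally_power_map X Y f x (local_degree X Y f x)"
  using assms local_degree_eq unfolding branched_cover_def by metis

lemma locally_power_map_homeomorphic:
  assumes X: "homeomorphic_maps X X' h h'" and Y: "homeomorphic_maps Y Y' g g'"
    and "locally_power_map X Y f x k"
  shows "locally_power_map X' Y' (g \<circ> f \<circ> h') (h x) k"
proof -
  from assms(3) obtain U V D E \<phi> \<psi> where 1: "k \<ge> 1" "openin X U" "x \<in> U" "openin Y V" "f ` U \<subseteq> V"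
    "open (D :: complex set)" "open (E :: complex set)"
    "homeomorphic_map (subtopology X U) (top_of_set D) \<phi>" "\<phi> x = 0"
    "homeomorphic_map (subtopology Y V) (top_of_set E) \<psi>" "\<psi> (f x) = 0"
    "\<forall>u\<in>U. \<psi> (f u) = \<phi> u ^ k"
    unfolding locally_power_map_def by (elim conjE exE)
  have UX: "U \<subseteq> topspace X" and VY: "V \<subseteq> topspace Y" using 1 by (auto dest: openin_subset)
  have hh: "\<And>u. u \<in> U \<Longrightarrow> h' (h u) = u" "\<And>v. v \<in> V \<Longrightarrow> g' (g v) = v"
    using X Y UX VY by (auto simp: homeomorphic_maps_def)
  have transfer: "homeomorphic_map (subtopology A' (p ` W)) (top_of_set F) (q \<circ> p')"
    if "homeomorphic_maps A A' p p'" "W \<subseteq> topspace A" "homeomorphic_map (subtopology A W) (top_of_set F) q"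
    for A :: "'e topology" and A' :: "'f topology" and p p' W and F :: "complex set" and q
  proof (rule homeomorphic_map_compose[OF _ that(3)])
    show "homeomorphic_map (subtopology A' (p ` W)) (subtopology A W) p'"
    proof (rule homeomorphic_map_subtopologies)
      show "homeomorphic_map A' A p'" using that(1) homeomorphic_maps_map by blast
      have "p ` W \<subseteq> topspace A'" using that(1,2)
        by (auto simp: homeomorphic_maps_def continuous_map_def)
      moreover have "p' ` p ` W = W"
        using that(1,2) by (force simp: homeomorphic_maps_def image_iff)
      ultimately show "p' ` (topspace A' \<inter> p ` W) = topspace A \<inter> W"
        using that(2) by (simp add: Int_absorb1)
    qed
  qed
  have "openin X' (h ` U)" "openin Y' (g ` V)"
    using X Y 1 homeomorphic_map_openness_eq by (metis homeomorphic_maps_map)+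
  then show ?thesis unfolding locally_power_map_def
    using transfer[OF X UX 1(8)] transfer[OF Y VY 1(10)] 1 hh
    by (intro conjI exI[of _ "h ` U"] exI[of _ "g ` V"] exI[of _ D] exI[of _ E]
        exI[of _ "\<phi> \<circ> h'"] exI[of _ "\<psi> \<circ> g'"]) auto
qed

text \<open>Conjugation by the homeomorphisms carries charts, fibres and local degrees along. This
  allows \<open>nsphere 2\<close> to be replaced by the unit sphere of
  \<open>complex \<times> real\<close> in both directions of the theorem.\<close>

lemma realizable_homeomorphic_maps:
  assumes X: "homeomorphic_maps X X' h h'" and Y: "homeomorphic_maps Y Y' g g'"
    and "realizable X Y d Ps"
  shows "realizable X' Y' d Ps"
proof -
  obtain f where f: "branched_cover X Y f" "has_degree X Y f d" "finite (branching_points X Y f)"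
     "image_mset (local_degrees_over X Y f) (mset_set (branching_points X Y f)) = Ps"
    using assms(3) unfolding realizable_def by blast
  define f' where "f' = g \<circ> f \<circ> h'"
  have cf: "continuous_map X Y f" using f by (simp add: branched_cover_def)
  have hX: "h ` topspace X = topspace X'" and gY: "g ` topspace Y = topspace Y'"
    using X Y by (metis homeomorphic_maps_map homeomorphic_imp_surjective_map)+
  have injh: "inj_on h (topspace X)" and injg: "inj_on g (topspace Y)"
    using X Y by (metis homeomorphic_maps_map homeomorphic_imp_injective_map)+
  have hh: "\<And>x. x \<in> topspace X \<Longrightarrow> h' (h x) = x" "\<And>y. y \<in> topspace Y \<Longrightarrow> g' (g y) = y"
    using X Y by (auto simp: homeomorphic_maps_def)
  have fY: "f x \<in> topspace Y" if "x \<in> topspace X" for x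
    using cf that by (auto simp: continuous_map_def)
  have lpm: "locally_power_map X' Y' f' (h x) (local_degree X Y f x)" if "x \<in> topspace X" for x
    unfolding f'_def
    by (rule locally_power_map_homeomorphic[OF X Y branched_cover_local_degree[OF f(1) that]])
  have ld: "local_degree X' Y' f' (h x) = local_degree X Y f x" if "x \<in> topspace X" for x
    by (rule local_degree_eq, rule lpm, rule that)
  have f'h: "f' (h x) = g (f x)" if "x \<in> topspace X" for x
    using that hh by (simp add: f'_def)
  have fib: "fibre X' f' (g y) = h ` fibre X f y" if "y \<in> topspace Y" for y
  proof -
    have "(f' (h x) = g y) = (f x = y)" if "x \<in> topspace X" for x
      using f'h[OF that] injg fY[OF that] \<open>y \<in> topspace Y\<close> by (metis inj_onD)
    then show ?thesis unfolding fibre_def hX[symmetric] by auto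
  qed
  have fsub: "fibre X f y \<subseteq> topspace X" for y by (auto simp: fibre_def)
  then have injf: "inj_on h (fibre X f y)" for y using injh inj_on_subset by blast
  have "branching_points X' Y' f' = g ` {y \<in> topspace Y. \<exists>x\<in>fibre X' f' (g y). local_degree X' Y' f' x > 1}"
    unfolding branching_points_def gY[symmetric] by blast
  also have "\<dots> = g ` branching_points X Y f"
  proof -
    have "(\<exists>x\<in>fibre X' f' (g y). local_degree X' Y' f' x > 1) \<longleftrightarrow> (\<exists>x\<in>fibre X f y. local_degree X Y f x > 1)"
      if "y \<in> topspace Y" for y
      using fib[OF that] ld fsub[of y] by (auto simp: subset_iff)
    then show ?thesis unfolding branching_points_def by (intro arg_cong[where f="image g"]) blast
  qed
  finally have bp: "branching_points X' Y' f' = g ` branching_points X Y f" .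
  have bsub: "branching_points X Y f \<subseteq> topspace Y" by (auto simp: branching_points_def)
  have lo: "local_degrees_over X' Y' f' (g y) = local_degrees_over X Y f y" if "y \<in> topspace Y" for y
  proof -
    have "local_degrees_over X' Y' f' (g y) = image_mset (local_degree X' Y' f') (image_mset h (mset_set (fibre X f y)))"
      unfolding local_degrees_over_def fib[OF that] by (simp add: image_mset_mset_set[OF injf])
    also have "\<dots> = local_degrees_over X Y f y"
      unfolding local_degrees_over_def multiset.map_comp
    proof (rule image_mset_cong)
      fix x assume "x \<in># mset_set (fibre X f y)"
      then have "x \<in> topspace X" using fsub elem_mset_set
        by (metis mset_set.infinite empty_iff set_mset_empty subsetD)
      then show "(local_degree X' Y' f' \<circ> h) x = local_degree X Y f x" by (simp add: ld)
    qed
    finally show ?thesis .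
  qed
  have "branched_cover X' Y' f'"
    unfolding branched_cover_def
  proof
    have "continuous_map X' X h'" "continuous_map Y Y' g"
      using X Y by (auto simp: homeomorphic_maps_def)
    then show "continuous_map X' Y' f'" unfolding f'_def
      using continuous_map_compose[OF _ continuous_map_compose[OF cf]] by (simp add: comp_assoc)
    show "\<forall>x\<in>topspace X'. \<exists>k. locally_power_map X' Y' f' x k"
      unfolding hX[symmetric] using lpm by blast
  qed
  moreover have "has_degree X' Y' f' d"
    unfolding has_degree_def
  proof
    fix z assume z: "z \<in> topspace Y' - branching_points X' Y' f'"
    then obtain y where y: "y \<in> topspace Y" "z = g y" using gY by blast
    then have "y \<in> topspace Y - branching_points X Y f" using z bp by auto
    then have "finite (fibre X f y) \<and> card (fibre X f y) = d"
      using f(2) by (auto simp: has_degree_def)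
    then show "finite (fibre X' f' z) \<and> card (fibre X' f' z) = d"
      using fib[OF y(1)] y(2) injf card_image by fastforce
  qed
  moreover have "finite (branching_points X' Y' f')" using bp f(3) by simp
  moreover have "image_mset (local_degrees_over X' Y' f') (mset_set (branching_points X' Y' f')) = Ps"
  proof -
    have "inj_on g (branching_points X Y f)" using injg bsub inj_on_subset by blast
    then have "image_mset (local_degrees_over X' Y' f') (mset_set (branching_points X' Y' f'))
        = image_mset (local_degrees_over X' Y' f' \<circ> g) (mset_set (branching_points X Y f))"
      unfolding bp by (simp add: image_mset_mset_set[symmetric] multiset.map_comp)
    also have "\<dots> = Ps" unfolding f(4)[symmetric]
      using lo bsub f(3) by (intro image_mset_cong) auto
    finally show ?thesis .
  qed
  ultimately show ?thesis unfolding realizable_def by blast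
qed

section \<open>Eisenstein integers\<close>

definition omega :: complex where "omega = Complex (-1/2) (sqrt 3 / 2)"

text \<open>Together with \<open>coord2\<close> these are the real coordinates of z in the basis 1,
  \<open>omega\<close>.\<close>

definition coord1 :: "complex \<Rightarrow> real" where "coord1 z = Re z + Im z / sqrt 3"
definition coord2 :: "complex \<Rightarrow> real" where "coord2 z = 2 * Im z / sqrt 3"

definition eisenstein :: "complex set" where
  "eisenstein = {z. coord1 z \<in> \<int> \<and> coord2 z \<in> \<int>}"

definition eisenstein_ideal :: "complex \<Rightarrow> complex set" where
  "eisenstein_ideal \<alpha> = (*) \<alpha> ` eisenstein"

lemma omega_sq: "omega * omega = - 1 - omega"
  by (simp add: omega_def complex_eq_iff field_simps)

lemma omega_cubed: "omega ^ 3 = 1"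
proof -
  have "omega ^ 3 = omega * (omega * omega)" by (simp add: power3_eq_cube)
  also have "\<dots> = omega * (- 1 - omega)" by (simp only: omega_sq)
  also have "\<dots> = - omega - omega * omega" by (simp add: algebra_simps)
  finally show ?thesis by (simp add: omega_sq)
qed

lemma norm_omega: "cmod omega = 1"
  by (simp add: omega_def cmod_def power2_eq_square field_simps)

lemma omega_neq: "omega \<noteq> 0" "omega \<noteq> 1"
  by (auto simp: omega_def complex_eq_iff)

lemma coord_add [simp]: "coord1 (z + w) = coord1 z + coord1 w" "coord2 (z + w) = coord2 z + coord2 w"
  and coord_diff [simp]: "coord1 (z - w) = coord1 z - coord1 w" "coord2 (z - w) = coord2 z - coord2 w"
  and coord_minus [simp]: "coord1 (- z) = - coord1 z" "coord2 (- z) = - coord2 z"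
  and coord_scale [simp]: "coord1 (of_real r * z) = r * coord1 z" "coord2 (of_real r * z) = r * coord2 z"
  and coord_real [simp]: "coord1 (of_real r) = r" "coord2 (of_real r) = 0"
  and coord_zero [simp]: "coord1 0 = 0" "coord2 0 = 0"
  and coord_one [simp]: "coord1 1 = 1" "coord2 1 = 0"
  and coord_omega [simp]: "coord1 omega = 0" "coord2 omega = 1"
  by (auto simp: coord1_def coord2_def omega_def field_simps)

lemma coord_int [simp]:
  "coord1 (of_int n) = of_int n" "coord2 (of_int n) = 0"
  "coord1 (of_nat k) = of_nat k" "coord2 (of_nat k) = 0"
  "coord1 (of_int n * z) = of_int n * coord1 z" "coord2 (of_int n * z) = of_int n * coord2 z"
  "coord1 (of_nat k * z) = of_nat k * coord1 z" "coord2 (of_nat k * z) = of_nat k * coord2 z"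
  by (simp_all add: coord1_def coord2_def field_simps)

lemma coord_expand: "z = of_real (coord1 z) + of_real (coord2 z) * omega"
  by (simp add: coord1_def coord2_def omega_def complex_eq_iff field_simps)

lemma coord_mult:
  "coord1 (z * w) = coord1 z * coord1 w - coord2 z * coord2 w"
  "coord2 (z * w) = coord1 z * coord2 w + coord2 z * coord1 w - coord2 z * coord2 w"
proof -
  define x y x' y' where "x = coord1 z" "y = coord2 z" "x' = coord1 w" "y' = coord2 w"
  have "z * w = (of_real x + of_real y * omega) * (of_real x' + of_real y' * omega)"
    unfolding x_y_x'_y'_def by (simp flip: coord_expand)
  also have "\<dots> = of_real (x * x') + of_real (x * y' + y * x') * omega + of_real (y * y') * (omega * omega)"
    by (simp add: algebra_simps)
  also have "\<dots> = of_real (x * x' - y * y') + of_real (x * y' + y * x' - y * y') * omega"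
    by (simp add: omega_sq algebra_simps)
  finally have "z * w = of_real (x * x' - y * y') + of_real (x * y' + y * x' - y * y') * omega" .
  then show "coord1 (z * w) = coord1 z * coord1 w - coord2 z * coord2 w"
    "coord2 (z * w) = coord1 z * coord2 w + coord2 z * coord1 w - coord2 z * coord2 w"
    by (simp_all only: coord_add coord_scale coord_real coord_omega x_y_x'_y'_def) simp_all
qed

lemma coord_cnj: "coord1 (cnj z) = coord1 z - coord2 z" "coord2 (cnj z) = - coord2 z"
  by (auto simp: coord1_def coord2_def field_simps)

lemma norm_coord: "(cmod z)\<^sup>2 = (coord1 z)\<^sup>2 - coord1 z * coord2 z + (coord2 z)\<^sup>2"
proof -
  define b where "b = Im z / sqrt 3"
  have "Im z = sqrt 3 * b" by (simp add: b_def)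
  then have "(Im z)\<^sup>2 = 3 * b\<^sup>2" by (simp add: power_mult_distrib)
  moreover have "coord1 z = Re z + b" "coord2 z = 2 * b"
    by (simp_all add: coord1_def coord2_def b_def)
  ultimately show ?thesis unfolding cmod_power2
    by (simp add: power2_eq_square algebra_simps)
qed

lemma eisenstein_ring [simp]:
  "0 \<in> eisenstein" "1 \<in> eisenstein" "omega \<in> eisenstein"
  "z \<in> eisenstein \<Longrightarrow> w \<in> eisenstein \<Longrightarrow> z + w \<in> eisenstein"
  "z \<in> eisenstein \<Longrightarrow> w \<in> eisenstein \<Longrightarrow> z - w \<in> eisenstein"
  "z \<in> eisenstein \<Longrightarrow> w \<in> eisenstein \<Longrightarrow> z * w \<in> eisenstein"
  "z \<in> eisenstein \<Longrightarrow> - z \<in> eisenstein"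
  "z \<in> eisenstein \<Longrightarrow> cnj z \<in> eisenstein"
  by (auto simp: eisenstein_def coord_mult coord_cnj)

lemma eisenstein_of_int [simp]: "of_int n \<in> eisenstein" "of_nat m \<in> eisenstein"
  using coord_real[of "of_int n"] coord_real[of "of_nat m"] by (simp_all add: eisenstein_def)

lemma eisensteinE:
  assumes "z \<in> eisenstein"
  obtains m n :: int where "z = of_int m + of_int n * omega" "coord1 z = of_int m" "coord2 z = of_int n"
  using assms coord_expand[of z] by (auto simp: eisenstein_def elim!: Ints_cases)

lemma eisenstein_idealI: "e \<in> eisenstein \<Longrightarrow> \<alpha> * e \<in> eisenstein_ideal \<alpha>"
  by (auto simp: eisenstein_ideal_def)

lemma eisenstein_idealE:
  assumes "z \<in> eisenstein_ideal \<alpha>"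
  obtains e where "e \<in> eisenstein" "z = \<alpha> * e"
  using assms unfolding eisenstein_ideal_def by blast

lemma eisenstein_ideal_closed:
  shows "0 \<in> eisenstein_ideal \<alpha>"
    and "z \<in> eisenstein_ideal \<alpha> \<Longrightarrow> w \<in> eisenstein_ideal \<alpha> \<Longrightarrow> z + w \<in> eisenstein_ideal \<alpha>"
    and "z \<in> eisenstein_ideal \<alpha> \<Longrightarrow> w \<in> eisenstein_ideal \<alpha> \<Longrightarrow> z - w \<in> eisenstein_ideal \<alpha>"
    and "z \<in> eisenstein_ideal \<alpha> \<Longrightarrow> - z \<in> eisenstein_ideal \<alpha>"
proof -
  show "0 \<in> eisenstein_ideal \<alpha>" using eisenstein_idealI[of 0 \<alpha>] by simp
  show "z + w \<in> eisenstein_ideal \<alpha>" if "z \<in> eisenstein_ideal \<alpha>" "w \<in> eisenstein_ideal \<alpha>"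
    using that by (metis eisenstein_idealE eisenstein_idealI eisenstein_ring(4) distrib_left)
  show "z - w \<in> eisenstein_ideal \<alpha>" if "z \<in> eisenstein_ideal \<alpha>" "w \<in> eisenstein_ideal \<alpha>"
    using that by (metis eisenstein_idealE eisenstein_idealI eisenstein_ring(5) right_diff_distrib)
  show "- z \<in> eisenstein_ideal \<alpha>" if "z \<in> eisenstein_ideal \<alpha>"
    using that by (metis eisenstein_idealE eisenstein_idealI eisenstein_ring(7) mult_minus_right)
qed

section \<open>The index of a principal ideal of Eisenstein integers is the norm of its
  generator\<close>

text \<open>A complete system of representatives modulo \<alpha>. Indices are thus cardinalities of
  sets of complex numbers, and no quotient ring has to be formed.\<close>

definition transversal :: "complex \<Rightarrow> complex set \<Rightarrow> bool" where
  "transversal \<alpha> R \<longleftrightarrow> R \<subseteq> eisenstein \<and> (\<forall>z\<in>eisenstein. \<exists>!r. r \<in> R \<and> z - r \<in> eisenstein_ideal \<alpha>)"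

lemma transversal_ex:
  assumes "transversal \<alpha> R" "z \<in> eisenstein"
  obtains r where "r \<in> R" "z - r \<in> eisenstein_ideal \<alpha>"
  using assms unfolding transversal_def by blast

lemma transversal_unique:
  assumes "transversal \<alpha> R" "r \<in> R" "s \<in> R" "r - s \<in> eisenstein_ideal \<alpha>"
  shows "r = s"
proof -
  have "r \<in> eisenstein" using assms by (auto simp: transversal_def)
  moreover have "r - r \<in> eisenstein_ideal \<alpha>" by (simp add: eisenstein_ideal_closed)
  ultimately show ?thesis using assms unfolding transversal_def by metis
qed

text \<open>A map whose fibres on the Eisenstein integers are the cosets of the ideal factors
  injectively through them. This is how an orbit and the set of cone points are counted
  later.\<close>

lemma transversal_bij_betw:
  assumes "transversal \<alpha> R"
    and q: "\<And>z w. z \<in> eisenstein \<Longrightarrow> w \<in> eisenstein \<Longrightarrow> q z = q w \<longleftrightarrow> z - w \<in> eisenstein_ideal \<alpha>"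
  shows "bij_betw q R (q ` eisenstein)"
proof (rule bij_betw_imageI)
  have R: "R \<subseteq> eisenstein" using assms(1) by (simp add: transversal_def)
  show "inj_on q R"
  proof (rule inj_onI)
    fix r s assume rs: "r \<in> R" "s \<in> R" "q r = q s"
    then have "r - s \<in> eisenstein_ideal \<alpha>" using q R by blast
    then show "r = s" using transversal_unique[OF assms(1)] rs by blast
  qed
  show "q ` R = q ` eisenstein"
  proof
    show "q ` eisenstein \<subseteq> q ` R"
    proof
      fix y assume "y \<in> q ` eisenstein"
      then obtain z where z: "z \<in> eisenstein" "y = q z" by blast
      obtain r where "r \<in> R" "z - r \<in> eisenstein_ideal \<alpha>"
        by (rule transversal_ex[OF assms(1) z(1)])
      then show "y \<in> q ` R" using q z R by (metis image_eqI subsetD)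
    qed
  qed (use R in blast)
qed

lemma transversal_card_unique:
  assumes "transversal \<alpha> R" "transversal \<alpha> S"
  shows "card R = card S"
proof -
  define q where "q z = {w \<in> eisenstein. w - z \<in> eisenstein_ideal \<alpha>}" for z
  have "q z = q w \<longleftrightarrow> z - w \<in> eisenstein_ideal \<alpha>" if "z \<in> eisenstein" "w \<in> eisenstein" for z w
  proof
    assume "q z = q w"
    moreover have "z \<in> q z" using that by (simp add: q_def eisenstein_ideal_closed)
    ultimately show "z - w \<in> eisenstein_ideal \<alpha>" by (simp add: q_def)
  next
    assume zw: "z - w \<in> eisenstein_ideal \<alpha>"
    have "(x - z \<in> eisenstein_ideal \<alpha>) = (x - w \<in> eisenstein_ideal \<alpha>)" for x
      using eisenstein_ideal_closed(2)[OF _ zw, of "x - z"] eisenstein_ideal_closed(3)[OF _ zw, of "x - w"]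
        by auto
    then show "q z = q w" by (simp add: q_def)
  qed
  then show ?thesis
    using transversal_bij_betw[OF assms(1), of q] transversal_bij_betw[OF assms(2), of q]
    by (metis bij_betw_same_card)
qed

text \<open>Divisibility by an ordinary integer n can be tested on each coordinate separately, so
  pairs of residues modulo n represent the cosets.\<close>

lemma transversal_of_nat:
  assumes "n > 0"
  shows "transversal (of_nat n) ((\<lambda>(i, j). of_nat i + of_nat j * omega) ` ({..<n} \<times> {..<n}))"
    (is "transversal _ (?f ` _)")
  unfolding transversal_def
proof (intro conjI ballI)
  show "?f ` ({..<n} \<times> {..<n}) \<subseteq> eisenstein" by auto
  fix z assume "z \<in> eisenstein"
  then obtain k l where z: "z = of_int k + of_int l * omega" "coord1 z = of_int k" "coord2 z = of_int l"
    by (rule eisensteinE)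
  have iff: "z - ?f (i, j) \<in> eisenstein_ideal (of_nat n) \<longleftrightarrow> int n dvd k - int i \<and> int n dvd l - int j" for i j
  proof
    assume "z - ?f (i, j) \<in> eisenstein_ideal (of_nat n)"
    then obtain e where e: "e \<in> eisenstein" "z - ?f (i, j) = of_nat n * e"
      by (auto simp: eisenstein_ideal_def)
    obtain p q where pq: "coord1 e = of_int p" "coord2 e = of_int q"
      using e(1) by (auto elim: eisensteinE)
    have "coord1 (z - ?f (i, j)) = n * coord1 e" "coord2 (z - ?f (i, j)) = n * coord2 e"
      unfolding e(2) by simp_all
    then have "coord1 z - i = n * coord1 e" "coord2 z - j = n * coord2 e" by simp_all
    then have "real_of_int (k - int i) = of_int (int n * p)" "real_of_int (l - int j) = of_int (int n * q)"
      unfolding z(2,3) pq by simp_all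
    then show "int n dvd k - int i \<and> int n dvd l - int j" by (simp only: of_int_eq_iff) simp
  next
    assume "int n dvd k - int i \<and> int n dvd l - int j"
    then obtain p q where "k - int i = int n * p" "l - int j = int n * q" by (auto elim!: dvdE)
    then have "k = int i + int n * p" "l = int j + int n * q" by linarith+
    then have "z - ?f (i, j) = of_nat n * (of_int p + of_int q * omega)"
      by (simp add: z(1) algebra_simps)
    then show "z - ?f (i, j) \<in> eisenstein_ideal (of_nat n)" by (simp add: eisenstein_idealI)
  qed
  have res: "int n dvd k - int i \<longleftrightarrow> i = nat (k mod int n)" if "i < n" for k i
  proof -
    have "int n dvd k - int i \<longleftrightarrow> k mod int n = int i mod int n" by (simp add: mod_eq_dvd_iff)
    then show ?thesis using that assms by auto
  qed
  have lt: "nat (k mod int n) < n" for k using assms by (simp add: nat_less_iff)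
  show "\<exists>!r. r \<in> ?f ` ({..<n} \<times> {..<n}) \<and> z - r \<in> eisenstein_ideal (of_nat n)"
  proof (rule ex1I[of _ "?f (nat (k mod int n), nat (l mod int n))"])
    show "?f (nat (k mod int n), nat (l mod int n)) \<in> ?f ` ({..<n} \<times> {..<n}) \<and>
      z - ?f (nat (k mod int n), nat (l mod int n)) \<in> eisenstein_ideal (of_nat n)"
      unfolding iff using lt res[OF lt] by blast
    fix r assume "r \<in> ?f ` ({..<n} \<times> {..<n}) \<and> z - r \<in> eisenstein_ideal (of_nat n)"
    then obtain ij where "ij \<in> {..<n} \<times> {..<n}" "r = ?f ij" "z - ?f ij \<in> eisenstein_ideal (of_nat n)"
      by blast
    moreover obtain i j where "ij = (i, j)" by (cases ij)
    ultimately have ij: "i < n" "j < n" "r = ?f (i, j)" "z - ?f (i, j) \<in> eisenstein_ideal (of_nat n)"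
      by simp_all
    then show "r = ?f (nat (k mod int n), nat (l mod int n))"
      using res[OF ij(1), of k] res[OF ij(2), of l] unfolding iff by blast
  qed
qed

lemma card_transversal_of_nat:
  "card ((\<lambda>(i, j). of_nat i + of_nat j * omega) ` ({..<n} \<times> {..<n})) = n * n"
proof -
  have "i = i' \<and> j = j'" if "of_nat i + of_nat j * omega = of_nat i' + of_nat j' * omega" for i j i' j' :: nat
  proof -
    have cf: "coord1 (of_nat i + of_nat j * omega) = i" "coord2 (of_nat i + of_nat j * omega) = j" for i j :: nat
      by simp_all
    show ?thesis
      using arg_cong[OF that, of coord1] arg_cong[OF that, of coord2] by (simp only: cf) simp
  qed
  then have "inj_on (\<lambda>(i, j). of_nat i + of_nat j * omega) ({..<n} \<times> {..<n})"
    by (auto simp: inj_on_def)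
  then show ?thesis by (simp add: card_image)
qed

text \<open>Multiplication by \<alpha> identifies the cosets modulo \<beta> with the cosets of the
  ideal of \<alpha> * \<beta> inside that of \<alpha>. A class is fixed by its residue r modulo
  \<alpha> and then by a residue s modulo \<beta>, so indices multiply.\<close>

lemma transversal_mult:
  assumes "\<alpha> \<noteq> 0" "\<alpha> \<in> eisenstein" and R: "transversal \<alpha> R" and beta: "\<beta> \<in> eisenstein" and S: "transversal \<beta> S"
  shows "transversal (\<alpha> * \<beta>) ((\<lambda>(r, s). r + \<alpha> * s) ` (R \<times> S))"
    and "card ((\<lambda>(r, s). r + \<alpha> * s) ` (R \<times> S)) = card R * card S"
proof -
  have RS: "R \<subseteq> eisenstein" "S \<subseteq> eisenstein" using R S by (auto simp: transversal_def)
  have uniq: "r = r' \<and> s = s'"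
    if u: "r \<in> R" "r' \<in> R" "s \<in> S" "s' \<in> S" "(r + \<alpha> * s) - (r' + \<alpha> * s') \<in> eisenstein_ideal (\<alpha> * \<beta>)" for r r' s s'
  proof -
    obtain e where e: "e \<in> eisenstein" "(r + \<alpha> * s) - (r' + \<alpha> * s') = \<alpha> * \<beta> * e"
      using u(5) by (auto simp: eisenstein_ideal_def)
    then have "r - r' = \<alpha> * (\<beta> * e + s' - s)" by (simp add: algebra_simps)
    moreover have "\<beta> * e + s' - s \<in> eisenstein"
      using e u RS beta by (intro eisenstein_ring) auto
    ultimately have "r - r' \<in> eisenstein_ideal \<alpha>"
      by (simp add: eisenstein_idealI)
    then have rr: "r = r'" by (rule transversal_unique[OF R u(1,2)])
    with e(2) have "\<alpha> * (s - s') = \<alpha> * (\<beta> * e)" by (simp add: algebra_simps)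
    with assms(1) have "s - s' = \<beta> * e" by simp
    then have "s - s' \<in> eisenstein_ideal \<beta>"
      using e by (simp add: eisenstein_idealI)
    then have "s = s'" by (rule transversal_unique[OF S u(3,4)])
    with rr show ?thesis by simp
  qed
  have "inj_on (\<lambda>(r, s). r + \<alpha> * s) (R \<times> S)"
  proof (rule inj_onI, clarify)
    fix r s r' s' assume "r \<in> R" "r' \<in> R" "s \<in> S" "s' \<in> S" and eq: "r + \<alpha> * s = r' + \<alpha> * s'"
    moreover have "(r + \<alpha> * s) - (r' + \<alpha> * s') \<in> eisenstein_ideal (\<alpha> * \<beta>)"
      unfolding eq by (simp add: eisenstein_ideal_closed)
    ultimately show "r = r' \<and> s = s'" by (intro uniq)
  qed
  then show "card ((\<lambda>(r, s). r + \<alpha> * s) ` (R \<times> S)) = card R * card S"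
    by (simp add: card_image card_cartesian_product)
  show "transversal (\<alpha> * \<beta>) ((\<lambda>(r, s). r + \<alpha> * s) ` (R \<times> S))"
    unfolding transversal_def
  proof (intro conjI ballI)
    show "(\<lambda>(r, s). r + \<alpha> * s) ` (R \<times> S) \<subseteq> eisenstein" using RS assms(2) by (auto simp: subset_iff)
    fix z assume z: "z \<in> eisenstein"
    obtain r e where r: "r \<in> R" "e \<in> eisenstein" "z - r = \<alpha> * e"
      by (metis transversal_ex[OF R z] eisenstein_idealE)
    obtain s e' where s: "s \<in> S" "e' \<in> eisenstein" "e - s = \<beta> * e'"
      by (metis transversal_ex[OF S r(2)] eisenstein_idealE)
    have "z - (r + \<alpha> * s) = \<alpha> * (e - s)" using r(3) by (simp add: algebra_simps)
    then have zr: "z - (r + \<alpha> * s) = \<alpha> * \<beta> * e'" using s by simp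
    show "\<exists>!y. y \<in> (\<lambda>(r, s). r + \<alpha> * s) ` (R \<times> S) \<and> z - y \<in> eisenstein_ideal (\<alpha> * \<beta>)"
    proof (rule ex1I[of _ "r + \<alpha> * s"])
      show "r + \<alpha> * s \<in> (\<lambda>(r, s). r + \<alpha> * s) ` (R \<times> S) \<and> z - (r + \<alpha> * s) \<in> eisenstein_ideal (\<alpha> * \<beta>)"
        unfolding zr
          using r(1) s(1) eisenstein_idealI[OF s(2)] by (auto intro!: image_eqI[of _ _ "(r, s)"])
      fix y assume y: "y \<in> (\<lambda>(r, s). r + \<alpha> * s) ` (R \<times> S) \<and> z - y \<in> eisenstein_ideal (\<alpha> * \<beta>)"
      then obtain r' s' where y': "r' \<in> R" "s' \<in> S" "y = r' + \<alpha> * s'" by auto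
      have "(z - y) - (z - (r + \<alpha> * s)) \<in> eisenstein_ideal (\<alpha> * \<beta>)"
        unfolding zr
          by (rule eisenstein_ideal_closed(3)[OF conjunct2[OF y] eisenstein_idealI[OF s(2)]])
      moreover have "(z - y) - (z - (r + \<alpha> * s)) = (r + \<alpha> * s) - (r' + \<alpha> * s')" by (simp add: y')
      ultimately have "(r + \<alpha> * s) - (r' + \<alpha> * s') \<in> eisenstein_ideal (\<alpha> * \<beta>)" by metis
      then show "y = r + \<alpha> * s" using uniq[OF r(1) y'(1) s(1) y'(2)] y' by simp
    qed
  qed
qed

lemma transversal_cnj:
  assumes "transversal \<alpha> R"
  shows "transversal (cnj \<alpha>) (cnj ` R)"
proof -
  have ideal: "cnj z \<in> eisenstein_ideal (cnj \<alpha>) \<longleftrightarrow> z \<in> eisenstein_ideal \<alpha>" for z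
  proof -
    have "cnj z \<in> eisenstein_ideal (cnj \<alpha>)" if "z \<in> eisenstein_ideal \<alpha>" for z \<alpha>
      using that by (metis eisenstein_idealE eisenstein_idealI eisenstein_ring(8) complex_cnj_mult)
    from this[of z \<alpha>] this[of "cnj z" "cnj \<alpha>"] show ?thesis by auto
  qed
  show ?thesis unfolding transversal_def
  proof (intro conjI ballI)
    show "cnj ` R \<subseteq> eisenstein" using assms by (auto simp: transversal_def)
    fix z assume "z \<in> eisenstein"
    then have cz: "cnj z \<in> eisenstein" by simp
    obtain r where r: "r \<in> R" "cnj z - r \<in> eisenstein_ideal \<alpha>" by (rule transversal_ex[OF assms cz])
    show "\<exists>!s. s \<in> cnj ` R \<and> z - s \<in> eisenstein_ideal (cnj \<alpha>)"
    proof (rule ex1I[of _ "cnj r"])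
      show "cnj r \<in> cnj ` R \<and> z - cnj r \<in> eisenstein_ideal (cnj \<alpha>)"
        using r ideal[of "cnj z - r"] by simp
      fix s assume "s \<in> cnj ` R \<and> z - s \<in> eisenstein_ideal (cnj \<alpha>)"
      then obtain t where t: "t \<in> R" "s = cnj t" "z - cnj t \<in> eisenstein_ideal (cnj \<alpha>)" by blast
      have "cnj z - t \<in> eisenstein_ideal \<alpha>" using t(3) ideal[of "cnj z - t"] by simp
      then have "(cnj z - r) - (cnj z - t) \<in> eisenstein_ideal \<alpha>"
        by (rule eisenstein_ideal_closed(3)[OF r(2)])
      then have "t = r" using transversal_unique[OF assms t(1) r(1)] by simp
      then show "s = cnj r" using t by simp
    qed
  qed
qed

lemma norm_eisenstein_nat:
  assumes "\<alpha> \<in> eisenstein"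
  obtains n :: nat where "(cmod \<alpha>)\<^sup>2 = real n" "\<alpha> * cnj \<alpha> = of_nat n"
proof -
  obtain k l where kl: "coord1 \<alpha> = of_int k" "coord2 \<alpha> = of_int l"
    using assms by (auto elim: eisensteinE)
  have "(cmod \<alpha>)\<^sup>2 = of_int (k\<^sup>2 - k * l + l\<^sup>2)" by (simp add: norm_coord kl)
  moreover from this have "k\<^sup>2 - k * l + l\<^sup>2 \<ge> 0" by (metis of_int_0_le_iff zero_le_power2)
  ultimately have *: "(cmod \<alpha>)\<^sup>2 = real (nat (k\<^sup>2 - k * l + l\<^sup>2))" by simp
  moreover have "\<alpha> * cnj \<alpha> = of_nat (nat (k\<^sup>2 - k * l + l\<^sup>2))"
    unfolding complex_mult_cnj by (metis * cmod_power2 of_real_of_nat_eq)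
  ultimately show thesis by (rule that)
qed

text \<open>With n = \<alpha> * cnj \<alpha>, the index n^2 of the ideal of n is the product of the
  indices for \<alpha> and \<open>cnj \<alpha>\<close>. These two agree by complex conjugation, so
  each is n.\<close>

lemma exists_transversal:
  assumes "\<alpha> \<in> eisenstein" "\<alpha> \<noteq> 0"
  obtains R where "finite R" "transversal \<alpha> R" "real (card R) = (cmod \<alpha>)\<^sup>2"
proof -
  obtain n where n: "(cmod \<alpha>)\<^sup>2 = real n" "\<alpha> * cnj \<alpha> = of_nat n"
    by (rule norm_eisenstein_nat[OF assms(1)])
  then have "n > 0" using assms(2) by (intro gr0I) auto
  let ?Q = "(\<lambda>(i, j). of_nat i + of_nat j * omega) ` ({..<n} \<times> {..<n})"
  have Q: "transversal (of_nat n) ?Q" "finite ?Q" "card ?Q = n * n"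
    using transversal_of_nat[OF \<open>n > 0\<close>] card_transversal_of_nat by auto
  \<comment> \<open>A representative is picked from the finite set \<open>?Q\<close>, which makes
    the transversal finite. The predicate depends only on the coset of z modulo \<alpha>, hence so
    does the element that \<open>SOME\<close> returns.\<close>
  define \<rho> where "\<rho> z = (SOME r. r \<in> ?Q \<and> z - r \<in> eisenstein_ideal \<alpha>)" for z
  have \<rho>: "\<rho> z \<in> ?Q \<and> z - \<rho> z \<in> eisenstein_ideal \<alpha>" if "z \<in> eisenstein" for z
    unfolding \<rho>_def
  proof (rule someI_ex)
    obtain r where r: "r \<in> ?Q" "z - r \<in> eisenstein_ideal (of_nat n)"
      using Q(1) \<open>z \<in> eisenstein\<close> unfolding transversal_def by blast
    then obtain e where e: "e \<in> eisenstein" "z - r = \<alpha> * (cnj \<alpha> * e)"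
      unfolding n(2)[symmetric] by (auto simp: eisenstein_ideal_def mult.assoc)
    have "z - r \<in> eisenstein_ideal \<alpha>"
      unfolding e(2) using e(1) assms(1) by (intro eisenstein_idealI) auto
    then show "\<exists>r. r \<in> ?Q \<and> z - r \<in> eisenstein_ideal \<alpha>" using r by blast
  qed
  have \<rho>_eq: "\<rho> z = \<rho> w" if "z - w \<in> eisenstein_ideal \<alpha>" for z w
  proof -
    have "(z - r \<in> eisenstein_ideal \<alpha>) = (w - r \<in> eisenstein_ideal \<alpha>)" for r
      using eisenstein_ideal_closed(2)[OF _ that, of "w - r"] eisenstein_ideal_closed(3)[OF _ that, of "z - r"]
        by auto
    then show ?thesis by (simp add: \<rho>_def)
  qed
  let ?R = "\<rho> ` eisenstein"
  have Qe: "?Q \<subseteq> eisenstein" using Q(1) by (simp add: transversal_def)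
  have RQ: "?R \<subseteq> ?Q" using \<rho> by blast
  have R: "transversal \<alpha> ?R" unfolding transversal_def
  proof (intro conjI ballI)
    show "?R \<subseteq> eisenstein" using RQ Qe by blast
    fix z assume z: "z \<in> eisenstein"
    show "\<exists>!r. r \<in> ?R \<and> z - r \<in> eisenstein_ideal \<alpha>"
    proof (rule ex1I[of _ "\<rho> z"])
      show "\<rho> z \<in> ?R \<and> z - \<rho> z \<in> eisenstein_ideal \<alpha>" using z \<rho> by blast
      fix r assume r: "r \<in> ?R \<and> z - r \<in> eisenstein_ideal \<alpha>"
      then obtain w where w: "w \<in> eisenstein" "r = \<rho> w" by blast
      have "w - z = (w - \<rho> w) - (z - r)" using w by simp
      also have "\<dots> \<in> eisenstein_ideal \<alpha>"
        by (rule eisenstein_ideal_closed(3)[OF conjunct2[OF \<rho>[OF w(1)]] conjunct2[OF r]])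
      finally have "\<rho> w = \<rho> z" by (rule \<rho>_eq)
      then show "r = \<rho> z" using w(2) by simp
    qed
  qed
  have fin: "finite ?R" using RQ Q(2) by (rule finite_subset)
  have "card ?Q = card ?R * card (cnj ` ?R)"
    using transversal_mult[OF assms(2,1) R eisenstein_ring(8)[OF assms(1)] transversal_cnj[OF R]]
      transversal_card_unique[OF Q(1)] unfolding n(2) by simp
  also have "card (cnj ` ?R) = card ?R" by (intro card_image) (simp add: inj_on_def)
  finally have "n * n = card ?R * card ?R" using Q(3) by simp
  then have "n\<^sup>2 = (card ?R)\<^sup>2" by (simp only: power2_eq_square)
  then have "n = card ?R" by simp
  then show thesis using that[OF fin R] n by simp
qed

text \<open>Closure under addition, negation and multiplication by omega makes L an ideal. By
  Euclidean division a non-zero element \<alpha> of least norm divides every element of L.\<close>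

lemma eisenstein_principal_ideal:
  assumes L: "L \<subseteq> eisenstein" and add: "\<And>z w. z \<in> L \<Longrightarrow> w \<in> L \<Longrightarrow> z + w \<in> L"
    and neg: "\<And>z. z \<in> L \<Longrightarrow> - z \<in> L" and om: "\<And>z. z \<in> L \<Longrightarrow> omega * z \<in> L"
    and nz: "z0 \<in> L" "z0 \<noteq> 0"
  obtains \<alpha> where "\<alpha> \<in> eisenstein" "\<alpha> \<noteq> 0" "L = eisenstein_ideal \<alpha>"
proof -
  have zero: "0 \<in> L" using add[OF nz(1) neg[OF nz(1)]] by simp
  have nat_mult: "of_nat n * z \<in> L" if "z \<in> L" for n z
    by (induction n) (use that zero add in \<open>auto simp: algebra_simps\<close>)
  have int_mult: "of_int n * z \<in> L" if "z \<in> L" for n z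
    using nat_mult[OF that, of "nat n"] neg[OF nat_mult[OF that, of "nat (- n)"]]
      by (cases "n \<ge> 0") auto
  have mult: "e * z \<in> L" if e: "e \<in> eisenstein" and z: "z \<in> L" for e z
  proof -
    obtain m n where "e = of_int m + of_int n * omega" using e by (rule eisensteinE)
    then have "e * z = of_int m * z + of_int n * (omega * z)" by (simp add: algebra_simps)
    then show ?thesis using add int_mult om z by simp
  qed
  define N where "N z = nat \<lfloor>(cmod z)\<^sup>2\<rfloor>" for z
  have N: "(cmod z)\<^sup>2 = real (N z)" if "z \<in> eisenstein" for z
    using norm_eisenstein_nat[OF that] by (metis N_def floor_of_nat nat_int)
  obtain \<alpha> where \<alpha>: "\<alpha> \<in> L" "\<alpha> \<noteq> 0" and min: "\<And>z. z \<in> L \<Longrightarrow> z \<noteq> 0 \<Longrightarrow> N \<alpha> \<le> N z"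
    using ex_has_least_nat[of "\<lambda>z. z \<in> L \<and> z \<noteq> 0" z0 N] nz by blast
  have "z \<in> eisenstein_ideal \<alpha>" if z: "z \<in> L" for z
  proof -
    define t where "t = z / \<alpha>"
    define \<beta> where "\<beta> = of_int (round (coord1 t)) + of_int (round (coord2 t)) * omega"
    have \<beta>: "\<beta> \<in> eisenstein" by (simp add: \<beta>_def)
    define x y where "x = coord1 (t - \<beta>)" and "y = coord2 (t - \<beta>)"
    have cb: "coord1 \<beta> = of_int (round (coord1 t))" "coord2 \<beta> = of_int (round (coord2 t))"
      unfolding \<beta>_def by simp_all
    \<comment> \<open>Rounding leaves coordinates of absolute value at most 1/2, for which the norm
      form x^2 - x y + y^2 is at most 3/4. The remainder is therefore strictly smaller than the
      divisor.\<close>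
    have xy: "\<bar>x\<bar> \<le> 1/2" "\<bar>y\<bar> \<le> 1/2"
      using of_int_round_abs_le[of "coord1 t"] of_int_round_abs_le[of "coord2 t"]
        unfolding x_def y_def coord_diff cb
      by (simp_all add: abs_minus_commute)
    have "x\<^sup>2 \<le> 1/4" "y\<^sup>2 \<le> 1/4" "\<bar>x * y\<bar> \<le> 1/4"
      using power_mono[OF xy(1), of 2] power_mono[OF xy(2), of 2] mult_mono[OF xy]
      by (auto simp: power2_eq_square abs_mult)
    then have "(cmod (t - \<beta>))\<^sup>2 < 1" unfolding norm_coord x_def[symmetric] y_def[symmetric] by auto
    define w where "w = z - \<beta> * \<alpha>"
    have "w = \<alpha> * (t - \<beta>)" using \<alpha>(2) by (simp add: w_def t_def algebra_simps)
    then have "(cmod w)\<^sup>2 = (cmod \<alpha>)\<^sup>2 * (cmod (t - \<beta>))\<^sup>2"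
      by (simp add: norm_mult power_mult_distrib)
    also have "\<dots> < (cmod \<alpha>)\<^sup>2 * 1" using \<open>_ < 1\<close> \<alpha>(2) by (intro mult_strict_left_mono) auto
    finally have less: "(cmod w)\<^sup>2 < (cmod \<alpha>)\<^sup>2" by simp
    have wL: "w \<in> L" unfolding w_def using add[OF z neg[OF mult[OF \<beta> \<alpha>(1)]]] by simp
    then have "N w < N \<alpha>" using less N L \<alpha>(1) by (metis of_nat_less_iff subsetD)
    then have "w = 0" using min[OF wL] by linarith
    then show ?thesis using \<beta> by (auto simp: w_def eisenstein_ideal_def mult.commute)
  qed
  moreover have "eisenstein_ideal \<alpha> \<subseteq> L"
    using mult \<alpha>(1) by (auto simp: eisenstein_ideal_def mult.commute)
  ultimately have "L = eisenstein_ideal \<alpha>" by blast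
  then show thesis using that \<alpha> L by blast
qed

section \<open>Transitive permutation groups with (3,3,3) relations and ideals of Eisenstein
  integers\<close>

lemma funpow_intertwine:
  assumes "a \<circ> u = v \<circ> a"
  shows "a \<circ> u ^^ k = v ^^ k \<circ> a"
proof -
  have "a (u x) = v (a x)" for x using fun_cong[OF assms, of x] by simp
  then have "a ((u ^^ k) x) = (v ^^ k) (a x)" for x by (induction k arbitrary: x) simp_all
  then show ?thesis by auto
qed

lemma funpow_commute:
  assumes "f \<circ> g = g \<circ> f"
  shows "f ^^ i \<circ> g ^^ j = g ^^ j \<circ> f ^^ i"
  using funpow_intertwine[OF funpow_intertwine[OF assms, of j, symmetric], of i] by simp

lemma funpow_permutes:
  assumes "u permutes A"
  shows "u ^^ i permutes A"
proof (induction i)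
  case (Suc i)
  show ?case using permutes_compose[OF Suc assms] by (simp only: funpow.simps(2))
qed (simp only: funpow.simps(1) permutes_id)

lemma permutes_period:
  assumes "finite A" "u permutes A"
  obtains N :: nat where "N > 0" "u ^^ N = id"
proof -
  have "u ^^ i permutes A" for i by (rule funpow_permutes[OF assms(2)])
  then have "range (\<lambda>i. u ^^ i) \<subseteq> {p. p permutes A}" by blast
  then have "finite (range (\<lambda>i. u ^^ i))"
    by (rule finite_subset) (rule finite_permutations[OF assms(1)])
  then have "\<not> inj (\<lambda>i. u ^^ i)" using finite_imageD[of "\<lambda>i. u ^^ i" UNIV] by auto
  then obtain k l where "k \<noteq> l" "u ^^ k = u ^^ l" by (auto simp: inj_on_def)
  then obtain i j where ij: "i < j" "u ^^ i = u ^^ j"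
    by (cases "k < l") (auto simp: not_less_iff_gr_or_eq)
  then obtain n where n: "n > 0" "j = i + n" using less_imp_add_positive by blast
  have "(u ^^ i) ((u ^^ n) x) = (u ^^ i) x" for x
    using ij(2) unfolding n(2) by (simp add: funpow_add fun_eq_iff)
  moreover have "inj (u ^^ i)" using permutes_inj[OF assms(2)] by (rule inj_fn)
  ultimately have "u ^^ n = id" by (auto simp: inj_eq)
  then show thesis using that n(1) by blast
qed

lemma funpow_int_mod_add:
  assumes "f ^^ N = id" "N > 0"
  shows "f ^^ nat ((i + j) mod int N) = f ^^ nat (i mod int N) \<circ> f ^^ nat (j mod int N)"
proof -
  have "int (nat ((i + j) mod int N)) = int ((nat (i mod int N) + nat (j mod int N)) mod N)"
    using assms(2) by (simp add: zmod_int mod_add_eq)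
  then have "nat ((i + j) mod int N) = (nat (i mod int N) + nat (j mod int N)) mod N" by linarith
  moreover have "f ^^ (k mod N) = f ^^ k" for k
    using funpow_mod_eq[of N f] assms(1) by (auto simp: fun_eq_iff)
  ultimately show ?thesis by (simp add: funpow_add)
qed

(* With u = a^-1 b and v = a u a^-1 the group <a, b> is the extension of the abelian group <u, v>
   by <a>, and a acts on Z u + Z v as omega acts on Z + Z omega.  The stabilizer of the fixed point
   p of a in <u, v> is therefore an ideal of the Eisenstein integers. *)
lemma card_eq_eisenstein_norm:
  assumes A: "finite A" "a permutes A" "b permutes A"
    and a3: "\<And>x. x \<in> A \<Longrightarrow> a (a (a x)) = x" and b3: "\<And>x. x \<in> A \<Longrightarrow> b (b (b x)) = x"
    and ba3: "\<And>x. x \<in> A \<Longrightarrow> b (a (b (a (b (a x))))) = x"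
    and p: "p \<in> A" "a p = p"
    and trans: "\<And>B. B \<subseteq> A \<Longrightarrow> B \<noteq> {} \<Longrightarrow> a ` B \<subseteq> B \<Longrightarrow> b ` B \<subseteq> B \<Longrightarrow> B = A"
  obtains \<alpha> where "\<alpha> \<in> eisenstein" "(cmod \<alpha>)\<^sup>2 = real (card A)"
proof -
  have out: "a x = x" "b x = x" if "x \<notin> A" for x using that A by (auto simp: permutes_def)
  have a3': "a (a (a x)) = x" and b3': "b (b (b x)) = x" and ba3': "b (a (b (a (b (a x))))) = x" for x
    by (cases "x \<in> A"; simp add: a3 b3 ba3 out)+
  have ab3': "a (b (a (b (a (b x))))) = x" for x
    using ba3'[of "a (a (b (b (a (a x)))))"] ba3'[of "b x"] b3' a3' by metis
  define u v where "u = a \<circ> a \<circ> b" and "v = b \<circ> a \<circ> a"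
  \<comment> \<open>Since a and b have order dividing 3, \<open>u \<circ> v\<close> is a^-1 b^-1
    a^-1, while \<open>v \<circ> u\<close> is b a b. Their equality is the relation (b a)^3 =
    1.\<close>
  have uv: "u \<circ> v = v \<circ> u"
  proof
    fix x
    have "b (a (b (a (b (a (a (b (b (a (a x)))))))))) = a (b (b (a (a x))))" by (rule ba3')
    show "(u \<circ> v) x = (v \<circ> u) x" unfolding u_def v_def o_def a3'
      by (metis a3' b3' ba3')
  qed
  have au: "a \<circ> u = v \<circ> a" by (auto simp: u_def v_def a3')
  have perm: "u permutes A" "v permutes A" unfolding u_def v_def by (intro permutes_compose A)+
  obtain M M' where M: "M > 0" "u ^^ M = id" "M' > 0" "v ^^ M' = id"
    by (metis permutes_period[OF A(1)] perm)
  define N where "N = M * M'"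
  have "id ^^ k = id" for k :: nat and x :: "'a \<Rightarrow> 'a" by (induction k) auto
  moreover have "u ^^ N = (u ^^ M) ^^ M'" "v ^^ N = (v ^^ M') ^^ M"
    by (simp_all add: N_def funpow_mult mult.commute)
  ultimately have N: "N > 0" "u ^^ N = id" "v ^^ N = id" using M unfolding N_def by simp_all
  \<comment> \<open>The translation u^m v^n for integers m, n. The common period N of u and v turns
    integer exponents into natural ones.\<close>
  define t where "t m n = u ^^ nat (m mod int N) \<circ> v ^^ nat (n mod int N)" for m n
  have t_add: "t (m + m') (n + n') = t m n \<circ> t m' n'" for m n m' n'
  proof -
    have "(v ^^ j) ((u ^^ i) x) = (u ^^ i) ((v ^^ j) x)" for i j x
      using fun_cong[OF funpow_commute[OF uv, of i j], of x] by simp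
    then show ?thesis unfolding t_def by (simp add: funpow_int_mod_add N fun_eq_iff)
  qed
  have modN: "u ^^ (k mod N) = u ^^ k" "v ^^ (k mod N) = v ^^ k" for k
    using funpow_mod_eq[of N u] funpow_mod_eq[of N v] N by (auto simp: fun_eq_iff)
  have t_nat: "t (int k) (int l) = u ^^ k \<circ> v ^^ l" for k l
    unfolding t_def using modN by (simp add: nat_mod_distrib)
  have t_mod: "t m n = t m' n'" if "m mod int N = m' mod int N" "n mod int N = n' mod int N" for m n m' n'
    using that by (simp add: t_def)
  have t0: "t 0 0 = id" using t_nat[of 0 0] by simp
  have t_pow: "t m n ^^ k = t (int k * m) (int k * n)" for m n k
  proof (induction k)
    case (Suc k)
    have "t m n ^^ Suc k = t (m + int k * m) (n + int k * n)"
      by (simp only: funpow.simps(2) Suc t_add)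
    then show ?case by (simp add: algebra_simps)
  qed (simp add: t0)
  \<comment> \<open>Conjugation by a sends u to v, and here v to the inverse of u v: the counterpart
    of omega * omega = - 1 - omega.\<close>
  have av: "a \<circ> v = t (-1) (-1) \<circ> a"
  proof -
    have "t 1 1 = u \<circ> v" using t_nat[of 1 1] by simp
    then have "t 1 1 \<circ> (a \<circ> v) = a" by (simp add: u_def v_def fun_eq_iff a3' b3')
    then have "t (-1) (-1) \<circ> a = (t (-1) (-1) \<circ> t 1 1) \<circ> (a \<circ> v)" by (simp only: comp_assoc)
    also have "t (-1) (-1) \<circ> t 1 1 = id" using t_add[of "-1" 1 "-1" 1] t0 by simp
    finally show ?thesis by (simp add: fun_eq_iff)
  qed
  have at: "a \<circ> t m n = t (- n) (m - n) \<circ> a" for m n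
  proof -
    define i j where "i = nat (m mod int N)" and "j = nat (n mod int N)"
    have ij: "int i = m mod int N" "int j = n mod int N" using N by (simp_all add: i_def j_def)
    have "a \<circ> t m n = (a \<circ> u ^^ i) \<circ> v ^^ j" by (simp add: t_def i_def j_def comp_assoc)
    also have "\<dots> = v ^^ i \<circ> (a \<circ> v ^^ j)" by (simp only: funpow_intertwine[OF au] comp_assoc)
    also have "\<dots> = (t (int 0) (int i) \<circ> t (- int j) (- int j)) \<circ> a"
      using funpow_intertwine[OF av, of j] t_nat[of 0 i] t_pow[of j "-1" "-1"]
        by (simp add: fun_eq_iff)
    also have "t (int 0) (int i) \<circ> t (- int j) (- int j) = t (- int j) (int i - int j)"
      using t_add[of "int 0" "- int j" "int i" "- int j"] by simp
    also have "\<dots> = t (- n) (m - n)"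
      by (rule t_mod) (simp_all add: ij mod_diff_eq mod_minus_eq)
    finally show ?thesis .
  qed
  have at': "a (t m n p) = t (- n) (m - n) p" for m n
    using fun_cong[OF at, of m n p] p by simp
  have tA: "t m n x \<in> A" if "x \<in> A" for m n x
    using that by (simp add: t_def permutes_in_image[OF funpow_permutes[OF perm(1)]]
      permutes_in_image[OF funpow_permutes[OF perm(2)]])
  \<comment> \<open>Because a fixes p and normalizes the translations, the translation orbit of p is
    stable under a, and under b = a u as well; transitivity then makes it everything.\<close>
  have "{t m n p | m n. True} = A"
  proof (rule trans)
    show "{t m n p | m n. True} \<subseteq> A" using tA p by blast
    show "{t m n p | m n. True} \<noteq> {}" by blast
    show "a ` {t m n p | m n. True} \<subseteq> {t m n p | m n. True}" using at' by blast
    have "b x = a (u x)" for x by (simp add: u_def a3')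
    moreover have "u (t m n x) = t (1 + m) (0 + n) x" for m n x
      using t_nat[of 1 0] unfolding t_add by simp
    ultimately show "b ` {t m n p | m n. True} \<subseteq> {t m n p | m n. True}" using at' by fastforce
  qed
  then have orbit: "\<And>x. x \<in> A \<Longrightarrow> \<exists>m n. x = t m n p" by blast
  \<comment> \<open>On Eisenstein integers the floors only turn integral coordinates into values of
    type \<open>int\<close>. Thus q is the orbit map of p, and its fibres are the cosets of the
    stabilizer.\<close>
  define q where "q z = t \<lfloor>coord1 z\<rfloor> \<lfloor>coord2 z\<rfloor> p" for z
  have q_coord: "q (of_int m + of_int n * omega) = t m n p" for m n by (simp add: q_def)
  have qA: "q ` eisenstein = A"
  proof
    show "q ` eisenstein \<subseteq> A" using tA p by (auto simp: q_def)
    show "A \<subseteq> q ` eisenstein"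
    proof
      fix x assume "x \<in> A"
      then obtain m n where "x = q (of_int m + of_int n * omega)" using orbit q_coord by metis
      then show "x \<in> q ` eisenstein"
        by (simp add: image_iff) (metis eisenstein_ring(3,4,6) eisenstein_of_int(1))
    qed
  qed
  define L where "L = {z \<in> eisenstein. q z = p}"
  have fl: "\<lfloor>coord1 (z + w)\<rfloor> = \<lfloor>coord1 z\<rfloor> + \<lfloor>coord1 w\<rfloor> \<and> \<lfloor>coord2 (z + w)\<rfloor> = \<lfloor>coord2 z\<rfloor> + \<lfloor>coord2 w\<rfloor>"
    if "w \<in> eisenstein" for z w
    using that by (elim eisensteinE) simp
  have q_add: "q (z + w) = t \<lfloor>coord1 z\<rfloor> \<lfloor>coord2 z\<rfloor> (q w)" if "w \<in> eisenstein" for z w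
    using fl[OF that] by (simp add: q_def t_add)
  have ker: "q z = q w \<longleftrightarrow> z - w \<in> L" if "z \<in> eisenstein" "w \<in> eisenstein" for z w
  proof -
    have w: "q (- w + w) = p" by (simp add: q_def t0)
    have zw: "q (z + - w) = t \<lfloor>coord1 (- w)\<rfloor> \<lfloor>coord2 (- w)\<rfloor> (q z)"
      using q_add[of z "- w"] that by (simp add: add.commute)
    have inv: "t \<lfloor>coord1 w\<rfloor> \<lfloor>coord2 w\<rfloor> (t \<lfloor>coord1 (- w)\<rfloor> \<lfloor>coord2 (- w)\<rfloor> x) = x" for x
    proof -
      have "\<lfloor>coord1 w\<rfloor> + \<lfloor>coord1 (- w)\<rfloor> = 0" "\<lfloor>coord2 w\<rfloor> + \<lfloor>coord2 (- w)\<rfloor> = 0"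
        using that(2) by (elim eisensteinE, simp)+
      then show ?thesis
        using t_add[of "\<lfloor>coord1 w\<rfloor>" "\<lfloor>coord1 (- w)\<rfloor>" "\<lfloor>coord2 w\<rfloor>" "\<lfloor>coord2 (- w)\<rfloor>"] t0
        by (metis comp_apply id_apply)
    qed
    have "z - w \<in> L \<longleftrightarrow> q (z + - w) = p" using that by (simp add: L_def)
    also have "\<dots> \<longleftrightarrow> t \<lfloor>coord1 (- w)\<rfloor> \<lfloor>coord2 (- w)\<rfloor> (q z) = t \<lfloor>coord1 (- w)\<rfloor> \<lfloor>coord2 (- w)\<rfloor> (q w)"
      using zw w q_add[OF that(2), of "- w"] by simp
    also have "\<dots> \<longleftrightarrow> q z = q w" using inv by metis
    finally show ?thesis by simp
  qed
  have zeroL: "q 0 = p" by (simp add: q_def t0)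
  obtain \<alpha> where \<alpha>: "\<alpha> \<in> eisenstein" "\<alpha> \<noteq> 0" "L = eisenstein_ideal \<alpha>"
  proof (rule eisenstein_principal_ideal[of L "of_nat N"])
    show "L \<subseteq> eisenstein" by (auto simp: L_def)
    show "z + w \<in> L" if "z \<in> L" "w \<in> L" for z w
    proof -
      have "z \<in> eisenstein" "w \<in> eisenstein" "q z = p" "q w = p" using that by (auto simp: L_def)
      then have "q (z + w) = p" using q_add[of w z] by (simp add: q_def)
      then show ?thesis using that by (simp add: L_def)
    qed
    show "- z \<in> L" if "z \<in> L" for z
      using ker[of 0 z] that zeroL by (simp add: L_def)
    show "omega * z \<in> L" if "z \<in> L" for z
    proof -
      have z: "z \<in> eisenstein" "q z = p" using that by (auto simp: L_def)
      have "q (omega * z) = t (- \<lfloor>coord2 z\<rfloor>) (\<lfloor>coord1 z\<rfloor> - \<lfloor>coord2 z\<rfloor>) p"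
        using z(1) by (elim eisensteinE) (simp add: q_def coord_mult)
      also have "\<dots> = a (q z)" by (simp add: at' q_def)
      finally show ?thesis using z p by (simp add: L_def)
    qed
    \<comment> \<open>The period N itself acts trivially, so the stabilizer contains a non-zero
      element.\<close>
    have "t (int N) 0 = t 0 0" by (rule t_mod) auto
    then show "of_nat N \<in> L" by (simp add: L_def q_def t0)
    show "of_nat N \<noteq> (0::complex)" using N by simp
  qed (use that in blast)
  obtain R where R: "finite R" "transversal \<alpha> R" "real (card R) = (cmod \<alpha>)\<^sup>2"
    by (rule exists_transversal[OF \<alpha>(1,2)])
  have "bij_betw q R A"
    using transversal_bij_betw[OF R(2), of q] ker unfolding \<alpha>(3) qA by blast
  then have "card R = card A" by (rule bij_betw_same_card)
  then show thesis using that[OF \<alpha>(1)] R(3) by simp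
qed

lemma eisenstein_norm_form:
  assumes "\<alpha> \<in> eisenstein" "(cmod \<alpha>)\<^sup>2 = real d"
  obtains x y :: nat where "d = x\<^sup>2 + x * y + y\<^sup>2"
proof -
  obtain k l where kl: "coord1 \<alpha> = of_int k" "coord2 \<alpha> = of_int l"
    using assms(1) by (auto elim: eisensteinE)
  have "real_of_int (int d) = of_int (k\<^sup>2 - k * l + l\<^sup>2)"
    using assms(2) by (simp add: norm_coord kl)
  then have d: "int d = k\<^sup>2 - k * l + l\<^sup>2" by (simp only: of_int_eq_iff)
  have "\<exists>x y :: int. x \<ge> 0 \<and> y \<ge> 0 \<and> int d = x\<^sup>2 + x * y + y\<^sup>2"
  proof -
    \<comment> \<open>The six sectors of the plane that multiplication by units permutes. With
      coordinates x and - y, where x, y \<ge> 0, the norm form is x^2 + x y + y^2; the witnesses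
      are, up to order, those of the unit multiple lying in such a sector.\<close>
    consider "k \<ge> 0" "l \<le> 0" | "k \<le> 0" "l \<ge> 0" | "k \<ge> l" "l \<ge> 0" | "l \<ge> k" "k \<ge> 0" | "k \<le> l" "l \<le> 0" | "l \<le> k" "k \<le> 0"
      by linarith
    then show ?thesis
    proof cases
      case 1 then show ?thesis using d by (intro exI[of _ k] exI[of _ "- l"]) auto
    next
      case 2 then show ?thesis using d by (intro exI[of _ "- k"] exI[of _ l]) auto
    next
      case 3 then show ?thesis
        using d by (intro exI[of _ "k - l"] exI[of _ l]) (auto simp: power2_eq_square algebra_simps)
    next
      case 4 then show ?thesis
        using d by (intro exI[of _ "l - k"] exI[of _ k]) (auto simp: power2_eq_square algebra_simps)
    next
      case 5 then show ?thesis
        using d by (intro exI[of _ "l - k"] exI[of _ "- l"]) (auto simp: power2_eq_square algebra_simps)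
    next
      case 6 then show ?thesis
        using d by (intro exI[of _ "k - l"] exI[of _ "- k"]) (auto simp: power2_eq_square algebra_simps)
    qed
  qed
  then obtain x y where xy: "x \<ge> 0" "y \<ge> 0" "int d = x\<^sup>2 + x * y + y\<^sup>2" by blast
  have "int d = int ((nat x)\<^sup>2 + nat x * nat y + (nat y)\<^sup>2)" using xy by simp
  then have "d = (nat x)\<^sup>2 + nat x * nat y + (nat y)\<^sup>2" by (simp only: of_nat_eq_iff)
  then show thesis by (rule that)
qed

section \<open>Monodromy of a branched cover\<close>

lemma finite_disjoint_balls:
  fixes F :: "'a::metric_space set"
  assumes "finite F"
  obtains e where "e > 0" "\<And>x y. x \<in> F \<Longrightarrow> y \<in> F \<Longrightarrow> x \<noteq> y \<Longrightarrow> ball x e \<inter> ball y e = {}"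
proof -
  define D where "D = insert 1 ((\<lambda>(x, y). dist x y) ` {(x, y) \<in> F \<times> F. x \<noteq> y})"
  have "finite {(x, y) \<in> F \<times> F. x \<noteq> y}"
    by (rule finite_subset[of _ "F \<times> F"]) (use assms in auto)
  then have fin: "finite D" unfolding D_def by simp
  define e where "e = Min D / 2"
  have "D \<noteq> {}" "\<And>z. z \<in> D \<Longrightarrow> z > 0" by (auto simp: D_def)
  then have "e > 0" using fin by (simp add: e_def)
  moreover have "ball x e \<inter> ball y e = {}" if "x \<in> F" "y \<in> F" "x \<noteq> y" for x y
  proof -
    have "dist x y \<in> D" using that by (force simp: D_def)
    then have le: "2 * e \<le> dist x y" using fin by (simp add: e_def)
    show ?thesis
    proof (rule ccontr)
      assume "ball x e \<inter> ball y e \<noteq> {}"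
      then obtain z where "dist x z < e" "dist y z < e" by auto
      then show False using le dist_triangle2[of x y z] by linarith
    qed
  qed
  ultimately show thesis by (rule that)
qed

lemma connected_subset_disjoint_open_UN:
  assumes "connected C" "C \<noteq> {}" "C \<subseteq> (\<Union>x\<in>F. W x)"
    and op: "\<And>x. x \<in> F \<Longrightarrow> openin (top_of_set S) (W x)" and "C \<subseteq> S"
    and disj: "\<And>x y. x \<in> F \<Longrightarrow> y \<in> F \<Longrightarrow> x \<noteq> y \<Longrightarrow> W x \<inter> W y = {}"
  obtains x where "x \<in> F" "C \<subseteq> W x"
proof -
  obtain c where c: "c \<in> C" using assms by blast
  then obtain x where x: "x \<in> F" "c \<in> W x" using assms by blast
  let ?V = "\<Union>y\<in>F - {x}. W y"
  have "openin (top_of_set S) ?V" using op by (intro openin_Union) auto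
  moreover have "openin (top_of_set C) (C \<inter> U)" if "openin (top_of_set S) U" for U
    using that \<open>C \<subseteq> S\<close> unfolding openin_open by blast
  ultimately have "openin (top_of_set C) (C \<inter> W x)" "openin (top_of_set C) (C \<inter> ?V)"
    using op[OF x(1)] by blast+
  moreover have "(C \<inter> W x) \<inter> (C \<inter> ?V) = {}" using disj x by blast
  moreover have "C = (C \<inter> W x) \<union> (C \<inter> ?V)" using assms(3) by blast
  ultimately have "C \<inter> W x = {} \<or> C \<inter> ?V = {}"
    using \<open>connected C\<close> unfolding connected_openin by (metis order_refl)
  then show thesis using that[OF x(1)] assms(3) c x by blast
qed

lemma homeomorphic_map_top_of_setE:
  assumes "homeomorphic_map (subtopology (top_of_set A) U) (top_of_set B) \<phi>" "U \<subseteq> A"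
  obtains \<phi>' where "homeomorphism U B \<phi> \<phi>'"
proof -
  have "subtopology (top_of_set A) U = top_of_set U"
    using assms(2) by (simp add: subtopology_subtopology Int_absorb1)
  then show thesis using assms(1) that unfolding homeomorphic_map_maps by auto
qed

lemma locally_power_map_disc_top_of_set:
  assumes "locally_power_map (top_of_set A) (top_of_set B) f x k" "openin (top_of_set A) W" "x \<in> W"
    "openin (top_of_set B) N" "f x \<in> N"
  obtains U V \<phi> \<phi>' \<psi> \<psi>' r where "r > 0" "openin (top_of_set A) U" "x \<in> U" "U \<subseteq> W"
    "openin (top_of_set B) V" "f x \<in> V" "V \<subseteq> N"
    "homeomorphism U (ball (0::complex) r) \<phi> \<phi>'" "\<phi> x = 0"
    "homeomorphism V (ball (0::complex) (r ^ k)) \<psi> \<psi>'" "\<psi> (f x) = 0"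
    "f ` U \<subseteq> V" "\<And>u. u \<in> U \<Longrightarrow> \<psi> (f u) = \<phi> u ^ k"
proof (rule locally_power_map_disc[OF assms])
  fix U V \<phi> \<psi> r
  assume 1: "r > 0" "openin (top_of_set A) U" "x \<in> U" "U \<subseteq> W"
    "openin (top_of_set B) V" "f x \<in> V" "V \<subseteq> N"
    "homeomorphic_map (subtopology (top_of_set A) U) (top_of_set (ball (0::complex) r)) \<phi>" "\<phi> x = 0"
    "homeomorphic_map (subtopology (top_of_set B) V) (top_of_set (ball (0::complex) (r ^ k))) \<psi>" "\<psi> (f x) = 0"
    "f ` U \<subseteq> V" "\<And>u. u \<in> U \<Longrightarrow> \<psi> (f u) = \<phi> u ^ k"
  obtain \<phi>' where 2: "homeomorphism U (ball 0 r) \<phi> \<phi>'"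
    by (rule homeomorphic_map_top_of_setE[OF 1(8) openin_imp_subset[OF 1(2)]])
  obtain \<psi>' where 3: "homeomorphism V (ball 0 (r ^ k)) \<psi> \<psi>'"
    by (rule homeomorphic_map_top_of_setE[OF 1(10) openin_imp_subset[OF 1(5)]])
  show thesis by (rule that[OF 1(1-7) 2 1(9) 3 1(11-13)])
qed

text \<open>For exponent 1 the model equation says that f is one chart followed by the inverse of
  the other.\<close>

lemma locally_power_map_1_local_homeomorphism:
  assumes "locally_power_map (top_of_set A) (top_of_set B) f x 1" "openin (top_of_set A) W" "x \<in> W"
    "openin (top_of_set B) N" "f x \<in> N"
  obtains U V q where "x \<in> U" "openin (top_of_set A) U" "U \<subseteq> W" "openin (top_of_set B) V" "V \<subseteq> N"
    "homeomorphism U V f q"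
proof (rule locally_power_map_disc_top_of_set[OF assms])
  fix U V \<phi> \<phi>' \<psi> \<psi>' r
  assume 1: "openin (top_of_set A) U" "x \<in> U" "U \<subseteq> W" "openin (top_of_set B) V" "V \<subseteq> N"
    "homeomorphism U (ball (0::complex) r) \<phi> \<phi>'" "homeomorphism V (ball (0::complex) (r ^ 1)) \<psi> \<psi>'"
    "f ` U \<subseteq> V" "\<And>u. u \<in> U \<Longrightarrow> \<psi> (f u) = \<phi> u ^ 1"
  have "homeomorphism (ball 0 r) V \<psi>' \<psi>" using 1(7) homeomorphism_symD by fastforce
  then have h: "homeomorphism U V (\<psi>' \<circ> \<phi>) (\<phi>' \<circ> \<psi>)" by (rule homeomorphism_compose[OF 1(6)])
  have "f u = (\<psi>' \<circ> \<phi>) u" if "u \<in> U" for u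
  proof -
    have "\<psi>' (\<psi> (f u)) = f u" using 1(7,8) that by (auto simp: homeomorphism_def)
    then show ?thesis using 1(9)[OF that] by simp
  qed
  then have "homeomorphism U V f (\<phi>' \<circ> \<psi>)" by (intro homeomorphism_cong[OF h]) auto
  then show thesis by (rule that[OF 1(2,1,3,4,5)])
qed

text \<open>The local inverses at the d points of one fibre give d distinct points over every nearby
  value. As nearby fibres also have exactly d points, nothing else lies over the neighbourhood, so
  it is evenly covered.\<close>

lemma covering_space_finite_fibres:
  fixes f :: "'a::metric_space \<Rightarrow> 'b::topological_space"
  assumes f: "continuous_on E f" "f ` E \<subseteq> Y" and "d > 0"
    and fib: "\<And>y. y \<in> Y \<Longrightarrow> finite (E \<inter> f -` {y}) \<and> card (E \<inter> f -` {y}) = d"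
    and loc: "\<And>x. x \<in> E \<Longrightarrow> \<exists>U V q. x \<in> U \<and> openin (top_of_set E) U \<and> openin (top_of_set Y) V \<and> homeomorphism U V f q"
  shows "covering_space E f Y"
proof
  show "f ` E = Y"
  proof
    show "Y \<subseteq> f ` E"
    proof
      fix y assume "y \<in> Y"
      then have "E \<inter> f -` {y} \<noteq> {}"
        using fib[of y] \<open>d > 0\<close> by (metis card.empty less_numeral_extra(3))
      then show "y \<in> f ` E" by blast
    qed
  qed (fact f)
  fix y assume y: "y \<in> Y"
  define F where "F = E \<inter> f -` {y}"
  have F: "finite F" "card F = d" using fib[OF y] by (auto simp: F_def)
  have FE: "F \<subseteq> E" by (auto simp: F_def)
  obtain e where e: "e > 0" "\<And>x x'. x \<in> F \<Longrightarrow> x' \<in> F \<Longrightarrow> x \<noteq> x' \<Longrightarrow> ball x e \<inter> ball x' e = {}"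
    using finite_disjoint_balls[OF F(1)] by metis
  have "\<forall>x\<in>F. \<exists>U V q. x \<in> U \<and> openin (top_of_set E) U \<and> openin (top_of_set Y) V \<and> homeomorphism U V f q"
    using loc FE by blast
  then obtain U V q where U: "\<And>x. x \<in> F \<Longrightarrow> x \<in> U x" "\<And>x. x \<in> F \<Longrightarrow> openin (top_of_set E) (U x)"
    "\<And>x. x \<in> F \<Longrightarrow> openin (top_of_set Y) (V x)" "\<And>x. x \<in> F \<Longrightarrow> homeomorphism (U x) (V x) f (q x)"
    by metis
  define U' where "U' x = U x \<inter> ball x e" for x
  have UE: "U x \<subseteq> E" if "x \<in> F" for x using U(2)[OF that] openin_imp_subset by blast
  have oU': "openin (top_of_set E) (U' x)" if "x \<in> F" for x
    unfolding U'_def using U(2)[OF that] by (intro openin_Int_open) auto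
  have ofU': "openin (top_of_set Y) (f ` U' x)" if "x \<in> F" for x
  proof -
    have "openin (top_of_set (U x)) (U' x)" unfolding U'_def by (simp add: openin_open_Int)
    then have "openin (top_of_set (V x)) (f ` U' x)"
      by (rule homeomorphism_imp_open_map[OF U(4)[OF that]])
    then show ?thesis using U(3)[OF that] openin_trans by blast
  qed
  define T where "T = Y \<inter> (\<Inter>x\<in>F. f ` U' x)"
  have oT: "openin (top_of_set Y) T"
  proof (cases "F = {}")
    case False
    then have "openin (top_of_set Y) (\<Inter>x\<in>F. f ` U' x)"
      using F(1) ofU' by (intro openin_INT2) auto
    then show ?thesis unfolding T_def by (intro openin_Int) auto
  qed (simp add: T_def)
  have xU': "x \<in> U' x" if "x \<in> F" for x using U(1)[OF that] e(1) by (simp add: U'_def)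
  have yT: "y \<in> T" unfolding T_def using y xU' by (force simp: F_def)
  define v where "v = (\<lambda>x. U' x \<inter> f -` T) ` F"
  have inj: "inj_on f (U' x)" if "x \<in> F" for x
    using U(4)[OF that] unfolding U'_def homeomorphism_def by (metis IntE inj_onI)
  have Uv: "\<Union> v = E \<inter> f -` T"
  proof
    show "\<Union> v \<subseteq> E \<inter> f -` T" unfolding v_def U'_def using UE by blast
    show "E \<inter> f -` T \<subseteq> \<Union> v"
    proof
      fix z assume z: "z \<in> E \<inter> f -` T"
      have ex: "\<exists>w. w \<in> U' x \<and> f w = f z" if "x \<in> F" for x
      proof -
        have "f z \<in> f ` U' x" using z that by (simp add: T_def)
        then show ?thesis by (auto simp: image_iff)
      qed
      \<comment> \<open>One point over f z from each of the d disjoint neighbourhoods; these d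
        points exhaust the fibre and so include z.\<close>
      define u where "u x = (SOME w. w \<in> U' x \<and> f w = f z)" for x
      have u: "u x \<in> U' x" "f (u x) = f z" if "x \<in> F" for x
        using someI_ex[OF ex[OF that]] by (simp_all add: u_def)
      have fz: "f z \<in> Y" using z by (auto simp: T_def)
      have sub: "u ` F \<subseteq> E \<inter> f -` {f z}" using u UE by (fastforce simp: U'_def)
      have "inj_on u F"
      proof (rule inj_onI)
        fix x x' assume "x \<in> F" "x' \<in> F" "u x = u x'"
        then have "x \<in> F" "x' \<in> F" "u x \<in> ball x e" "u x \<in> ball x' e"
          using u(1)[of x] u(1)[of x'] unfolding U'_def by simp_all
        then show "x = x'" using e(2)[of x x'] by blast
      qed
      then have "card (u ` F) = d" using F by (simp add: card_image)
      then have "u ` F = E \<inter> f -` {f z}" using sub fib[OF fz] by (intro card_subset_eq) auto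
      moreover have "z \<in> E \<inter> f -` {f z}" using z by simp
      ultimately have "z \<in> u ` F" by simp
      then obtain x where "x \<in> F" "z = u x" by (rule imageE)
      then show "z \<in> \<Union> v" using u(1) z unfolding v_def by blast
    qed
  qed
  have disj: "pairwise disjnt v"
    unfolding pairwise_def v_def disjnt_def
  proof clarify
    fix x x' assume "x \<in> F" "x' \<in> F" "U' x \<inter> f -` T \<noteq> U' x' \<inter> f -` T"
    then show "(U' x \<inter> f -` T) \<inter> (U' x' \<inter> f -` T) = {}" using e(2)[of x x'] unfolding U'_def by auto
  qed
  have ov: "openin (top_of_set E) u" if u: "u \<in> v" for u
  proof -
    have "openin (top_of_set E) (E \<inter> f -` T)"
      using f oT by (intro continuous_openin_preimage[of E f Y]) auto
    moreover obtain x where "x \<in> F" "u = U' x \<inter> f -` T" using u by (auto simp: v_def)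
    moreover have "U' x \<inter> f -` T = U' x \<inter> (E \<inter> f -` T)" if "x \<in> F" for x
      using UE[OF that] by (auto simp: U'_def)
    ultimately show ?thesis using oU' by (metis openin_Int)
  qed
  have hom: "\<exists>q. homeomorphism u T f q" if u: "u \<in> v" for u
  proof -
    obtain x where x: "x \<in> F" "u = U' x \<inter> f -` T" using u by (auto simp: v_def)
    have "f ` u = T"
    proof
      show "T \<subseteq> f ` u"
      proof
        fix t assume t: "t \<in> T"
        then have "t \<in> f ` U' x" using x unfolding T_def by blast
        then show "t \<in> f ` u" using x t by blast
      qed
    qed (use x in blast)
    moreover have "u \<subseteq> U x" using x by (auto simp: U'_def)
    ultimately have "homeomorphism u T f (q x)"
      by (intro homeomorphism_of_subsets[OF U(4)[OF x(1)]]) auto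
    then show ?thesis by blast
  qed
  show "\<exists>T. y \<in> T \<and> openin (top_of_set Y) T \<and> (\<exists>v. \<Union> v = E \<inter> f -` T \<and> (\<forall>u\<in>v. openin (top_of_set E) u) \<and>
      pairwise disjnt v \<and> (\<forall>u\<in>v. \<exists>q. homeomorphism u T f q))"
    by (intro exI[of _ T] conjI exI[of _ v] ballI yT oT Uv disj ov hom)
qed (fact f)

lemma covering_space_homeomorphism_compose:
  assumes cov: "covering_space E f Y" and hom: "homeomorphism Y Z t s"
  shows "covering_space E (t \<circ> f) Z"
proof
  have fE: "f ` E = Y" "continuous_on E f" using cov by (auto simp: covering_space_def)
  have tY: "t ` Y = Z" "continuous_on Y t" "inj_on t Y"
    using hom by (auto simp: homeomorphism_def inj_on_def) metis
  show "continuous_on E (t \<circ> f)" using fE tY by (intro continuous_on_compose) auto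
  show "(t \<circ> f) ` E = Z" using fE(1) tY(1) image_comp[of t f E] by simp
  fix z assume "z \<in> Z"
  then have "z \<in> t ` Y" by (simp only: tY(1))
  then obtain y where y: "z = t y" "y \<in> Y" by (rule imageE)
  have "\<exists>T. y \<in> T \<and> openin (top_of_set Y) T \<and> (\<exists>v. \<Union> v = E \<inter> f -` T \<and>
       (\<forall>u\<in>v. openin (top_of_set E) u) \<and> pairwise disjnt v \<and> (\<forall>u\<in>v. \<exists>q. homeomorphism u T f q))"
    by (rule cov[unfolded covering_space_def, THEN conjunct2, THEN conjunct2, THEN bspec, OF y(2)])
  then obtain T v where T: "y \<in> T" "openin (top_of_set Y) T" "\<Union> v = E \<inter> f -` T" "\<forall>u\<in>v. openin (top_of_set E) u"
    "pairwise disjnt v" "\<forall>u\<in>v. \<exists>q. homeomorphism u T f q"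
    by (elim exE conjE)
  have TY: "T \<subseteq> Y" using T(2) openin_imp_subset by blast
  have pre: "E \<inter> (t \<circ> f) -` (t ` T) = E \<inter> f -` T"
  proof -
    have "t (f x) \<in> t ` T \<longleftrightarrow> f x \<in> T" if "x \<in> E" for x
      using tY(3) TY that fE(1) by (metis imageI inj_on_image_mem_iff)
    then show ?thesis unfolding vimage_def o_def by blast
  qed
  have hT: "homeomorphism T (t ` T) t s" using hom TY by (rule homeomorphism_of_subsets) auto
  have "\<exists>q. homeomorphism u (t ` T) (t \<circ> f) q" if "u \<in> v" for u
    using bspec[OF T(6) that] homeomorphism_compose[OF _ hT] by blast
  moreover have "openin (top_of_set Z) (t ` T)" by (rule homeomorphism_imp_open_map[OF hom T(2)])
  ultimately show "\<exists>T. z \<in> T \<and> openin (top_of_set Z) T \<and> (\<exists>v. \<Union> v = E \<inter> (t \<circ> f) -` T \<and>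
     (\<forall>u\<in>v. openin (top_of_set E) u) \<and> pairwise disjnt v \<and> (\<forall>u\<in>v. \<exists>q. homeomorphism u T (t \<circ> f) q))"
    unfolding y(1)
      using T(1,3,4,5) pre by (intro exI[of _ "t ` T"] conjI exI[of _ v] ballI imageI) simp_all
qed

text \<open>Charts at the finitely many points over y are made disjoint by small balls. Compactness
  then yields one neighbourhood N of y all of whose preimages lie in these chart domains.\<close>

lemma branched_chart_neighbourhood:
  fixes S :: "'a::metric_space set"
  assumes f: "continuous_on S f" "f ` S \<subseteq> S" and "compact S" and y: "y \<in> S"
    and fin: "finite (S \<inter> f -` {y})"
    and pm: "\<And>x. x \<in> S \<Longrightarrow> f x = y \<Longrightarrow> locally_power_map (top_of_set S) (top_of_set S) f x (k x)"
  obtains N W \<phi> \<psi> where "openin (top_of_set S) N" "y \<in> N"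
    "\<And>x. x \<in> S \<Longrightarrow> f x = y \<Longrightarrow> openin (top_of_set S) (W x)"
    "\<And>x x'. x \<in> S \<inter> f -` {y} \<Longrightarrow> x' \<in> S \<inter> f -` {y} \<Longrightarrow> x \<noteq> x' \<Longrightarrow> W x \<inter> W x' = {}"
    "\<And>u. u \<in> S \<Longrightarrow> f u \<in> N \<Longrightarrow> \<exists>x\<in>S \<inter> f -` {y}. u \<in> W x"
    "\<And>x. x \<in> S \<Longrightarrow> f x = y \<Longrightarrow> continuous_on (W x) (\<phi> x) \<and> inj_on (\<phi> x) (W x)"
    "\<And>x. x \<in> S \<Longrightarrow> f x = y \<Longrightarrow> continuous_on N (\<psi> x) \<and> (\<forall>v\<in>N - {y}. \<psi> x v \<noteq> (0::complex))"
    "\<And>x u. x \<in> S \<Longrightarrow> f x = y \<Longrightarrow> u \<in> W x \<Longrightarrow> f u \<in> N \<Longrightarrow> \<psi> x (f u) = \<phi> x u ^ k x"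
    "\<And>x v. x \<in> S \<Longrightarrow> f x = y \<Longrightarrow> v \<in> N \<Longrightarrow> \<exists>u\<in>W x. f u = v"
proof -
  define F where "F = S \<inter> f -` {y}"
  have memF: "x \<in> F \<longleftrightarrow> x \<in> S \<and> f x = y" for x by (auto simp: F_def)
  obtain e where e: "e > 0" "\<And>x x'. x \<in> F \<Longrightarrow> x' \<in> F \<Longrightarrow> x \<noteq> x' \<Longrightarrow> ball x e \<inter> ball x' e = {}"
    using finite_disjoint_balls[OF fin[folded F_def]] by metis
  define R where "R x U V \<phi> \<psi> \<longleftrightarrow> openin (top_of_set S) U \<and> x \<in> U \<and> U \<subseteq> ball x e \<and> openin (top_of_set S) V \<and> y \<in> V \<and>
      continuous_on U \<phi> \<and> inj_on \<phi> U \<and> continuous_on V \<psi> \<and> (\<forall>v\<in>V - {y}. \<psi> v \<noteq> (0::complex)) \<and>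
      (\<forall>u\<in>U. \<psi> (f u) = \<phi> u ^ k x) \<and> V \<subseteq> f ` U" for x U V \<phi> \<psi>
  have "\<exists>U V \<phi> \<psi>. R x U V \<phi> \<psi>" if x: "x \<in> F" for x
  proof -
    have o: "openin (top_of_set S) (S \<inter> ball x e)" "x \<in> S \<inter> ball x e" "openin (top_of_set S) S" "f x \<in> S"
      using x e(1) f by (auto simp: F_def)
    have lpm: "locally_power_map (top_of_set S) (top_of_set S) f x (k x)"
      using pm x by (simp add: memF)
    show ?thesis
    proof (rule locally_power_map_disc_top_of_set[OF lpm o])
      fix U V \<phi> \<phi>' \<psi> \<psi>' r
      assume 1: "r > 0" "openin (top_of_set S) U" "x \<in> U" "U \<subseteq> S \<inter> ball x e"
        "openin (top_of_set S) V" "f x \<in> V" "homeomorphism U (ball (0::complex) r) \<phi> \<phi>'"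
        "homeomorphism V (ball (0::complex) (r ^ k x)) \<psi> \<psi>'" "\<psi> (f x) = 0"
        "f ` U \<subseteq> V" "\<And>u. u \<in> U \<Longrightarrow> \<psi> (f u) = \<phi> u ^ k x"
      have k: "k x \<ge> 1" using pm x by (auto simp: memF locally_power_map_def)
      have inj\<psi>: "inj_on \<psi> V" and inj\<phi>: "inj_on \<phi> U"
        using 1(7,8) unfolding homeomorphism_def by (metis inj_onI)+
      have nz: "\<forall>v\<in>V - {y}. \<psi> v \<noteq> 0"
        using inj\<psi> 1(6,9) x unfolding memF by (metis Diff_iff inj_onD singletonI)
      have sur: "V \<subseteq> f ` U"
      proof
        fix v assume v: "v \<in> V"
        have "\<psi> v \<in> ball 0 (r ^ k x)" using 1(8) v by (auto simp: homeomorphism_def)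
        then have lt: "norm (\<psi> v) < r ^ k x" by simp
        \<comment> \<open>Some k-th root of \<open>\<psi> v\<close>; zero is treated apart because
          the logarithm serves only non-zero values.\<close>
        define w where "w = (if \<psi> v = 0 then 0 else exp (Ln (\<psi> v) / of_nat (k x)))"
        have w: "w ^ k x = \<psi> v"
          using k by (auto simp: w_def exp_of_nat_mult[symmetric] power_0_left)
        then have "norm w ^ k x < r ^ k x" using lt by (metis norm_power)
        then have "norm w < r" using 1(1) power_less_imp_less_base less_imp_le by blast
        then obtain u where u: "u \<in> U" "\<phi> u = w"
          using 1(7) unfolding homeomorphism_def by (metis imageE mem_ball_0)
        then have "\<psi> (f u) = \<psi> v" using 1(11) w by simp
        then have "f u = v" using inj\<psi> 1(10) u v by (meson image_subset_iff inj_onD)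
        then show "v \<in> f ` U" using u by blast
      qed
      have "continuous_on U \<phi>" "continuous_on V \<psi>" using 1(7,8) by (auto simp: homeomorphism_def)
      then have "R x U V \<phi> \<psi>" unfolding R_def using 1 inj\<phi> nz sur x memF by blast
      then show ?thesis by blast
    qed
  qed
  then have "\<forall>x\<in>F. \<exists>U V \<phi> \<psi>. R x U V \<phi> \<psi>" by blast
  then obtain W V \<phi> \<psi> where R: "\<forall>x\<in>F. R x (W x) (V x) (\<phi> x) (\<psi> x)" by metis
  then have WV: "\<forall>x\<in>F. openin (top_of_set S) (W x) \<and> x \<in> W x \<and> W x \<subseteq> ball x e \<and>
      openin (top_of_set S) (V x) \<and> y \<in> V x \<and> continuous_on (W x) (\<phi> x) \<and> inj_on (\<phi> x) (W x) \<and>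
      continuous_on (V x) (\<psi> x) \<and> (\<forall>v\<in>V x - {y}. \<psi> x v \<noteq> 0) \<and> (\<forall>u\<in>W x. \<psi> x (f u) = \<phi> x u ^ k x) \<and> V x \<subseteq> f ` W x"
    unfolding R_def .
  \<comment> \<open>The part of the sphere outside all chart domains is compact and misses the fibre
    of y. Its image is therefore closed and avoids y, and N is cut down to avoid that image.\<close>
  define K where "K = S - (\<Union>x\<in>F. W x)"
  have "closedin (top_of_set S) K"
    unfolding K_def using WV by (intro closedin_diff openin_Union) auto
  then have "compact K" using \<open>compact S\<close> closedin_compact by blast
  moreover have "continuous_on K f" using f(1) by (rule continuous_on_subset) (auto simp: K_def)
  ultimately have "closed (f ` K)" by (intro compact_imp_closed compact_continuous_image)
  have "y \<notin> f ` K" using WV by (auto simp: K_def memF)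
  define N where "N = (\<Inter>x\<in>F. V x) \<inter> (S - f ` K)"
  have "openin (top_of_set S) (S - f ` K)" using \<open>closed (f ` K)\<close>
    by (simp add: Diff_eq open_Compl openin_open_Int)
  then have oN: "openin (top_of_set S) N"
  proof (cases "F = {}")
    case False
    have "openin (top_of_set S) (\<Inter>x\<in>F. V x)"
      using WV False fin by (intro openin_INT2) (auto simp: F_def)
    with \<open>openin (top_of_set S) (S - f ` K)\<close> show ?thesis unfolding N_def by (intro openin_Int)
  qed (simp add: N_def)
  have NV: "N \<subseteq> V x" if "x \<in> F" for x using that by (auto simp: N_def)
  have c4: "W x \<inter> W x' = {}" if "x \<in> F" "x' \<in> F" "x \<noteq> x'" for x x'
    using WV that e(2)[OF that] by blast
  have c5: "\<exists>x\<in>F. u \<in> W x" if "u \<in> S" "f u \<in> N" for u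
    using that by (auto simp: N_def K_def)
  show thesis
  proof (rule that[of N W \<phi> \<psi>])
    show "openin (top_of_set S) N" by (fact oN)
    show "y \<in> N" using \<open>y \<notin> f ` K\<close> y WV unfolding N_def by blast
    show "openin (top_of_set S) (W x)" if "x \<in> S" "f x = y" for x using WV that memF by blast
    show "W x \<inter> W x' = {}" if "x \<in> S \<inter> f -` {y}" "x' \<in> S \<inter> f -` {y}" "x \<noteq> x'" for x x'
      using c4 that unfolding F_def by blast
    show "\<exists>x\<in>S \<inter> f -` {y}. u \<in> W x" if "u \<in> S" "f u \<in> N" for u
      using c5 that unfolding F_def by blast
    show "continuous_on (W x) (\<phi> x) \<and> inj_on (\<phi> x) (W x)" if "x \<in> S" "f x = y" for x
      using bspec[OF WV, of x] that memF[of x] by simp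
    show "continuous_on N (\<psi> x) \<and> (\<forall>v\<in>N - {y}. \<psi> x v \<noteq> 0)" if "x \<in> S" "f x = y" for x
    proof -
      have x: "x \<in> F" using that memF by blast
      then show ?thesis using bspec[OF WV x] NV[OF x] by (auto intro: continuous_on_subset)
    qed
    show "\<psi> x (f u) = \<phi> x u ^ k x" if "x \<in> S" "f x = y" "u \<in> W x" "f u \<in> N" for x u
      using bspec[OF WV, of x] that memF[of x] by simp
    show "\<exists>u\<in>W x. f u = v" if "x \<in> S" "f x = y" "v \<in> N" for x v
    proof -
      have x: "x \<in> F" using that memF by blast
      then have "v \<in> f ` W x" using bspec[OF WV x] NV[OF x] that(3) by blast
      then show ?thesis by blast
    qed
  qed
qed

section \<open>Monodromy through sections over slit planes\<close>

text \<open>The two open half planes joined through the real gate I. The gates in use are the three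
  intervals into which 0 and 1 divide the real line.\<close>

definition slit_plane :: "real set \<Rightarrow> complex set" where
  "slit_plane I = {z. Im z \<noteq> 0 \<or> Re z \<in> I}"

definition real_edge :: "real set \<Rightarrow> bool" where
  "real_edge I \<longleftrightarrow> open I \<and> convex I \<and> I \<noteq> {} \<and> 0 \<notin> I \<and> 1 \<notin> I"

lemma open_slit_plane: "open I \<Longrightarrow> open (slit_plane I)"
proof -
  assume "open I"
  then have "open (Re -` I)" by (rule open_vimage) (intro continuous_intros)
  moreover have "open {z. Im z \<noteq> 0}" by (intro open_Collect_neq continuous_intros)
  moreover have "slit_plane I = {z. Im z \<noteq> 0} \<union> Re -` I" by (auto simp: slit_plane_def)
  ultimately show ?thesis by (simp add: open_Un)
qed

text \<open>The set is star-shaped about any c in I: a segment from c to a point off the axis leaves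
  the axis at once, and one to a point of the axis stays in I by convexity.\<close>

lemma simply_connected_slit_plane:
  assumes "convex I" "I \<noteq> {}"
  shows "simply_connected (slit_plane I)"
proof -
  obtain c where c: "c \<in> I" using assms(2) by blast
  have "closed_segment (of_real c) z \<subseteq> slit_plane I" if z: "z \<in> slit_plane I" for z
  proof
    fix w assume "w \<in> closed_segment (of_real c) z"
    then obtain u where u: "0 \<le> u" "u \<le> 1" "w = (1 - u) *\<^sub>R of_real c + u *\<^sub>R z"
      unfolding in_segment by blast
    have reim: "Re w = (1 - u) * c + u * Re z" "Im w = u * Im z" by (simp_all add: u(3))
    show "w \<in> slit_plane I"
    proof (cases "Im z = 0")
      case True
      then have "Re z \<in> I" using z by (simp add: slit_plane_def)
      then have "(1 - u) * c + u * Re z \<in> I" using assms(1) c u(1,2) unfolding convex_alt by simp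
      then show ?thesis by (simp add: slit_plane_def reim)
    next
      case False
      then show ?thesis using c by (cases "u = 0") (auto simp: slit_plane_def reim)
    qed
  qed
  moreover have "complex_of_real c \<in> slit_plane I" using c by (simp add: slit_plane_def)
  ultimately have "starlike (slit_plane I)" unfolding starlike_def by blast
  then show ?thesis by (rule starlike_imp_simply_connected)
qed

text \<open>The three branching points are normalized to 0, 1 and infinity, and E is the covering
  surface without the fibres over them.\<close>

locale punctured_plane_cover =
  fixes E :: "'a::real_normed_vector set" and p :: "'a \<Rightarrow> complex" and d :: nat
  assumes cov: "covering_space E p (UNIV - {0, 1})"
    and fib_fin: "z \<notin> {0, 1} \<Longrightarrow> finite (E \<inter> p -` {z})"
    and fib_card: "z \<notin> {0, 1} \<Longrightarrow> card (E \<inter> p -` {z}) = d"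
begin

definition sheets :: "'a set" where "sheets = E \<inter> p -` {\<i>}"

definition sec :: "real set \<Rightarrow> 'a \<Rightarrow> complex \<Rightarrow> 'a" where
  "sec I a = (SOME g. continuous_on (slit_plane I) g \<and> g ` slit_plane I \<subseteq> E \<and> g \<i> = a \<and> (\<forall>z\<in>slit_plane I. p (g z) = z))"

text \<open>Monodromy of the loop that runs from \<open>\<i>\<close> down through I to
  \<open>- \<i>\<close> and back up through J: the lift that starts on sheet a ends on sheet
  b.\<close>

definition cross :: "real set \<Rightarrow> real set \<Rightarrow> 'a \<Rightarrow> 'a" where
  "cross I J a = (THE b. b \<in> sheets \<and> sec J b (- \<i>) = sec I a (- \<i>))"

lemma finite_sheets: "finite sheets" and card_sheets: "card sheets = d"
  using fib_fin[of \<i>] fib_card[of \<i>] by (simp_all add: sheets_def complex_eq_iff)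

lemma slit_plane_sub: "real_edge I \<Longrightarrow> slit_plane I \<subseteq> UNIV - {0, 1}"
  by (auto simp: slit_plane_def real_edge_def)

lemma sec:
  assumes "real_edge I" "a \<in> sheets"
  shows "continuous_on (slit_plane I) (sec I a)" "\<And>z. z \<in> slit_plane I \<Longrightarrow> sec I a z \<in> E"
    "sec I a \<i> = a" "\<And>z. z \<in> slit_plane I \<Longrightarrow> p (sec I a z) = z"
proof -
  have I: "open I" "convex I" "I \<noteq> {}" using assms(1) by (auto simp: real_edge_def)
  have "\<i> \<in> slit_plane I" by (simp add: slit_plane_def)
  have ex: "\<exists>g. continuous_on (slit_plane I) g \<and> g ` slit_plane I \<subseteq> E \<and> g \<i> = a \<and> (\<forall>z\<in>slit_plane I. p (g z) = z)"
  proof (rule covering_space_lift_strong[OF cov _ \<open>\<i> \<in> slit_plane I\<close>, of a "\<lambda>z. z"])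
    show "a \<in> E" "\<i> = p a" using assms(2) by (auto simp: sheets_def)
    show "simply_connected (slit_plane I)" by (rule simply_connected_slit_plane[OF I(2,3)])
    show "locally path_connected (slit_plane I)"
      by (rule open_imp_locally_path_connected[OF open_slit_plane[OF I(1)]])
    show "(\<lambda>z. z) \<in> slit_plane I \<rightarrow> UNIV - {0, 1}" using slit_plane_sub[OF assms(1)] by blast
  qed (auto simp: image_subset_iff Pi_iff)
  from someI_ex[OF ex] show "continuous_on (slit_plane I) (sec I a)" "\<And>z. z \<in> slit_plane I \<Longrightarrow> sec I a z \<in> E"
    "sec I a \<i> = a" "\<And>z. z \<in> slit_plane I \<Longrightarrow> p (sec I a z) = z"
    unfolding sec_def[symmetric] by (auto simp: image_subset_iff)
qed

lemma sec_eq: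
  assumes "real_edge I" "real_edge J" "a \<in> sheets" "b \<in> sheets" "connected T" "T \<subseteq> slit_plane I" "T \<subseteq> slit_plane J"
    "w \<in> T" "sec I a w = sec J b w" "z \<in> T"
  shows "sec I a z = sec J b z"
proof (rule covering_space_lift_unique[where ?g1.0 = "sec I a" and ?g2.0 = "sec J b" and a = w and T = T and f = "\<lambda>z. z", OF cov assms(9)])
  show "continuous_on T (sec I a)" by (rule continuous_on_subset[OF sec(1)[OF assms(1,3)] assms(6)])
  show "continuous_on T (sec J b)" by (rule continuous_on_subset[OF sec(1)[OF assms(2,4)] assms(7)])
  show "(\<lambda>z. z) \<in> T \<rightarrow> UNIV - {0, 1}" using slit_plane_sub[OF assms(1)] assms(6) by auto
  show "sec I a \<in> T \<rightarrow> E" using sec(2)[OF assms(1,3)] assms(6) by auto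
  show "sec J b \<in> T \<rightarrow> E" using sec(2)[OF assms(2,4)] assms(7) by auto
  show "x = p (sec I a x)" if "x \<in> T" for x using sec(4)[OF assms(1,3), of x] that assms(6) by auto
  show "x = p (sec J b x)" if "x \<in> T" for x using sec(4)[OF assms(2,4), of x] that assms(7) by auto
qed (use assms in auto)

lemma connected_slit_plane: "real_edge I \<Longrightarrow> connected (slit_plane I)"
  unfolding real_edge_def using simply_connected_slit_plane simply_connected_imp_connected by blast

lemma half_planes: "connected {z. Im z > 0}" "connected {z. Im z < 0}"
  "{z. Im z > 0} \<subseteq> slit_plane I" "{z. Im z < 0} \<subseteq> slit_plane I"
  by (auto intro!: convex_connected convex_halfspace_Im_gt convex_halfspace_Im_lt simp: slit_plane_def)

lemma sec_upper:
  assumes "real_edge I" "real_edge J" "a \<in> sheets" "Im z > 0"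
  shows "sec I a z = sec J a z"
  by (rule sec_eq[OF assms(1,2,3,3) half_planes(1,3,3), of \<i>]) (use assms sec(3) in auto)

lemma sec_lower:
  assumes "real_edge I" "real_edge J" "a \<in> sheets" "b \<in> sheets" "Im w < 0" "sec I a w = sec J b w" "Im z < 0"
  shows "sec I a z = sec J b z"
  by (rule sec_eq[OF assms(1-4) half_planes(2,4,4), of w]) (use assms in auto)

text \<open>Two sections that agree at z agree at \<open>\<i>\<close>, where they take their labels.
  Surjectivity then follows by counting, since both fibres have d points.\<close>

lemma bij_betw_sec:
  assumes "real_edge I" "z \<in> slit_plane I"
  shows "bij_betw (\<lambda>a. sec I a z) sheets (E \<inter> p -` {z})"
proof -
  have inj: "inj_on (\<lambda>a. sec I a z) sheets"
  proof (rule inj_onI)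
    fix a b assume ab: "a \<in> sheets" "b \<in> sheets" "sec I a z = sec I b z"
    have "\<i> \<in> slit_plane I" by (simp add: slit_plane_def)
    then have "sec I a \<i> = sec I b \<i>"
      by (rule sec_eq[OF assms(1,1) ab(1,2) connected_slit_plane[OF assms(1)] order_refl order_refl assms(2) ab(3)])
    then show "a = b" using sec(3) assms ab by simp
  qed
  have sub: "(\<lambda>a. sec I a z) ` sheets \<subseteq> E \<inter> p -` {z}" using sec(2,4) assms by auto
  have z: "z \<notin> {0, 1}" using slit_plane_sub[OF assms(1)] assms(2) by blast
  have "(\<lambda>a. sec I a z) ` sheets = E \<inter> p -` {z}"
    by (rule card_subset_eq[OF fib_fin[OF z] sub]) (simp add: card_image[OF inj] card_sheets fib_card[OF z])
  with inj show ?thesis by (simp add: bij_betw_def)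
qed

lemma sec_inj:
  assumes "real_edge I" "z \<in> slit_plane I" "a \<in> sheets" "b \<in> sheets" "sec I a z = sec I b z"
  shows "a = b"
  using inj_onD[OF bij_betw_imp_inj_on[OF bij_betw_sec[OF assms(1,2)]], of a b] assms by simp

lemma mi_in: "- \<i> \<in> slit_plane I" by (simp add: slit_plane_def)

lemma cross:
  assumes "real_edge I" "real_edge J" "a \<in> sheets"
  shows "cross I J a \<in> sheets" "sec J (cross I J a) (- \<i>) = sec I a (- \<i>)"
    "\<And>b. b \<in> sheets \<Longrightarrow> sec J b (- \<i>) = sec I a (- \<i>) \<Longrightarrow> cross I J a = b"
proof -
  have "sec I a (- \<i>) \<in> E \<inter> p -` {- \<i>}" using sec(2,4)[OF assms(1,3) mi_in] by simp
  then have "sec I a (- \<i>) \<in> (\<lambda>b. sec J b (- \<i>)) ` sheets"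
    using bij_betw_imp_surj_on[OF bij_betw_sec[OF assms(2) mi_in]] by simp
  then obtain b where b: "b \<in> sheets" "sec J b (- \<i>) = sec I a (- \<i>)" by auto
  have uniq: "c = b" if "c \<in> sheets" "sec J c (- \<i>) = sec I a (- \<i>)" for c
    by (rule sec_inj[OF assms(2) mi_in that(1) b(1)]) (simp add: b(2) that(2))
  have eq: "cross I J a = b" unfolding cross_def
  proof (rule the_equality)
    show "b \<in> sheets \<and> sec J b (- \<i>) = sec I a (- \<i>)" using b by blast
    show "c = b" if "c \<in> sheets \<and> sec J c (- \<i>) = sec I a (- \<i>)" for c using uniq that by blast
  qed
  show "cross I J a \<in> sheets" "sec J (cross I J a) (- \<i>) = sec I a (- \<i>)" unfolding eq by (fact b)+
  show "cross I J a = c" if "c \<in> sheets" "sec J c (- \<i>) = sec I a (- \<i>)" for c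
    unfolding eq using uniq[OF that] by simp
qed

text \<open>Coming up through J and going down through J again cancels. For the three gates in order
  this is the relation that loops around 0 and 1 compose to a loop around infinity.\<close>

lemma cross_cross:
  assumes "real_edge I" "real_edge J" "real_edge K" "a \<in> sheets"
  shows "cross J K (cross I J a) = cross I K a"
  by (rule cross(3)[OF assms(2,3) cross(1)[OF assms(1,2,4)] cross(1)[OF assms(1,3,4)]])
     (simp add: cross(2) assms)

lemma cross_same: "real_edge I \<Longrightarrow> a \<in> sheets \<Longrightarrow> cross I I a = a"
  using cross(3)[of I I a a] by simp

lemma bij_betw_cross:
  assumes "real_edge I" "real_edge J"
  shows "bij_betw (cross I J) sheets sheets"
  by (rule bij_betw_byWitness[where f' = "cross J I"])
     (use assms cross_cross cross_same cross(1) in auto)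

text \<open>The circle starts on the gate J, passes through the upper half plane, crosses I
  downwards and returns to J through the lower half plane. The lift is glued from three sections,
  the last one carrying the label \<open>cross I J a\<close>.\<close>

lemma circle_lift:
  fixes c r :: real
  assumes IJ: "real_edge I" "real_edge J" and "c + r \<in> J" "c - r \<in> I" "r > 0" and a: "a \<in> sheets"
  obtains l where "continuous_on {0..1} l" "\<And>t. t \<in> {0..1} \<Longrightarrow> l t \<in> E"
    "\<And>t. t \<in> {0..1} \<Longrightarrow> p (l t) = of_real c + of_real r * exp (2 * of_real pi * \<i> * of_real t)"
    "l 0 = sec J a (of_real (c + r))" "l 1 = sec J (cross I J a) (of_real (c + r))"
proof -
  define \<gamma> where "\<gamma> t = of_real c + of_real r * exp (2 * of_real pi * \<i> * of_real t)" for t :: real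
  have \<gamma>_cis: "\<gamma> t = of_real c + of_real r * cis (2 * pi * t)" for t
    by (simp add: \<gamma>_def cis_conv_exp algebra_simps)
  have Im\<gamma>: "Im (\<gamma> t) = r * sin (2 * pi * t)" and Re\<gamma>: "Re (\<gamma> t) = c + r * cos (2 * pi * t)" for t
    by (simp_all add: \<gamma>_cis)
  have up: "Im (\<gamma> t) > 0" if "0 < t" "t < 1/2" for t
    unfolding Im\<gamma> using that \<open>r > 0\<close> by (intro mult_pos_pos sin_gt_zero) auto
  have down: "Im (\<gamma> t) < 0" if "1/2 < t" "t < 1" for t
  proof -
    have "sin (2 * pi * t) < 0" using that by (intro sin_lt_zero) auto
    then show ?thesis unfolding Im\<gamma> using \<open>r > 0\<close> by (simp add: mult_pos_neg)
  qed
  have ends: "\<gamma> 0 = of_real (c + r)" "\<gamma> 1 = of_real (c + r)" "\<gamma> (1/2) = of_real (c - r)"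
    by (simp_all add: \<gamma>_cis complex_eq_iff)
  have cont\<gamma>: "continuous_on X \<gamma>" for X unfolding \<gamma>_def by (intro continuous_intros)
  define b where "b = cross I J a"
  have b: "b \<in> sheets" "sec J b (- \<i>) = sec I a (- \<i>)"
    using cross(1,2)[OF IJ a] by (simp_all add: b_def)
  have in1: "\<gamma> t \<in> slit_plane J" if "0 \<le> t" "t \<le> 1/4" for t
    using up[of t] ends(1) \<open>c + r \<in> J\<close> that by (cases "t = 0") (auto simp: slit_plane_def)
  have in2: "\<gamma> t \<in> slit_plane I" if "1/4 \<le> t" "t \<le> 3/4" for t
  proof -
    consider "t < 1/2" | "t = 1/2" | "t > 1/2" by linarith
    then show ?thesis
    proof cases
      case 1
      then show ?thesis using up[of t] that by (simp add: slit_plane_def)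
    next
      case 2
      then show ?thesis using ends(3) \<open>c - r \<in> I\<close> by (simp only: slit_plane_def) simp
    next
      case 3
      then show ?thesis using down[of t] that by (simp add: slit_plane_def)
    qed
  qed
  have in3: "\<gamma> t \<in> slit_plane J" if "3/4 \<le> t" "t \<le> 1" for t
    using down[of t] ends(2) \<open>c + r \<in> J\<close> that by (cases "t = 1") (auto simp: slit_plane_def)
  \<comment> \<open>The times 1/4 and 3/4 are the top and the bottom of the circle. They lie in the
    open half planes, where sections over different slit planes can be compared.\<close>
  define l where "l t = (if t \<le> 1/4 then sec J a (\<gamma> t) else if t \<le> 3/4 then sec I a (\<gamma> t) else sec J b (\<gamma> t))" for t
  have cont: "continuous_on X (\<lambda>t. sec K x (\<gamma> t))" if "real_edge K" "x \<in> sheets" "\<gamma> ` X \<subseteq> slit_plane K" for K x X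
    using continuous_on_compose2[OF sec(1)[OF that(1,2)] cont\<gamma>] that(3) by blast
  show thesis
  proof
    show "continuous_on {0..1} l" unfolding l_def
    proof (rule continuous_on_cases_le)
      have eq: "{t \<in> {0..1}. t \<le> 1/4} = {0..1/4::real}" by auto
      show "continuous_on {t \<in> {0..1}. t \<le> 1/4} (\<lambda>t. sec J a (\<gamma> t))"
        unfolding eq by (rule cont[OF IJ(2) a]) (use in1 in auto)
      have eq2: "{t \<in> {0..1}. 1/4 \<le> t} = {1/4..1::real}" by auto
      show "continuous_on {t \<in> {0..1}. 1/4 \<le> t} (\<lambda>t. if t \<le> 3/4 then sec I a (\<gamma> t) else sec J b (\<gamma> t))"
        unfolding eq2
      proof (rule continuous_on_cases_le)
        have eq: "{t \<in> {1/4..1}. t \<le> 3/4} = {1/4..3/4::real}" by auto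
        show "continuous_on {t \<in> {1/4..1}. t \<le> 3/4} (\<lambda>t. sec I a (\<gamma> t))"
          unfolding eq by (rule cont[OF IJ(1) a]) (use in2 in auto)
        have eq: "{t \<in> {1/4..1}. 3/4 \<le> t} = {3/4..1::real}" by auto
        show "continuous_on {t \<in> {1/4..1}. 3/4 \<le> t} (\<lambda>t. sec J b (\<gamma> t))"
          unfolding eq by (rule cont[OF IJ(2) b(1)]) (use in3 in auto)
        show "sec I a (\<gamma> t) = sec J b (\<gamma> t)" if "t = 3/4" for t
          by (rule sec_lower[OF IJ a b(1) _ b(2)[symmetric] down]) (use that in auto)
      qed (intro continuous_intros)
      show "sec J a (\<gamma> t) = (if t \<le> 3/4 then sec I a (\<gamma> t) else sec J b (\<gamma> t))" if "t = 1/4" for t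
      proof -
        have t: "0 < t" "t < 1/2" using that by simp_all
        then have "sec J a (\<gamma> t) = sec I a (\<gamma> t)" by (rule sec_upper[OF IJ(2,1) a up])
        then show ?thesis using t by simp
      qed
    qed (intro continuous_intros)
    show "l t \<in> E" if "t \<in> {0..1}" for t
      using that sec(2)[OF IJ(2) a in1[of t]] sec(2)[OF IJ(1) a in2[of t]] sec(2)[OF IJ(2) b(1) in3[of t]]
      by (simp add: l_def)
    show "p (l t) = of_real c + of_real r * exp (2 * of_real pi * \<i> * of_real t)" if "t \<in> {0..1}" for t
      using that sec(4)[OF IJ(2) a in1[of t]] sec(4)[OF IJ(1) a in2[of t]] sec(4)[OF IJ(2) b(1) in3[of t]]
      unfolding \<gamma>_def[symmetric] by (simp add: l_def)
    show "l 0 = sec J a (of_real (c + r))" "l 1 = sec J (cross I J a) (of_real (c + r))"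
      using ends by (simp_all add: l_def b_def)
  qed
qed

text \<open>Along a circle around a branching point, in a chart in which the covering is \<open>u \<mapsto> u\<^sup>k\<close>,
  every lift gets multiplied by the same \<open>k\<close>-th root of unity, whatever the (unknown) winding
  number of the circle in that chart.\<close>

lemma cross_order:
  fixes c r :: real and k :: "'x \<Rightarrow> nat" and W :: "'x \<Rightarrow> 'a set" and \<phi> :: "'x \<Rightarrow> 'a \<Rightarrow> complex"
    and \<psi> :: "'x \<Rightarrow> complex \<Rightarrow> complex"
  assumes IJ: "real_edge I" "real_edge J" and cr: "c + r \<in> J" "c - r \<in> I" "r > 0"
    and circ: "sphere (of_real c) r \<subseteq> N"
    and W: "\<And>x. x \<in> F \<Longrightarrow> openin (top_of_set E) (W x)"
    and disj: "\<And>x y. x \<in> F \<Longrightarrow> y \<in> F \<Longrightarrow> x \<noteq> y \<Longrightarrow> W x \<inter> W y = {}"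
    and cover: "\<And>u. u \<in> E \<Longrightarrow> p u \<in> N \<Longrightarrow> \<exists>x\<in>F. u \<in> W x"
    and \<phi>: "\<And>x. x \<in> F \<Longrightarrow> continuous_on (W x) (\<phi> x)" "\<And>x. x \<in> F \<Longrightarrow> inj_on (\<phi> x) (W x)"
    and \<psi>: "\<And>x. x \<in> F \<Longrightarrow> continuous_on N (\<psi> x)" "\<And>x z. x \<in> F \<Longrightarrow> z \<in> N \<Longrightarrow> \<psi> x z \<noteq> 0"
    and eq: "\<And>x u. x \<in> F \<Longrightarrow> u \<in> W x \<Longrightarrow> p u \<in> N \<Longrightarrow> \<psi> x (p u) = \<phi> x u ^ k x"
    and k: "\<And>x. x \<in> F \<Longrightarrow> k x \<in> {1, 3}"
    and k1: "x1 \<in> F" "k x1 = 1" and sur: "\<And>z. z \<in> N \<Longrightarrow> \<exists>u\<in>W x1. p u = z"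
  shows "\<And>a. a \<in> sheets \<Longrightarrow> cross I J (cross I J (cross I J a)) = a"
    and "\<exists>a\<in>sheets. cross I J a = a"
proof -
  define q where "q = complex_of_real (c + r)"
  define \<gamma> where "\<gamma> t = of_real c + of_real r * exp (2 * of_real pi * \<i> * of_real t)" for t :: real
  have \<gamma>N: "\<gamma> t \<in> N" for t
  proof -
    have "cmod (exp (2 * of_real pi * \<i> * of_real t)) = 1" by (simp add: norm_exp_eq_Re)
    then have "\<gamma> t \<in> sphere (of_real c) r" using \<open>r > 0\<close> by (simp add: \<gamma>_def dist_norm norm_mult)
    then show ?thesis using circ by blast
  qed
  have \<gamma>01: "\<gamma> 0 = q" "\<gamma> 1 = q" using exp_two_pi_i by (simp_all add: \<gamma>_def q_def mult.assoc)
  have qJ: "q \<in> slit_plane J" using cr by (simp add: q_def slit_plane_def)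
  have cont\<gamma>: "continuous_on {0..1} \<gamma>" unfolding \<gamma>_def by (intro continuous_intros)
  let ?m = "cross I J"
  let ?s = "\<lambda>a. sec J a q"
  have m: "?m a \<in> sheets" if "a \<in> sheets" for a by (rule cross(1)[OF IJ that])
  have sE: "?s a \<in> E" "p (?s a) = q" if "a \<in> sheets" for a using sec(2,4)[OF IJ(2) that qJ] by auto
  have inj_s: "a = b" if "a \<in> sheets" "b \<in> sheets" "?s a = ?s b" for a b
    by (rule sec_inj[OF IJ(2) qJ that])
  have root: "\<exists>\<eta>. \<eta> ^ k x = 1 \<and> (\<forall>a\<in>sheets. ?s a \<in> W x \<longrightarrow> ?s (?m a) \<in> W x \<and> \<phi> x (?s (?m a)) = \<eta> * \<phi> x (?s a))"
    if x: "x \<in> F" for x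
  proof -
    \<comment> \<open>The circle stays where \<open>\<psi> x\<close> has no zero, so a continuous
      logarithm L exists along it. The difference L 1 - L 0 is 2 pi i times the unknown winding
      number.\<close>
    have "continuous_on {0..1} (\<lambda>t. \<psi> x (\<gamma> t))"
      using continuous_on_compose2[OF \<psi>(1)[OF x] cont\<gamma>] \<gamma>N by blast
    then obtain L where L: "continuous_on {0..1::real} L" "\<And>t. t \<in> {0..1} \<Longrightarrow> \<psi> x (\<gamma> t) = exp (L t)"
      using continuous_logarithm_on_contractible[of "{0..1::real}" "\<lambda>t. \<psi> x (\<gamma> t)"] \<psi>(2)[OF x \<gamma>N]
        convex_imp_contractible[of "{0..1::real}"] by auto
    have kx: "k x \<noteq> 0" using k[OF x] by auto
    \<comment> \<open>Defined from the chart at x alone, without reference to a sheet: hence one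
      root of unity serves all lifts inside \<open>W x\<close>.\<close>
    define \<eta> where "\<eta> = exp ((L 1 - L 0) / of_nat (k x))"
    have "\<eta> ^ k x = exp (L 1 - L 0)" using kx by (simp add: \<eta>_def flip: exp_of_nat_mult)
    also have "\<dots> = 1" using L(2)[of 0] L(2)[of 1] \<gamma>01 \<psi>(2)[OF x \<gamma>N] by (simp add: exp_diff)
    finally have "\<eta> ^ k x = 1" .
    moreover have "?s (?m a) \<in> W x \<and> \<phi> x (?s (?m a)) = \<eta> * \<phi> x (?s a)" if a: "a \<in> sheets" "?s a \<in> W x" for a
    proof -
      obtain l where l: "continuous_on {0..1} l" "\<And>t. t \<in> {0..1} \<Longrightarrow> l t \<in> E"
        "\<And>t. t \<in> {0..1} \<Longrightarrow> p (l t) = \<gamma> t" "l 0 = ?s a" "l 1 = ?s (?m a)"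
        by (rule circle_lift[OF IJ cr a(1), folded \<gamma>_def q_def]) blast
      have "connected (l ` {0..1})" by (rule connected_continuous_image[OF l(1)]) simp
      moreover have "l ` {0..1} \<noteq> {}" "l ` {0..1} \<subseteq> E" using l(2) by auto
      moreover have "l ` {0..1} \<subseteq> (\<Union>x\<in>F. W x)"
      proof
        fix u assume "u \<in> l ` {0..1}"
        then have "u \<in> E" "p u \<in> N" using l(2,3) \<gamma>N by auto
        then show "u \<in> (\<Union>x\<in>F. W x)" using cover by blast
      qed
      ultimately obtain x' where x': "x' \<in> F" "l ` {0..1} \<subseteq> W x'"
        using connected_subset_disjoint_open_UN[of "l ` {0..1}" W F E] W disj by metis
      have "l 0 \<in> l ` {0..1}" by (rule imageI) simp
      then have "l 0 \<in> W x'" using x'(2) by blast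
      moreover have "l 0 \<in> W x" using l(4) a(2) by simp
      ultimately have "x' = x" using disj[OF x'(1) x] by blast
      then have lW: "l t \<in> W x" if "t \<in> {0..1}" for t using x'(2) that by blast
      \<comment> \<open>The quotient of the lift, read in the chart, by a continuous k-th root of
        \<open>\<psi> x (\<gamma> t)\<close>. It takes values in the finite set of k-th roots of
        unity, so continuity makes it constant.\<close>
      define h where "h t = \<phi> x (l t) / exp (L t / of_nat (k x))" for t
      have hk: "h t ^ k x = 1" if t: "t \<in> {0..1}" for t
      proof -
        have "\<phi> x (l t) ^ k x = \<psi> x (p (l t))" using eq[OF x lW[OF t]] l(3)[OF t] \<gamma>N by simp
        also have "\<dots> = exp (L t)" using L(2)[OF t] l(3)[OF t] by simp
        also have "\<dots> = exp (L t / of_nat (k x)) ^ k x" using kx by (simp flip: exp_of_nat_mult)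
        finally show ?thesis by (simp add: h_def power_divide)
      qed
      have "continuous_on {0..1} (\<lambda>t. \<phi> x (l t))"
        using continuous_on_compose2[OF \<phi>(1)[OF x] l(1)] lW by blast
      then have "continuous_on {0..1} h"
        unfolding h_def using L(1) kx by (intro continuous_intros) auto
      moreover have "finite (h ` {0..1})"
        by (rule finite_subset[of _ "{z. z ^ k x = 1}"]) (use hk finite_nth_roots kx in auto)
      ultimately have "h constant_on {0..1}" by (intro continuous_finite_range_constant) auto
      then have "h 1 = h 0" unfolding constant_on_def by auto
      then have "\<phi> x (l 1) = \<phi> x (l 0) * (exp (L 1 / of_nat (k x)) / exp (L 0 / of_nat (k x)))"
        by (simp add: h_def field_simps)
      also have "exp (L 1 / of_nat (k x)) / exp (L 0 / of_nat (k x)) = \<eta>"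
        by (simp add: \<eta>_def diff_divide_distrib exp_diff)
      finally show ?thesis using lW[of 1] l(4,5) by (simp add: mult.commute)
    qed
    ultimately show ?thesis by blast
  qed
  show "?m (?m (?m a)) = a" if a: "a \<in> sheets" for a
  proof -
    have "p (?s a) \<in> N" using sE(2)[OF a] \<gamma>N[of 0] \<gamma>01 by simp
    then obtain x where x: "x \<in> F" "?s a \<in> W x" using cover sE(1)[OF a] by blast
    obtain \<eta> where \<eta>: "\<eta> ^ k x = 1" "\<And>a. a \<in> sheets \<Longrightarrow> ?s a \<in> W x \<Longrightarrow> ?s (?m a) \<in> W x \<and> \<phi> x (?s (?m a)) = \<eta> * \<phi> x (?s a)"
      using root[OF x(1)] by blast
    \<comment> \<open>Both admissible local degrees, 1 and 3, divide 3.\<close>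
    have \<eta>3: "\<eta> ^ 3 = 1" using \<eta>(1) k[OF x(1)] by auto
    have 1: "?s (?m a) \<in> W x" "\<phi> x (?s (?m a)) = \<eta> * \<phi> x (?s a)" using \<eta>(2)[OF a x(2)] by auto
    have 2: "?s (?m (?m a)) \<in> W x" "\<phi> x (?s (?m (?m a))) = \<eta> * \<phi> x (?s (?m a))"
      using \<eta>(2)[OF m[OF a] 1(1)] by auto
    have 3: "?s (?m (?m (?m a))) \<in> W x" "\<phi> x (?s (?m (?m (?m a)))) = \<eta> * \<phi> x (?s (?m (?m a)))"
      using \<eta>(2)[OF m[OF m[OF a]] 2(1)] by auto
    have "\<phi> x (?s (?m (?m (?m a)))) = \<eta> ^ 3 * \<phi> x (?s a)"
      unfolding 3(2) 2(2) 1(2) by (simp add: power3_eq_cube)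
    then have "\<phi> x (?s (?m (?m (?m a)))) = \<phi> x (?s a)" by (simp add: \<eta>3)
    then have "?s (?m (?m (?m a))) = ?s a" using 3(1) x(2) by (rule inj_onD[OF \<phi>(2)[OF x(1)]])
    then show ?thesis by (rule inj_s[OF m[OF m[OF m[OF a]]] a])
  qed
  show "\<exists>a\<in>sheets. ?m a = a"
  proof -
    \<comment> \<open>Near a point of local degree 1 the root of unity is 1, so the sheet that
      passes through \<open>W x1\<close> returns to itself.\<close>
    obtain u where u: "u \<in> W x1" "p u = q" using sur[of q] \<gamma>N[of 0] \<gamma>01 by auto
    then have "u \<in> E \<inter> p -` {q}" using openin_imp_subset[OF W[OF k1(1)]] by auto
    then obtain a where a: "a \<in> sheets" "u = ?s a"
      using bij_betw_imp_surj_on[OF bij_betw_sec[OF IJ(2) qJ]] by blast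
    obtain \<eta> where \<eta>: "\<eta> ^ k x1 = 1" "\<And>a. a \<in> sheets \<Longrightarrow> ?s a \<in> W x1 \<Longrightarrow> ?s (?m a) \<in> W x1 \<and> \<phi> x1 (?s (?m a)) = \<eta> * \<phi> x1 (?s a)"
      using root[OF k1(1)] by blast
    have 1: "?s (?m a) \<in> W x1" "\<phi> x1 (?s (?m a)) = \<phi> x1 (?s a)"
      using \<eta>(2)[OF a(1)] a(2) u(1) \<eta>(1) k1(2) by auto
    have "?s a \<in> W x1" using a(2) u(1) by simp
    with 1 have "?s (?m a) = ?s a" by (intro inj_onD[OF \<phi>(2)[OF k1(1)]])
    then have "?m a = a" by (rule inj_s[OF m[OF a(1)] a(1)])
    then show ?thesis using a(1) by blast
  qed
qed

text \<open>Because p is a local homeomorphism, every point of E close enough to a value of the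
  section is itself the value of the section at its projection.\<close>

lemma open_sec_image:
  assumes I: "real_edge I" and a: "a \<in> sheets"
  shows "openin (top_of_set E) (sec I a ` slit_plane I)"
proof (subst openin_subopen, clarify)
  fix z assume z: "z \<in> slit_plane I"
  obtain T V q where T: "sec I a z \<in> T" "openin (top_of_set E) T" "openin (top_of_set (UNIV - {0, 1})) V" "homeomorphism T V p q"
    using covering_space_local_homeomorphism[OF cov sec(2)[OF I a z]] by metis
  have oI: "open (slit_plane I)" using I by (simp add: real_edge_def open_slit_plane)
  have TE: "T \<subseteq> E" using T(2) openin_imp_subset by blast
  obtain T' where T': "open T'" "T = E \<inter> T'" using T(2) by (auto simp: openin_open)
  have "open (slit_plane I \<inter> sec I a -` T')"
    using continuous_open_preimage[OF sec(1)[OF I a] oI T'(1)] .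
  then have "openin (top_of_set E) (E \<inter> p -` (slit_plane I \<inter> sec I a -` T'))"
    using continuous_openin_preimage_gen[OF covering_space_imp_continuous[OF cov]] by blast
  then have "openin (top_of_set E) (T \<inter> (E \<inter> p -` (slit_plane I \<inter> sec I a -` T')))"
    using T(2) by (rule openin_Int[rotated])
  moreover have "sec I a z \<in> T \<inter> (E \<inter> p -` (slit_plane I \<inter> sec I a -` T'))"
    using T(1) T'(2) TE z sec(4)[OF I a z] by auto
  moreover have "T \<inter> (E \<inter> p -` (slit_plane I \<inter> sec I a -` T')) \<subseteq> sec I a ` slit_plane I"
  proof
    fix u assume "u \<in> T \<inter> (E \<inter> p -` (slit_plane I \<inter> sec I a -` T'))"
    then have u: "u \<in> T" "p u \<in> slit_plane I" "sec I a (p u) \<in> T'" by auto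
    then have "sec I a (p u) \<in> T" using T'(2) sec(2)[OF I a u(2)] by auto
    moreover have "p (sec I a (p u)) = p u" by (rule sec(4)[OF I a u(2)])
    ultimately have "sec I a (p u) = u" using T(4) u(1) unfolding homeomorphism_def by metis
    then show "u \<in> sec I a ` slit_plane I" using u(2) by (metis imageI)
  qed
  ultimately show "\<exists>T. openin (top_of_set E) T \<and> sec I a z \<in> T \<and> T \<subseteq> sec I a ` slit_plane I"
    by blast
qed

text \<open>If B is stable under all crossings, the sections labelled by B and those labelled by its
  complement sweep out two disjoint open sets that cover E. Connectedness forces one of them to be
  empty.\<close>

lemma sheets_transitive:
  assumes "connected E" and Is: "\<And>I. I \<in> \<I> \<Longrightarrow> real_edge I" and cover: "\<And>z. z \<notin> {0, 1} \<Longrightarrow> \<exists>I\<in>\<I>. z \<in> slit_plane I"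
    and disj: "\<And>I J. I \<in> \<I> \<Longrightarrow> J \<in> \<I> \<Longrightarrow> I \<noteq> J \<Longrightarrow> I \<inter> J = {}"
    and B: "B \<subseteq> sheets" "B \<noteq> {}" and inv: "\<And>I J. I \<in> \<I> \<Longrightarrow> J \<in> \<I> \<Longrightarrow> cross I J ` B \<subseteq> B"
  shows "B = sheets"
proof -
  define Q where "Q B = (\<Union>I\<in>\<I>. \<Union>a\<in>B. sec I a ` slit_plane I)" for B
  have op: "openin (top_of_set E) (Q B)" if "B \<subseteq> sheets" for B
    unfolding Q_def
      using that open_sec_image Is by (intro openin_Union ballI) (auto intro!: openin_Union)
  have un: "E \<subseteq> Q B \<union> Q (sheets - B)"
  proof
    fix u assume u: "u \<in> E"
    then have "p u \<notin> {0, 1}" using covering_space_imp_surjective[OF cov] by blast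
    then obtain I where I: "I \<in> \<I>" "p u \<in> slit_plane I" using cover by blast
    have "u \<in> E \<inter> p -` {p u}" using u by simp
    then obtain a where a: "a \<in> sheets" "u = sec I a (p u)"
      using bij_betw_imp_surj_on[OF bij_betw_sec[OF Is[OF I(1)] I(2)]] by blast
    have "u \<in> Q C" if "a \<in> C" for C
      unfolding Q_def using imageI[OF I(2), of "sec I a"] a(2) I(1) that by auto
    then show "u \<in> Q B \<union> Q (sheets - B)" using a(1) by (cases "a \<in> B") simp_all
  qed
  have dj: "Q B \<inter> Q (sheets - B) = {}"
  proof (rule ccontr)
    assume "Q B \<inter> Q (sheets - B) \<noteq> {}"
    then obtain I J a b z w where 1: "I \<in> \<I>" "J \<in> \<I>" "a \<in> B" "b \<in> sheets" "b \<notin> B" "z \<in> slit_plane I" "w \<in> slit_plane J"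
      "sec I a z = sec J b w" unfolding Q_def by blast
    have aS: "a \<in> sheets" using 1 B by blast
    have "p (sec I a z) = z" "p (sec J b w) = w"
      by (rule sec(4)[OF Is[OF 1(1)] aS 1(6)], rule sec(4)[OF Is[OF 1(2)] 1(4) 1(7)])
    then have zw: "z = w" using 1(8) by simp
    have RI: "real_edge I" "real_edge J" using Is 1 by auto
    have "a \<noteq> b" using 1 by blast
    have neq: "sec I a z \<noteq> sec I b z"
      using sec_inj[OF RI(1) 1(6) aS 1(4)] \<open>a \<noteq> b\<close> by blast
    then have "I \<noteq> J" using 1(8) zw by auto
    then have "Im z \<noteq> 0" using 1(6,7) zw disj[OF 1(1,2)] by (auto simp: slit_plane_def)
    \<comment> \<open>Above the axis, equal values mean equal labels whatever the gates are. Below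
      it, a common value of sections over I and J says that crossing takes one label to the other,
      and B is closed under that.\<close>
    then consider "Im z > 0" | "Im z < 0" by linarith
    then show False
    proof cases
      case 1
      then show False
        using sec_upper[OF RI(2,1) \<open>b \<in> sheets\<close>, of z] neq \<open>sec I a z = sec J b w\<close> zw by simp
    next
      case 2
      then have "sec I a (- \<i>) = sec J b (- \<i>)"
        using sec_lower[OF RI aS \<open>b \<in> sheets\<close>, of z "- \<i>"] \<open>sec I a z = sec J b w\<close> zw by simp
      then have "cross I J a = b" by (intro cross(3)[OF RI aS \<open>b \<in> sheets\<close>]) simp
      then show False using inv[OF \<open>I \<in> \<I>\<close> \<open>J \<in> \<I>\<close>] \<open>a \<in> B\<close> \<open>b \<notin> B\<close> by blast
    qed
  qed
  have ne: "Q B' \<noteq> {}" if B': "B' \<subseteq> sheets" "B' \<noteq> {}" for B'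
  proof -
    obtain b I where "b \<in> B'" "I \<in> \<I>" using B' cover[of \<i>] by (auto simp: complex_eq_iff)
    moreover have "\<i> \<in> slit_plane I" by (simp add: slit_plane_def)
    ultimately show ?thesis unfolding Q_def by blast
  qed
  have "Q (sheets - B) = {}"
  proof (rule ccontr)
    assume "Q (sheets - B) \<noteq> {}"
    moreover have "Q B \<noteq> {}" by (rule ne[OF B])
    ultimately show False
      using \<open>connected E\<close> op[OF B(1)] op[of "sheets - B"] un dj unfolding connected_openin by blast
  qed
  then show ?thesis using ne[of "sheets - B"] B by blast
qed

end

section \<open>From a cover of the sphere with three branching points to the punctured plane\<close>

lemma homeomorphism_facts:
  assumes "homeomorphism S T f g"
  shows "x \<in> S \<Longrightarrow> g (f x) = x" "y \<in> T \<Longrightarrow> f (g y) = y" "x \<in> S \<Longrightarrow> f x \<in> T" "y \<in> T \<Longrightarrow> g y \<in> S"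
  using assms by (auto simp: homeomorphism_def)

text \<open>Without one point of F the sphere is a plane, and a plane remains connected when
  finitely many points are removed.\<close>

lemma connected_sphere_minus_finite:
  assumes "finite F" "F \<noteq> {}" "F \<subseteq> sphere (0::complex \<times> real) 1"
  shows "connected (sphere (0::complex \<times> real) 1 - F)"
proof -
  obtain p where p: "p \<in> F" using assms(2) by blast
  then have ps: "p \<in> sphere (0::complex \<times> real) 1" using assms(3) by blast
  obtain g h where gh: "homeomorphism (sphere (0::complex \<times> real) 1 - {p}) (UNIV :: complex set) g h"
    using sphere_minus_point_homeomorphic_plane[OF ps] unfolding homeomorphic_def by blast
  let ?S = "sphere (0::complex \<times> real) 1"
  have hg: "\<And>x. x \<in> ?S - {p} \<Longrightarrow> h (g x) = x" "\<And>z. g (h z) = z" "\<And>z. h z \<in> ?S - {p}"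
    using homeomorphism_facts[OF gh] by simp_all
  have "?S - F = h ` (UNIV - g ` (F - {p}))"
  proof
    show "?S - F \<subseteq> h ` (UNIV - g ` (F - {p}))"
    proof
      fix x assume x: "x \<in> ?S - F"
      then have xp: "x \<in> ?S - {p}" using p by blast
      have "g x \<notin> g ` (F - {p})"
      proof
        assume "g x \<in> g ` (F - {p})"
        then obtain y where y: "g x = g y" "y \<in> F - {p}" by (rule imageE)
        then have "h (g x) = h (g y)" by simp
        then have "x = y" using hg(1)[OF xp] hg(1)[of y] y(2) assms(3) by auto
        then show False using x y by blast
      qed
      then show "x \<in> h ` (UNIV - g ` (F - {p}))"
        using hg(1)[OF xp] by (intro image_eqI[of _ _ "g x"]) auto
    qed
    show "h ` (UNIV - g ` (F - {p})) \<subseteq> ?S - F"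
    proof
      fix x assume "x \<in> h ` (UNIV - g ` (F - {p}))"
      then obtain z where z: "x = h z" "z \<notin> g ` (F - {p})" by blast
      have "x \<notin> F" using z hg(2)[of z] hg(3)[of z] by (metis DiffD2 DiffI image_eqI)
      then show "x \<in> ?S - F" using hg(3)[of z] z(1) by blast
    qed
  qed
  moreover have "connected (UNIV - g ` (F - {p}))"
    using assms(1) by (intro connected_open_diff_countable) (auto simp: countable_finite)
  moreover have "continuous_on UNIV h" using gh by (auto simp: homeomorphism_def)
  ultimately show ?thesis by (metis connected_continuous_image continuous_on_subset subset_UNIV)
qed

text \<open>A homeomorphism of the sphere minus y3 with the plane puts y3 at infinity; an affine
  change of coordinate then moves the images of y1 and y2 to 0 and 1.\<close>

lemma sphere_normal_form:
  assumes "y1 \<in> sphere (0::complex \<times> real) 1" "y2 \<in> sphere (0::complex \<times> real) 1"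
    "y3 \<in> sphere (0::complex \<times> real) 1" "y1 \<noteq> y2" "y1 \<noteq> y3" "y2 \<noteq> y3"
  obtains \<tau> \<sigma> where "homeomorphism (sphere (0::complex \<times> real) 1 - {y3}) (UNIV :: complex set) \<tau> \<sigma>" "\<sigma> 0 = y1" "\<sigma> 1 = y2"
proof -
  let ?S = "sphere (0::complex \<times> real) 1"
  obtain g h where gh: "homeomorphism (?S - {y3}) (UNIV :: complex set) g h"
    using sphere_minus_point_homeomorphic_plane[OF assms(3)] unfolding homeomorphic_def by blast
  have hg: "h (g y1) = y1" "h (g y2) = y2"
    using homeomorphism_facts(1)[OF gh] assms by auto
  define D where "D = g y2 - g y1"
  have "D \<noteq> 0" using hg assms(4) unfolding D_def by (metis right_minus_eq)
  then have aff: "homeomorphism UNIV UNIV (\<lambda>z. (z - g y1) / D) (\<lambda>z. g y1 + z * D)"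
    by (intro homeomorphismI) (auto intro!: continuous_intros)
  have "homeomorphism (?S - {y3}) UNIV ((\<lambda>z. (z - g y1) / D) \<circ> g) (h \<circ> (\<lambda>z. g y1 + z * D))"
    by (rule homeomorphism_compose[OF gh aff])
  then show thesis by (rule that) (use hg in \<open>simp_all add: D_def\<close>)
qed

lemma realizable_333_extract:
  assumes P: "P = replicate_mset k 3 + {#1#}" and "realizable (top_of_set S) (top_of_set S) d {#P, P, P#}"
  obtains f B where "continuous_on S f" "f ` S \<subseteq> S" "B \<subseteq> S" "card B = 3"
    "\<And>y. y \<in> S - B \<Longrightarrow> finite (S \<inter> f -` {y}) \<and> card (S \<inter> f -` {y}) = d"
    "\<And>x. x \<in> S \<Longrightarrow> f x \<notin> B \<Longrightarrow> locally_power_map (top_of_set S) (top_of_set S) f x 1"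
    "\<And>y. y \<in> B \<Longrightarrow> finite (S \<inter> f -` {y})"
    "\<And>x. x \<in> S \<Longrightarrow> locally_power_map (top_of_set S) (top_of_set S) f x (local_degree (top_of_set S) (top_of_set S) f x)"
    "\<And>x. x \<in> S \<Longrightarrow> f x \<in> B \<Longrightarrow> local_degree (top_of_set S) (top_of_set S) f x \<in> {1, 3}"
    "\<And>y. y \<in> B \<Longrightarrow> \<exists>x\<in>S. f x = y \<and> local_degree (top_of_set S) (top_of_set S) f x = 1"
proof -
  let ?X = "top_of_set S"
  obtain f where f: "branched_cover ?X ?X f" "has_degree ?X ?X f d" "finite (branching_points ?X ?X f)"
     "image_mset (local_degrees_over ?X ?X f) (mset_set (branching_points ?X ?X f)) = {#P, P, P#}"
    using assms(2) unfolding realizable_def by blast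
  define B where "B = branching_points ?X ?X f"
  let ?ld = "local_degree ?X ?X f"
  have fib: "fibre ?X f y = S \<inter> f -` {y}" for y by (auto simp: fibre_def)
  have cm: "continuous_map ?X ?X f" using f(1) by (simp add: branched_cover_def)
  have lpm: "locally_power_map ?X ?X f x (?ld x)" if "x \<in> S" for x
    using branched_cover_local_degree[OF f(1)] that by simp
  have ld1: "?ld x \<ge> 1" if "x \<in> S" for x using lpm[OF that] by (simp add: locally_power_map_def)
  have BS: "B \<subseteq> S" by (auto simp: B_def branching_points_def)
  have "size (image_mset (local_degrees_over ?X ?X f) (mset_set B)) = 3"
    using f(4) by (simp add: B_def)
  then have cB: "card B = 3" by simp
  have lo: "local_degrees_over ?X ?X f y = P" if "y \<in> B" for y
  proof -
    have "local_degrees_over ?X ?X f y \<in># image_mset (local_degrees_over ?X ?X f) (mset_set B)"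
      using that f(3) by (simp add: B_def)
    then show ?thesis unfolding B_def f(4) by simp
  qed
  \<comment> \<open>\<open>mset_set\<close> of an infinite fibre would be empty, but P contains the
    part 1.\<close>
  have finB: "finite (S \<inter> f -` {y})" if "y \<in> B" for y
  proof (rule ccontr)
    assume "infinite (S \<inter> f -` {y})"
    then have "local_degrees_over ?X ?X f y = {#}" by (simp add: local_degrees_over_def fib)
    then show False using lo[OF that] P by simp
  qed
  have setP: "?ld ` (S \<inter> f -` {y}) = set_mset P" if "y \<in> B" for y
    using arg_cong[OF lo[OF that], of set_mset] finB[OF that]
      by (simp add: local_degrees_over_def fib)
  show thesis
  proof (rule that[of f B])
    show "continuous_on S f" using cm by (simp add: continuous_map_subtopology_eu)
    show "f ` S \<subseteq> S" using cm by (auto simp: continuous_map_def)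
    show "finite (S \<inter> f -` {y}) \<and> card (S \<inter> f -` {y}) = d" if "y \<in> S - B" for y
      using f(2) that unfolding has_degree_def B_def fib by simp
    show "locally_power_map ?X ?X f x 1" if "x \<in> S" "f x \<notin> B" for x
    proof -
      have "f x \<in> S" using cm that by (auto simp: continuous_map_def)
      moreover have "x \<in> fibre ?X f (f x)" using that by (simp add: fibre_def)
      ultimately have "\<not> ?ld x > 1" using that(2) unfolding B_def branching_points_def by auto
      then have "?ld x = 1" using ld1[OF that(1)] by simp
      then show ?thesis using lpm[OF that(1)] by simp
    qed
    show "?ld x \<in> {1, 3}" if "x \<in> S" "f x \<in> B" for x
    proof -
      have "?ld x \<in> ?ld ` (S \<inter> f -` {f x})" using that by simp
      then show ?thesis
        unfolding setP[OF that(2)] P by (auto simp: in_replicate_mset split: if_splits)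
    qed
    show "\<exists>x\<in>S. f x = y \<and> ?ld x = 1" if y: "y \<in> B" for y
    proof -
      have "1 \<in> ?ld ` (S \<inter> f -` {y})" unfolding setP[OF y] P by simp
      then obtain x where x: "1 = ?ld x" "x \<in> S \<inter> f -` {y}" by (rule imageE)
      then show ?thesis by (intro bexI[of _ x]) auto
    qed
  qed (use BS cB finB lpm in simp_all)
qed

lemma real_edges: "real_edge {..<0}" "real_edge {0<..<1}" "real_edge {1<..}"
proof -
  show "real_edge {..<0}" unfolding real_edge_def by (auto intro!: exI[of _ "-1::real"])
  have "{0<..<1::real} \<noteq> {}" by (simp add: greaterThanLessThan_empty_iff)
  then show "real_edge {0<..<1}" unfolding real_edge_def by auto
  show "real_edge {1<..}" unfolding real_edge_def by (auto intro!: exI[of _ "2::real"])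
qed

lemma slit_planes_cover:
  assumes "z \<notin> {0, 1}"
  shows "\<exists>I\<in>{{..<0}, {0<..<1}, {1<..}}. z \<in> slit_plane I"
proof -
  have "Im z \<noteq> 0 \<or> Re z < 0 \<or> (0 < Re z \<and> Re z < 1) \<or> Re z > 1"
    using assms by (auto simp: complex_eq_iff)
  then show ?thesis by (auto simp: slit_plane_def)
qed

lemma (in punctured_plane_cover) card_eq_norm:
  assumes "connected E" "d > 0"
    and o: "\<And>I J a. (I, J) \<in> {({..<0}, {0<..<1}), ({0<..<1}, {1<..}), ({..<0}, {1<..})} \<Longrightarrow> a \<in> sheets \<Longrightarrow>
        cross I J (cross I J (cross I J a)) = a"
    and fx: "p0 \<in> sheets" "cross {..<0} {0<..<1} p0 = p0"
  obtains \<alpha> where "\<alpha> \<in> eisenstein" "(cmod \<alpha>)\<^sup>2 = real d"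
proof -
  let ?n = "{..<0::real}" let ?m = "{0<..<1::real}" let ?p = "{1::real<..}"
  note e = real_edges
  \<comment> \<open>a is the monodromy around 0 and b the one around 1; \<open>b \<circ> a\<close>
    enters through the negative axis and leaves beyond 1, so it goes around infinity.\<close>
  define a where "a x = (if x \<in> sheets then cross ?n ?m x else x)" for x
  define b where "b x = (if x \<in> sheets then cross ?m ?p x else x)" for x
  have ax: "a x = cross ?n ?m x" "a x \<in> sheets" if "x \<in> sheets" for x
    using that cross(1)[OF e(1,2)] by (simp_all add: a_def)
  have bx: "b x = cross ?m ?p x" "b x \<in> sheets" if "x \<in> sheets" for x
    using that cross(1)[OF e(2,3)] by (simp_all add: b_def)
  have ba: "b (a x) = cross ?n ?p x" if "x \<in> sheets" for x
    using bx(1)[OF ax(2)[OF that]] ax(1)[OF that] cross_cross[OF e that] by simp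
  have c: "cross ?n ?p x \<in> sheets" if "x \<in> sheets" for x by (rule cross(1)[OF e(1,3) that])
  show thesis
  proof (rule card_eq_eisenstein_norm[OF finite_sheets, of a b p0])
    have "bij_betw a sheets sheets"
      using bij_betw_cross[OF e(1,2)] by (rule bij_betw_cong[THEN iffD1, rotated]) (simp add: ax)
    then show "a permutes sheets" by (rule bij_imp_permutes) (simp add: a_def)
    have "bij_betw b sheets sheets"
      using bij_betw_cross[OF e(2,3)] by (rule bij_betw_cong[THEN iffD1, rotated]) (simp add: bx)
    then show "b permutes sheets" by (rule bij_imp_permutes) (simp add: b_def)
    show "a (a (a x)) = x" if "x \<in> sheets" for x
      using o[of ?n ?m x] that ax(2)[OF that] ax(2)[OF ax(2)[OF that]] by (simp add: ax(1))
    show "b (b (b x)) = x" if "x \<in> sheets" for x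
      using o[of ?m ?p x] that bx(2)[OF that] bx(2)[OF bx(2)[OF that]] by (simp add: bx(1))
    show "b (a (b (a (b (a x))))) = x" if "x \<in> sheets" for x
      using o[of ?n ?p x] that c[OF that] c[OF c[OF that]] by (simp add: ba)
    show "p0 \<in> sheets" "a p0 = p0" using fx by (simp_all add: a_def)
    show "C = sheets" if C: "C \<subseteq> sheets" "C \<noteq> {}" "a ` C \<subseteq> C" "b ` C \<subseteq> C" for C
    proof (rule sheets_transitive[OF assms(1), of "{?n, ?m, ?p}"])
      \<comment> \<open>An injection of the finite set C into itself is onto, so C is closed under
        the inverse crossing as well.\<close>
      have rev_cl: "cross J I ` C \<subseteq> C" if IJ: "real_edge I" "real_edge J" and fwd: "cross I J ` C \<subseteq> C" for I J
      proof -
        have "finite C" using C(1) finite_sheets by (rule finite_subset)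
        moreover have "inj_on (cross I J) C"
          using bij_betw_imp_inj_on[OF bij_betw_cross[OF IJ]] C(1) by (rule inj_on_subset)
        ultimately have eq: "cross I J ` C = C" using fwd by (intro endo_inj_surj)
        show ?thesis
        proof
          fix y assume "y \<in> cross J I ` C"
          then obtain x where x: "y = cross J I x" "x \<in> C" by (rule imageE)
          then have "x \<in> cross I J ` C" using eq by simp
          then obtain w where w: "x = cross I J w" "w \<in> C" by (rule imageE)
          have ws: "w \<in> sheets" using w C(1) by blast
          have "y = cross J I (cross I J w)" using x w by simp
          also have "\<dots> = w" using cross_cross[OF IJ IJ(1) ws] cross_same[OF IJ(1) ws] by simp
          finally show "y \<in> C" using w by simp
        qed
      qed
      have comp: "cross I K ` C \<subseteq> C" if "real_edge I" "real_edge J" "real_edge K" "cross I J ` C \<subseteq> C" "cross J K ` C \<subseteq> C" for I J K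
      proof
        fix y assume "y \<in> cross I K ` C"
        then obtain x where x: "y = cross I K x" "x \<in> C" by (rule imageE)
        have "x \<in> sheets" using x C(1) by blast
        then have "y = cross J K (cross I J x)" using cross_cross[OF that(1-3)] x by simp
        then show "y \<in> C" using that(4,5) x(2) by blast
      qed
      have id: "cross I I ` C \<subseteq> C" if "real_edge I" for I
        using cross_same[OF that] C(1) by auto
      have "a ` C = cross ?n ?m ` C" by (rule image_cong[OF refl ax(1)]) (rule subsetD[OF C(1)])
      then have nm: "cross ?n ?m ` C \<subseteq> C" using C(3) by (simp only:)
      have "b ` C = cross ?m ?p ` C" by (rule image_cong[OF refl bx(1)]) (rule subsetD[OF C(1)])
      then have mp: "cross ?m ?p ` C \<subseteq> C" using C(4) by (simp only:)
      note mn = rev_cl[OF e(1,2) nm] and pm = rev_cl[OF e(2,3) mp]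
      note np = comp[OF e nm mp]
      note pn = rev_cl[OF e(1,3) np]
      show "cross I J ` C \<subseteq> C" if "I \<in> {?n, ?m, ?p}" "J \<in> {?n, ?m, ?p}" for I J
        using that nm mp mn pm np pn id[OF e(1)] id[OF e(2)] id[OF e(3)]
          by (elim insertE emptyE) simp_all
      show "real_edge I" if "I \<in> {?n, ?m, ?p}" for I using that e by auto
      show "I \<inter> J = {}" if "I \<in> {?n, ?m, ?p}" "J \<in> {?n, ?m, ?p}" "I \<noteq> J" for I J
        using that by (elim insertE emptyE) auto
    qed (use C slit_planes_cover in auto)
  next
    fix \<alpha> assume "\<alpha> \<in> eisenstein" "(cmod \<alpha>)\<^sup>2 = real (card sheets)"
    then show thesis using that card_sheets by simp
  qed
qed

lemma realizable_333_imp: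
  assumes P: "P = replicate_mset k 3 + {#1#}" and "d > 0"
    and real: "realizable (top_of_set (sphere (0::complex \<times> real) 1)) (top_of_set (sphere (0::complex \<times> real) 1)) d {#P, P, P#}"
  obtains x y :: nat where "d = x\<^sup>2 + x * y + y\<^sup>2"
proof -
  let ?S = "sphere (0::complex \<times> real) 1"
  let ?X = "top_of_set ?S"
  obtain f B where cf: "continuous_on ?S f" and fS: "f ` ?S \<subseteq> ?S" and BS: "B \<subseteq> ?S" and cB: "card B = 3"
    and fib: "\<And>y. y \<in> ?S - B \<Longrightarrow> finite (?S \<inter> f -` {y}) \<and> card (?S \<inter> f -` {y}) = d"
    and lpm1: "\<And>x. x \<in> ?S \<Longrightarrow> f x \<notin> B \<Longrightarrow> locally_power_map ?X ?X f x 1"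
    and finB: "\<And>y. y \<in> B \<Longrightarrow> finite (?S \<inter> f -` {y})"
    and lpm: "\<And>x. x \<in> ?S \<Longrightarrow> locally_power_map ?X ?X f x (local_degree ?X ?X f x)"
    and ld13: "\<And>x. x \<in> ?S \<Longrightarrow> f x \<in> B \<Longrightarrow> local_degree ?X ?X f x \<in> {1, 3}"
    and ld1: "\<And>y. y \<in> B \<Longrightarrow> \<exists>x\<in>?S. f x = y \<and> local_degree ?X ?X f x = 1"
    by (rule realizable_333_extract[OF P real]) blast
  define ld where "ld = local_degree ?X ?X f"
  obtain y1 y2 y3 where B: "B = {y1, y2, y3}" "y1 \<noteq> y2" "y1 \<noteq> y3" "y2 \<noteq> y3"
    using cB by (auto simp: card_3_iff)
  then have yS: "y1 \<in> ?S" "y2 \<in> ?S" "y3 \<in> ?S" using BS by auto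
  obtain \<tau> \<sigma> where hom: "homeomorphism (?S - {y3}) (UNIV :: complex set) \<tau> \<sigma>" and \<sigma>01: "\<sigma> 0 = y1" "\<sigma> 1 = y2"
    by (rule sphere_normal_form[OF yS B(2-4)])
  have \<tau>\<sigma>: "\<tau> (\<sigma> z) = z" "\<sigma> z \<in> ?S - {y3}" for z
    using homeomorphism_facts(2,4)[OF hom UNIV_I] by simp_all
  have \<sigma>\<tau>: "\<sigma> (\<tau> x) = x" if "x \<in> ?S - {y3}" for x by (rule homeomorphism_facts(1)[OF hom that])
  have c\<sigma>: "continuous_on UNIV \<sigma>" and c\<tau>: "continuous_on (?S - {y3}) \<tau>"
    using hom by (auto simp: homeomorphism_def)
  have \<sigma>B: "\<sigma> z \<in> ?S - B \<longleftrightarrow> z \<notin> {0, 1}" for z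
  proof -
    have "\<sigma> z = y1 \<longleftrightarrow> z = 0" "\<sigma> z = y2 \<longleftrightarrow> z = 1" using \<sigma>01 \<tau>\<sigma>(1) by metis+
    then show ?thesis using \<tau>\<sigma>(2)[of z] B(1) by auto
  qed
  \<comment> \<open>Whole fibres over B are deleted, including their points of local degree 1, so
    that exactly d sheets remain over every other point.\<close>
  define E where "E = ?S \<inter> f -` (- B)"
  have ES: "E \<subseteq> ?S" "f ` E \<subseteq> ?S - B" using fS by (auto simp: E_def)
  have oSB: "openin ?X (?S - B)"
    using cB by (intro openin_diff) (auto intro!: closed_subset finite_imp_closed BS card_ge_0_finite simp: card_gt_0_iff)
  have "E = ?S \<inter> f -` (?S - B)" using fS by (auto simp: E_def)
  then have oE: "openin ?X E" using continuous_openin_preimage[OF cf _ oSB] fS by auto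
  have fibE: "E \<inter> f -` {y} = ?S \<inter> f -` {y}" if "y \<in> ?S - B" for y using that by (auto simp: E_def)
  have cov: "covering_space E f (?S - B)"
  proof (rule covering_space_finite_fibres[OF _ ES(2) \<open>d > 0\<close>])
    show "continuous_on E f" using cf ES(1) by (rule continuous_on_subset)
    show "finite (E \<inter> f -` {y}) \<and> card (E \<inter> f -` {y}) = d" if "y \<in> ?S - B" for y
      using fib[OF that] fibE[OF that] by simp
    show "\<exists>U V q. x \<in> U \<and> openin (top_of_set E) U \<and> openin (top_of_set (?S - B)) V \<and> homeomorphism U V f q" if x: "x \<in> E" for x
    proof -
      have "x \<in> ?S" "f x \<in> ?S - B" using x ES by blast+
      then have xS: "x \<in> ?S" "f x \<notin> B" "f x \<in> ?S - B" by blast+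
      obtain U V q where U: "x \<in> U" "openin ?X U" "U \<subseteq> E" "openin ?X V" "V \<subseteq> ?S - B" "homeomorphism U V f q"
        by (rule locally_power_map_1_local_homeomorphism[OF lpm1[OF xS(1,2)] oE x oSB xS(3)])
      have "openin (top_of_set E) U" by (rule openin_subset_trans[OF U(2,3) ES(1)])
      moreover have "openin (top_of_set (?S - B)) V" by (rule openin_subset_trans[OF U(4,5)]) auto
      ultimately show ?thesis using U by blast
    qed
  qed
  have homB: "homeomorphism (?S - B) (UNIV - {0, 1}) \<tau> \<sigma>"
  proof (rule homeomorphism_of_subsets[OF hom])
    show "?S - B \<subseteq> ?S - {y3}" using B by blast
    show "\<tau> ` (?S - B) = UNIV - {0, 1}"
    proof
      show "\<tau> ` (?S - B) \<subseteq> UNIV - {0, 1}"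
      proof
        fix z assume "z \<in> \<tau> ` (?S - B)"
        then obtain x where x: "z = \<tau> x" "x \<in> ?S - B" by (rule imageE)
        then have "\<sigma> z = x" using \<sigma>\<tau>[of x] B(1) by auto
        then have "z \<notin> {0, 1}" using x(2) \<sigma>B[of z] by simp
        then show "z \<in> UNIV - {0, 1}" by blast
      qed
      show "UNIV - {0, 1} \<subseteq> \<tau> ` (?S - B)"
      proof
        fix z :: complex assume "z \<in> UNIV - {0, 1}"
        then have "\<sigma> z \<in> ?S - B" using \<sigma>B[of z] by blast
        then show "z \<in> \<tau> ` (?S - B)" using \<tau>\<sigma>(1)[of z] by (intro image_eqI[of _ _ "\<sigma> z"]) simp_all
      qed
    qed
  qed auto
  define p where "p = \<tau> \<circ> f"
  have p_eq: "p u = z \<longleftrightarrow> f u = \<sigma> z" if "u \<in> E" for u z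
  proof -
    have "f u \<in> ?S - {y3}" using that ES(2) B(1) by auto
    then show ?thesis unfolding p_def o_def using \<sigma>\<tau>[of "f u"] \<tau>\<sigma>(1)[of z] by auto
  qed
  have fibp: "E \<inter> p -` {z} = ?S \<inter> f -` {\<sigma> z}" if "z \<notin> {0, 1}" for z
  proof -
    have "E \<inter> p -` {z} = E \<inter> f -` {\<sigma> z}" using p_eq by auto
    then show ?thesis using fibE \<sigma>B[of z] that by simp
  qed
  interpret punctured_plane_cover E p d
  proof
    show "covering_space E p (UNIV - {0, 1})"
      unfolding p_def by (rule covering_space_homeomorphism_compose[OF cov homB])
    show "finite (E \<inter> p -` {z})" "card (E \<inter> p -` {z}) = d" if "z \<notin> {0, 1}" for z
      unfolding fibp[OF that] using fib[of "\<sigma> z"] \<sigma>B[of z] that by blast+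
  qed
  have conn: "connected E"
  proof -
    have "?S \<inter> f -` B = (\<Union>y\<in>B. ?S \<inter> f -` {y})" by auto
    then have "finite (?S \<inter> f -` B)" using finB B(1) by auto
    moreover have "?S \<inter> f -` B \<noteq> {}" using ld1[of y1] B(1) by auto
    ultimately have "connected (?S - (?S \<inter> f -` B))" by (intro connected_sphere_minus_finite) auto
    moreover have "?S - (?S \<inter> f -` B) = E" by (auto simp: E_def)
    ultimately show ?thesis by simp
  qed
  \<comment> \<open>Formulated for every circle that \<open>\<sigma>\<close> carries into a
    neighbourhood of y, so that small circles around 0 and 1 and large circles around infinity are
    treated alike.\<close>
  have vertex: "\<exists>N. openin ?X N \<and> y \<in> N \<and> (\<forall>I J c r. real_edge I \<longrightarrow> real_edge J \<longrightarrow> c + r \<in> J \<longrightarrow> c - r \<in> I \<longrightarrow> r > 0 \<longrightarrow>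
      (\<forall>z\<in>sphere (complex_of_real c) r. z \<notin> {0, 1} \<and> \<sigma> z \<in> N) \<longrightarrow>
      (\<forall>a\<in>sheets. cross I J (cross I J (cross I J a)) = a) \<and> (\<exists>a\<in>sheets. cross I J a = a))" if y: "y \<in> B" for y
  proof -
    have yS: "y \<in> ?S" using y BS by blast
    have pm: "locally_power_map ?X ?X f x (ld x)" if "x \<in> ?S" "f x = y" for x
      unfolding ld_def by (rule lpm[OF that(1)])
    obtain N W \<phi> \<psi> where N: "openin ?X N" "y \<in> N"
      and W: "\<And>x. x \<in> ?S \<Longrightarrow> f x = y \<Longrightarrow> openin ?X (W x)"
      and disj: "\<And>x x'. x \<in> ?S \<inter> f -` {y} \<Longrightarrow> x' \<in> ?S \<inter> f -` {y} \<Longrightarrow> x \<noteq> x' \<Longrightarrow> W x \<inter> W x' = {}"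
      and cover: "\<And>u. u \<in> ?S \<Longrightarrow> f u \<in> N \<Longrightarrow> \<exists>x\<in>?S \<inter> f -` {y}. u \<in> W x"
      and \<phi>: "\<And>x. x \<in> ?S \<Longrightarrow> f x = y \<Longrightarrow> continuous_on (W x) (\<phi> x) \<and> inj_on (\<phi> x) (W x)"
      and \<psi>: "\<And>x. x \<in> ?S \<Longrightarrow> f x = y \<Longrightarrow> continuous_on N (\<psi> x) \<and> (\<forall>v\<in>N - {y}. \<psi> x v \<noteq> (0::complex))"
      and eq: "\<And>x u. x \<in> ?S \<Longrightarrow> f x = y \<Longrightarrow> u \<in> W x \<Longrightarrow> f u \<in> N \<Longrightarrow> \<psi> x (f u) = \<phi> x u ^ ld x"
      and sur: "\<And>x v. x \<in> ?S \<Longrightarrow> f x = y \<Longrightarrow> v \<in> N \<Longrightarrow> \<exists>u\<in>W x. f u = v"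
    proof (rule branched_chart_neighbourhood[OF cf fS compact_sphere yS finB[OF y]])
      show "locally_power_map ?X ?X f x (ld x)" if "x \<in> ?S" "f x = y" for x by (rule pm[OF that])
    next
      fix N W \<phi> \<psi>
      assume h1: "openin ?X N"
        and h2: "y \<in> N"
        and h3: "\<And>x. x \<in> ?S \<Longrightarrow> f x = y \<Longrightarrow> openin ?X (W x)"
        and h4: "\<And>x x'. x \<in> ?S \<inter> f -` {y} \<Longrightarrow> x' \<in> ?S \<inter> f -` {y} \<Longrightarrow> x \<noteq> x' \<Longrightarrow> W x \<inter> W x' = {}"
        and h5: "\<And>u. u \<in> ?S \<Longrightarrow> f u \<in> N \<Longrightarrow> \<exists>x\<in>?S \<inter> f -` {y}. u \<in> W x"
        and h6: "\<And>x. x \<in> ?S \<Longrightarrow> f x = y \<Longrightarrow> continuous_on (W x) (\<phi> x) \<and> inj_on (\<phi> x) (W x)"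
        and h7: "\<And>x. x \<in> ?S \<Longrightarrow> f x = y \<Longrightarrow> continuous_on N (\<psi> x) \<and> (\<forall>v\<in>N - {y}. \<psi> x v \<noteq> (0::complex))"
        and h8: "\<And>x u. x \<in> ?S \<Longrightarrow> f x = y \<Longrightarrow> u \<in> W x \<Longrightarrow> f u \<in> N \<Longrightarrow> \<psi> x (f u) = \<phi> x u ^ ld x"
        and h9: "\<And>x v. x \<in> ?S \<Longrightarrow> f x = y \<Longrightarrow> v \<in> N \<Longrightarrow> \<exists>u\<in>W x. f u = v"
      show thesis by (rule that[OF h1 h2 h3 h4 h5 h6 h7 h8 h9])
    qed
    let ?F = "?S \<inter> f -` {y}"
    obtain x1 where x1: "x1 \<in> ?F" "ld x1 = 1" using ld1[OF y] by (auto simp: ld_def)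
    define M where "M = {z. z \<notin> {0, 1} \<and> \<sigma> z \<in> N}"
    have pN: "f u \<in> N" "f u = \<sigma> (p u)" if "u \<in> E" "p u \<in> M" for u
    proof -
      show "f u = \<sigma> (p u)" using p_eq[OF that(1), of "p u"] by simp
      then show "f u \<in> N" using that(2) by (simp add: M_def)
    qed
    have My: "\<sigma> z \<in> N - {y}" if "z \<in> M" for z using that \<sigma>B[of z] y by (auto simp: M_def)
    have conc: "(\<forall>a\<in>sheets. cross I J (cross I J (cross I J a)) = a) \<and> (\<exists>a\<in>sheets. cross I J a = a)"
      if IJ: "real_edge I" "real_edge J" and cr: "c + r \<in> J" "c - r \<in> I" "r > 0"
        and circ: "\<forall>z\<in>sphere (complex_of_real c) r. z \<notin> {0, 1} \<and> \<sigma> z \<in> N" for I J c r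
    proof -
      have c1: "sphere (complex_of_real c) r \<subseteq> M" using circ by (auto simp: M_def)
      have c2: "openin (top_of_set E) (W x \<inter> E)" if "x \<in> ?F" for x
      proof -
        have "openin ?X (W x \<inter> E)" using W[of x] that oE by (intro openin_Int) auto
        then show ?thesis by (rule openin_subset_trans) (use ES in auto)
      qed
      have c3: "(W x \<inter> E) \<inter> (W x' \<inter> E) = {}" if "x \<in> ?F" "x' \<in> ?F" "x \<noteq> x'" for x x'
        using disj[OF that] by blast
      have c4: "\<exists>x\<in>?F. u \<in> W x \<inter> E" if u: "u \<in> E" "p u \<in> M" for u
      proof -
        obtain x where "x \<in> ?F" "u \<in> W x" using cover[of u] pN(1)[OF u] u(1) ES(1) by blast
        then show ?thesis using u(1) by blast
      qed
      have c5: "continuous_on (W x \<inter> E) (\<phi> x)" "inj_on (\<phi> x) (W x \<inter> E)" if "x \<in> ?F" for x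
        using \<phi>[of x] that by (auto intro: continuous_on_subset inj_on_subset)
      have c6: "continuous_on M (\<lambda>z. \<psi> x (\<sigma> z))" if x: "x \<in> ?F" for x
      proof (rule continuous_on_compose2[of N "\<psi> x"])
        show "continuous_on N (\<psi> x)" using \<psi>[of x] x by simp
        show "continuous_on M \<sigma>" using c\<sigma> by (rule continuous_on_subset) simp
        show "\<sigma> ` M \<subseteq> N" by (auto simp: M_def)
      qed
      have c7: "\<psi> x (\<sigma> z) \<noteq> 0" if "x \<in> ?F" "z \<in> M" for x z
        using \<psi>[of x] that(1) My[OF that(2)] by simp
      have c8: "\<psi> x (\<sigma> (p u)) = \<phi> x u ^ ld x" if "x \<in> ?F" "u \<in> W x \<inter> E" "p u \<in> M" for x u
        using eq[of x u] pN[of u] that by simp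
      have c9: "ld x \<in> {1, 3}" if "x \<in> ?F" for x using ld13[of x] that y unfolding ld_def by simp
      have c10: "\<exists>u\<in>W x1 \<inter> E. p u = z" if z: "z \<in> M" for z
      proof -
        have "x1 \<in> ?S" "f x1 = y" "\<sigma> z \<in> N" using x1 My[OF z] by auto
        then obtain u where u: "u \<in> W x1" "f u = \<sigma> z" using sur by blast
        have "u \<in> ?S" using u(1) openin_imp_subset[OF W[of x1]] x1 by auto
        moreover have "\<sigma> z \<in> ?S - B" using z \<sigma>B[of z] by (simp add: M_def)
        ultimately have uE: "u \<in> E" using u(2) by (simp add: E_def)
        then show ?thesis using u p_eq[OF uE, of z] by blast
      qed
      show ?thesis
        using cross_order[where F = ?F and W = "\<lambda>x. W x \<inter> E" and \<phi> = \<phi> and \<psi> = "\<lambda>x z. \<psi> x (\<sigma> z)" and k = ld and N = M,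
          OF IJ cr c1 c2 c3 c4 c5 c6 c7 c8 c9 x1 c10] by blast
    qed
    show ?thesis using N conc by blast
  qed
  have B1: "y1 \<in> B" "y2 \<in> B" "y3 \<in> B" using B by auto
  \<comment> \<open>With r < 1 the circle around 0 or 1 meets the real axis once in each of the two
    gates adjacent to its centre.\<close>
  have near: "\<exists>r>0. r < 1 \<and> (\<forall>z\<in>sphere w r. z \<notin> {0, 1} \<and> \<sigma> z \<in> N)" if N: "openin ?X N" "\<sigma> w \<in> N" and w: "w \<in> {0, 1}" for w N
  proof -
    have "openin (top_of_set UNIV) (UNIV \<inter> \<sigma> -` N)"
      by (rule continuous_openin_preimage[OF c\<sigma> _ N(1)]) (use \<tau>\<sigma>(2) in auto)
    then have "open (\<sigma> -` N)" by simp
    moreover have "w \<in> \<sigma> -` N" using N(2) by simp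
    ultimately obtain e where e: "e > 0" "ball w e \<subseteq> \<sigma> -` N" by (rule openE)
    define r where "r = min (e / 2) (1 / 2)"
    have r: "r > 0" "r < 1" "r < e" using e(1) by (auto simp: r_def)
    have all: "\<forall>z\<in>sphere w r. z \<notin> {0, 1} \<and> \<sigma> z \<in> N"
    proof (intro ballI conjI)
      fix z assume z: "z \<in> sphere w r"
      show "\<sigma> z \<in> N" using z r(3) e(2) by auto
      have "dist w z = r" using z by simp
      then show "z \<notin> {0, 1}" using w r by auto
    qed
    show ?thesis by (intro exI[of _ r] conjI r(1) r(2) all)
  qed
  \<comment> \<open>Outside a neighbourhood N of y3 the sphere is compact and has bounded image in
    the plane, so a large circle lies in N. With r > 1 it meets the axis in the two unbounded
    gates.\<close>
  have far: "\<exists>r>1. \<forall>z\<in>sphere 0 r. z \<notin> {0, 1} \<and> \<sigma> z \<in> N" if N: "openin ?X N" "y3 \<in> N" for N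
  proof -
    have "closedin ?X (?S - N)" using N(1) by (intro closedin_diff) auto
    then have "compact (?S - N)" using closedin_compact[OF compact_sphere] by blast
    moreover have "continuous_on (?S - N) \<tau>" using c\<tau> by (rule continuous_on_subset) (use N in auto)
    ultimately have "bounded (\<tau> ` (?S - N))" by (intro compact_imp_bounded compact_continuous_image)
    then obtain R where R: "\<And>z. z \<in> \<tau> ` (?S - N) \<Longrightarrow> norm z \<le> R" unfolding bounded_iff by blast
    define r where "r = max R 1 + 1"
    have r: "r > 1" "r > R" by (auto simp: r_def)
    have all: "\<forall>z\<in>sphere 0 r. z \<notin> {0, 1} \<and> \<sigma> z \<in> N"
    proof (intro ballI conjI)
      fix z :: complex assume z: "z \<in> sphere 0 r"
      have nz: "norm z = r" using z by simp
      then show "z \<notin> {0, 1}" using r by auto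
      show "\<sigma> z \<in> N"
      proof (rule ccontr)
        assume "\<sigma> z \<notin> N"
        then have "\<sigma> z \<in> ?S - N" using \<tau>\<sigma>(2)[of z] by blast
        then have "\<tau> (\<sigma> z) \<in> \<tau> ` (?S - N)" by (rule imageI)
        then show False using R[of z] \<tau>\<sigma>(1)[of z] nz r(2) by simp
      qed
    qed
    show ?thesis by (intro exI[of _ r] conjI r(1) all)
  qed
  let ?n = "{..<0::real}" let ?m = "{0<..<1::real}" let ?p = "{1::real<..}"
  have v1: "(\<forall>a\<in>sheets. cross ?n ?m (cross ?n ?m (cross ?n ?m a)) = a) \<and> (\<exists>a\<in>sheets. cross ?n ?m a = a)"
  proof -
    obtain N where N: "openin ?X N" "y1 \<in> N" and conc: "\<And>I J c r. real_edge I \<Longrightarrow> real_edge J \<Longrightarrow> c + r \<in> J \<Longrightarrow> c - r \<in> I \<Longrightarrow> r > 0 \<Longrightarrow>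
      (\<forall>z\<in>sphere (complex_of_real c) r. z \<notin> {0, 1} \<and> \<sigma> z \<in> N) \<Longrightarrow>
      (\<forall>a\<in>sheets. cross I J (cross I J (cross I J a)) = a) \<and> (\<exists>a\<in>sheets. cross I J a = a)" using vertex[OF B1(1)] by blast
    obtain r where r: "r > 0" "r < 1" "\<forall>z\<in>sphere 0 r. z \<notin> {0, 1} \<and> \<sigma> z \<in> N"
      using near[OF N(1), of 0] N(2) \<sigma>01 by auto
    show ?thesis by (rule conc[OF real_edges(1,2), of 0 r]) (use r in auto)
  qed
  have v2: "(\<forall>a\<in>sheets. cross ?m ?p (cross ?m ?p (cross ?m ?p a)) = a)"
  proof -
    obtain N where N: "openin ?X N" "y2 \<in> N" and conc: "\<And>I J c r. real_edge I \<Longrightarrow> real_edge J \<Longrightarrow> c + r \<in> J \<Longrightarrow> c - r \<in> I \<Longrightarrow> r > 0 \<Longrightarrow>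
      (\<forall>z\<in>sphere (complex_of_real c) r. z \<notin> {0, 1} \<and> \<sigma> z \<in> N) \<Longrightarrow>
      (\<forall>a\<in>sheets. cross I J (cross I J (cross I J a)) = a) \<and> (\<exists>a\<in>sheets. cross I J a = a)" using vertex[OF B1(2)] by blast
    obtain r where r: "r > 0" "r < 1" "\<forall>z\<in>sphere 1 r. z \<notin> {0, 1} \<and> \<sigma> z \<in> N"
      using near[OF N(1), of 1] N(2) \<sigma>01 by auto
    show ?thesis by (rule conjunct1, rule conc[OF real_edges(2,3), of 1 r]) (use r in auto)
  qed
  have v3: "(\<forall>a\<in>sheets. cross ?n ?p (cross ?n ?p (cross ?n ?p a)) = a)"
  proof -
    obtain N where N: "openin ?X N" "y3 \<in> N" and conc: "\<And>I J c r. real_edge I \<Longrightarrow> real_edge J \<Longrightarrow> c + r \<in> J \<Longrightarrow> c - r \<in> I \<Longrightarrow> r > 0 \<Longrightarrow>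
      (\<forall>z\<in>sphere (complex_of_real c) r. z \<notin> {0, 1} \<and> \<sigma> z \<in> N) \<Longrightarrow>
      (\<forall>a\<in>sheets. cross I J (cross I J (cross I J a)) = a) \<and> (\<exists>a\<in>sheets. cross I J a = a)" using vertex[OF B1(3)] by blast
    obtain r where r: "r > 1" "\<forall>z\<in>sphere 0 r. z \<notin> {0, 1} \<and> \<sigma> z \<in> N" using far[OF N] by auto
    show ?thesis by (rule conjunct1, rule conc[OF real_edges(1,3), of 0 r]) (use r in auto)
  qed
  obtain p0 where p0: "p0 \<in> sheets" "cross ?n ?m p0 = p0" using v1 by blast
  have o: "cross I J (cross I J (cross I J a)) = a" if "(I, J) \<in> {(?n, ?m), (?m, ?p), (?n, ?p)}" "a \<in> sheets" for I J a
    using that v1 v2 v3 by (elim insertE emptyE) simp_all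
  obtain \<alpha> where "\<alpha> \<in> eisenstein" "(cmod \<alpha>)\<^sup>2 = real d"
    by (rule card_eq_norm[OF conn \<open>d > 0\<close> o p0])
  then show thesis using eisenstein_norm_form that by blast
qed

section \<open>The plane modulo the rotations of the triangular lattice\<close>

lemma cis_2pi_eq_iff: "cis (2 * pi * x) = cis (2 * pi * y) \<longleftrightarrow> x - y \<in> \<int>"
proof -
  have "cis (2 * pi * x) = cis (2 * pi * y) \<longleftrightarrow> sin (2 * pi * x) = sin (2 * pi * y) \<and> cos (2 * pi * x) = cos (2 * pi * y)"
    by (auto simp: complex_eq_iff)
  also have "\<dots> \<longleftrightarrow> (\<exists>n::int. 2 * pi * x = 2 * pi * y + 2 * pi * of_int n)"
    by (rule sin_cos_eq_iff)
  also have "\<dots> \<longleftrightarrow> (\<exists>n::int. x - y = of_int n)"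
  proof -
    have "2 * pi * x = 2 * pi * y + 2 * pi * of_int n \<longleftrightarrow> x - y = of_int n" for n :: int
    proof -
      have "2 * pi * x = 2 * pi * y + 2 * pi * of_int n \<longleftrightarrow> 2 * pi * (x - y) = 2 * pi * of_int n"
        by (simp add: algebra_simps)
      then show ?thesis by simp
    qed
    then show ?thesis by simp
  qed
  also have "\<dots> \<longleftrightarrow> x - y \<in> \<int>" by (auto simp: Ints_def)
  finally show ?thesis .
qed

text \<open>These three characters of the plane are trivial on the lattice, multiply to 1 and are
  permuted cyclically by multiplication by \<open>omega\<close>. They are the diagonal entries of an
  element of the maximal torus of SU(3).\<close>

definition ch1 :: "complex \<Rightarrow> complex" where "ch1 z = cis (2 * pi * coord1 z)"
definition ch2 :: "complex \<Rightarrow> complex" where "ch2 z = cis (2 * pi * - coord2 z)"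
definition ch3 :: "complex \<Rightarrow> complex" where "ch3 z = cis (2 * pi * (coord2 z - coord1 z))"

definition vandermonde :: "complex \<Rightarrow> complex \<Rightarrow> complex \<Rightarrow> complex" where
  "vandermonde a b c = (a - b) * (b - c) * (c - a)"

text \<open>The sum of the three characters is the fundamental character of \<open>SU(3)\<close>: it separates the
  orbits of the affine Weyl group. Their Vandermonde product changes sign under reflections, so the
  pair separates the orbits of the rotation subgroup.\<close>

definition orbit_inv :: "complex \<Rightarrow> complex \<times> real" where
  "orbit_inv z = (ch1 z + ch2 z + ch3 z, Im (vandermonde (ch1 z) (ch2 z) (ch3 z)))"

text \<open>Radial projection of the image of \<open>orbit_inv\<close> to the unit sphere. That no
  information is lost rests on every ray meeting the image in one point only.\<close>

definition orbit_map :: "complex \<Rightarrow> complex \<times> real" where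
  "orbit_map z = orbit_inv z /\<^sub>R norm (orbit_inv z)"

lemma ch_norm: "cmod (ch1 z) = 1" "cmod (ch2 z) = 1" "cmod (ch3 z) = 1"
  by (simp_all add: ch1_def ch2_def ch3_def)

lemma ch_prod: "ch1 z * ch2 z * ch3 z = 1"
proof -
  have "2 * pi * coord1 z + 2 * pi * - coord2 z + 2 * pi * (coord2 z - coord1 z) = 0"
    by (simp add: algebra_simps)
  then show ?thesis unfolding ch1_def ch2_def ch3_def cis_mult by (metis cis_zero)
qed

lemma coord_omega_mult: "coord1 (omega * z) = - coord2 z" "coord2 (omega * z) = coord1 z - coord2 z"
  by (simp_all add: coord_mult)

lemma ch_omega: "ch1 (omega * z) = ch2 z" "ch2 (omega * z) = ch3 z" "ch3 (omega * z) = ch1 z"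
  by (simp_all add: ch1_def ch2_def ch3_def coord_omega_mult)

lemma ch_add:
  assumes "l \<in> eisenstein"
  shows "ch1 (z + l) = ch1 z" "ch2 (z + l) = ch2 z" "ch3 (z + l) = ch3 z"
proof -
  have l: "coord1 l \<in> \<int>" "coord2 l \<in> \<int>" using assms by (auto simp: eisenstein_def)
  show "ch1 (z + l) = ch1 z" "ch2 (z + l) = ch2 z" "ch3 (z + l) = ch3 z"
    unfolding ch1_def ch2_def ch3_def cis_2pi_eq_iff using l by simp_all
qed

lemma ch_eqD:
  assumes "ch1 z = ch1 w" "ch2 z = ch2 w"
  shows "z - w \<in> eisenstein"
proof -
  have 1: "coord1 z - coord1 w \<in> \<int>" and 2: "- coord2 z - - coord2 w \<in> \<int>"
    using assms unfolding ch1_def ch2_def cis_2pi_eq_iff by blast+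
  have "coord2 z - coord2 w \<in> \<int>" using Ints_minus[OF 2] by simp
  with 1 show ?thesis by (simp add: eisenstein_def)
qed

lemma orbit_inv_omega: "orbit_inv (omega * z) = orbit_inv z"
proof -
  have "vandermonde b c a = vandermonde a b c" for a b c
    by (simp add: vandermonde_def algebra_simps)
  then show ?thesis by (simp add: orbit_inv_def ch_omega add_ac)
qed

lemma orbit_inv_add: "l \<in> eisenstein \<Longrightarrow> orbit_inv (z + l) = orbit_inv z"
  by (simp add: orbit_inv_def ch_add)

definition orbit_rel :: "complex \<Rightarrow> complex \<Rightarrow> bool" where
  "orbit_rel z w \<longleftrightarrow> (\<exists>j::nat. \<exists>l\<in>eisenstein. w = omega ^ j * z + l)"

lemma orbit_inv_power: "orbit_inv (omega ^ j * z) = orbit_inv z"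
  by (induction j) (simp_all add: orbit_inv_omega mult.assoc)

section \<open>Triples of unit complex numbers with product 1\<close>

lemma cnj_mult_self_eq_1_iff: "cnj a * a = 1 \<longleftrightarrow> cmod a = 1"
proof -
  have "cnj a * a = of_real ((cmod a)\<^sup>2)"
    using complex_norm_square[of a] by (simp add: mult.commute)
  then have "cnj a * a = 1 \<longleftrightarrow> (cmod a)\<^sup>2 = 1\<^sup>2" by (simp only: of_real_eq_1_iff one_power2)
  also have "\<dots> \<longleftrightarrow> cmod a = 1" by (rule power2_eq_iff_nonneg) auto
  finally show ?thesis .
qed

lemma cnj_unit:
  assumes "cmod a = 1" "a * b * c = 1"
  shows "cnj a = b * c"
proof -
  have "cnj a = cnj a * (a * b * c)" using assms(2) by simp
  also have "\<dots> = (cnj a * a) * (b * c)" by (simp add: mult_ac)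
  also have "cnj a * a = 1" using assms(1) cnj_mult_self_eq_1_iff[of a] by blast
  finally show ?thesis by simp
qed

lemma cnj_units:
  assumes "cmod a = 1" "cmod b = 1" "cmod c = 1" "a * b * c = 1"
  shows "cnj a = b * c" "cnj b = c * a" "cnj c = a * b"
proof -
  show "cnj a = b * c" by (rule cnj_unit[OF assms(1,4)])
  show "cnj b = c * a" by (rule cnj_unit[OF assms(2)]) (use assms(4) in \<open>simp add: mult_ac\<close>)
  show "cnj c = a * b" by (rule cnj_unit[OF assms(3)]) (use assms(4) in \<open>simp add: mult_ac\<close>)
qed

text \<open>The conjugate of each entry is the product of the other two. So a, b, c are the roots of
  X^3 - E X^2 + cnj E X - 1, a cubic determined by their sum E alone.\<close>

lemma cnj_sum_units:
  assumes "cmod a = 1" "cmod b = 1" "cmod c = 1" "a * b * c = 1"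
  shows "cnj (a + b + c) = a * b + b * c + c * a"
  by (simp add: cnj_units[OF assms] add_ac)

text \<open>The discriminant of the cubic with roots a, b, c, written in the elementary symmetric
  functions with third one equal to 1.\<close>

lemma vandermonde_sq:
  fixes a b c :: complex
  assumes "a * b * c = 1" "e1 = a + b + c" "e2 = a * b + b * c + c * a"
  shows "(vandermonde a b c)\<^sup>2 = e1\<^sup>2 * e2\<^sup>2 - 4 * e2 ^ 3 - 4 * e1 ^ 3 + 18 * e1 * e2 - 27"
proof -
  have "(vandermonde a b c)\<^sup>2 = e1\<^sup>2 * e2\<^sup>2 - 4 * e2 ^ 3 - 4 * e1 ^ 3 * (a * b * c) + 18 * e1 * e2 * (a * b * c) - 27 * (a * b * c)\<^sup>2"
    unfolding vandermonde_def assms(2,3)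
      by (simp add: power2_eq_square power3_eq_cube algebra_simps)
  then show ?thesis using assms(1) by simp
qed

text \<open>Equal symmetric functions leave only permutations of the roots. An odd one reverses the
  sign of the Vandermonde product, which is possible only if two roots coincide, and then it has the
  same effect as a cyclic one.\<close>

lemma vandermonde_cyclic:
  fixes a b c a' b' c' :: complex
  assumes "a + b + c = a' + b' + c'" "a * b + b * c + c * a = a' * b' + b' * c' + c' * a'" "a * b * c = a' * b' * c'"
    and V: "vandermonde a b c = vandermonde a' b' c'"
  shows "(a', b', c') \<in> {(a, b, c), (b, c, a), (c, a, b)}"
proof -
  have key: "(a', b', c') \<in> {(a, b, c), (b, c, a), (c, a, b)}"
    if "a' = a" "a + b + c = a' + b' + c'" "a * b + b * c + c * a = a' * b' + b' * c' + c' * a'"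
      "vandermonde a b c = vandermonde a' b' c'" for a b c :: complex
  proof -
    have s: "b + c = b' + c'" using that(1,2) by simp
    have "a * (b + c) + b * c = a * (b' + c') + b' * c'"
      using that(3) unfolding that(1) by (simp add: algebra_simps)
    then have bc: "b * c = b' * c'" unfolding s by simp
    have "(b' - b) * (b' - c) = b' * b' - (b + c) * b' + b * c" by (simp add: algebra_simps)
    also have "\<dots> = 0" unfolding s bc by (simp add: algebra_simps)
    finally have "b' = b \<or> b' = c" by simp
    then consider "b' = b" "c' = c" | "b' = c" "c' = b" using s by auto
    then show ?thesis
    proof cases
      case 1 then show ?thesis using that(1) by simp
    next
      case 2
      then have "vandermonde a b c = - vandermonde a b c"
        using that(4) unfolding that(1) by (simp add: vandermonde_def algebra_simps)
      then have "vandermonde a b c = 0" by simp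
      then have "a = b \<or> b = c \<or> c = a" by (auto simp: vandermonde_def)
      then show ?thesis using 2 that(1) by auto
    qed
  qed
  have "(a' - a) * (a' - b) * (a' - c) = a' ^ 3 - (a + b + c) * a'\<^sup>2 + (a * b + b * c + c * a) * a' - a * b * c"
    by (simp add: power2_eq_square power3_eq_cube algebra_simps)
  also have "\<dots> = 0"
    unfolding assms(1-3) by (simp add: power2_eq_square power3_eq_cube algebra_simps)
  finally consider "a' = a" | "a' = b" | "a' = c" by auto
  then show ?thesis
  proof cases
    case 1 then show ?thesis using key[of a b c] assms by simp
  next
    case 2
    have "(a', b', c') \<in> {(b, c, a), (c, a, b), (a, b, c)}"
      using 2 assms by (intro key) (auto simp: vandermonde_def algebra_simps)
    then show ?thesis by auto
  next
    case 3
    have "(a', b', c') \<in> {(c, a, b), (a, b, c), (b, c, a)}"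
      using 3 assms by (intro key) (auto simp: vandermonde_def algebra_simps)
    then show ?thesis by auto
  qed
qed

text \<open>Conjugation replaces each root by the product of the other two and thereby changes the
  sign of the product. Its imaginary part, the only part kept in \<open>orbit_inv\<close>, hence
  determines it.\<close>

lemma vandermonde_units_imaginary:
  assumes "cmod a = 1" "cmod b = 1" "cmod c = 1" "a * b * c = 1"
  shows "vandermonde a b c = \<i> * of_real (Im (vandermonde a b c))"
proof -
  let ?V = "vandermonde a b c"
  have "cnj ?V = (b * c - c * a) * (c * a - a * b) * (a * b - b * c)"
    by (simp only: vandermonde_def complex_cnj_mult complex_cnj_diff cnj_units[OF assms])
  also have "\<dots> = (a * b * c) * - ?V" by (simp add: vandermonde_def algebra_simps)
  finally have "cnj ?V = (a * b * c) * - ?V" .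
  then have "cnj ?V = - ?V" using assms(4) by simp
  then have "Re ?V = 0" by (simp add: complex_eq_iff)
  then show ?thesis by (simp add: complex_eq_iff)
qed

text \<open>Minus the discriminant of X^3 - E X^2 + cnj E X - 1, of degree four in E and of degree
  six in the roots. It is non-negative exactly on the deltoid formed by the sums of three unit
  numbers with product 1.\<close>

definition sextic :: "complex \<Rightarrow> real" where
  "sextic E = 27 - 18 * (cmod E)\<^sup>2 + 8 * Re (E ^ 3) - (cmod E) ^ 4"

lemma sextic_eq: "of_real (sextic E) = - (E\<^sup>2 * (cnj E)\<^sup>2 - 4 * (cnj E) ^ 3 - 4 * E ^ 3 + 18 * E * cnj E - 27)"
proof -
  have n: "E * cnj E = of_real ((cmod E)\<^sup>2)" using complex_norm_square[of E] by simp
  have "E\<^sup>2 * (cnj E)\<^sup>2 = (E * cnj E)\<^sup>2" by (simp add: power_mult_distrib)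
  also have "\<dots> = of_real ((cmod E) ^ 4)" unfolding n by (simp flip: of_real_power power_mult)
  finally have 1: "E\<^sup>2 * (cnj E)\<^sup>2 = of_real ((cmod E) ^ 4)" .
  have 2: "(cnj E) ^ 3 + E ^ 3 = of_real (2 * Re (E ^ 3))"
    using complex_add_cnj[of "E ^ 3"] by (simp add: add.commute)
  have "- (E\<^sup>2 * (cnj E)\<^sup>2 - 4 * (cnj E) ^ 3 - 4 * E ^ 3 + 18 * E * cnj E - 27)
     = 27 - 18 * (E * cnj E) + 4 * ((cnj E) ^ 3 + E ^ 3) - E\<^sup>2 * (cnj E)\<^sup>2" by (simp add: algebra_simps)
  also have "\<dots> = of_real (sextic E)" unfolding 1 2 n sextic_def by simp
  finally show ?thesis by simp
qed

text \<open>The Vandermonde product is i t with t real, and its square is the discriminant, that is,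
  minus \<open>sextic\<close>.\<close>

lemma orbit_inv_surface: "(snd (orbit_inv z))\<^sup>2 = sextic (fst (orbit_inv z))"
proof -
  let ?V = "vandermonde (ch1 z) (ch2 z) (ch3 z)" let ?E = "ch1 z + ch2 z + ch3 z"
  have "?V\<^sup>2 = - of_real (sextic ?E)"
    unfolding sextic_eq
      using vandermonde_sq[OF ch_prod refl cnj_sum_units[OF ch_norm ch_prod]] by simp
  moreover have "?V\<^sup>2 = - of_real ((Im ?V)\<^sup>2)"
    by (subst vandermonde_units_imaginary[OF ch_norm ch_prod]) (simp add: power_mult_distrib)
  ultimately have "complex_of_real ((Im ?V)\<^sup>2) = of_real (sextic ?E)" by simp
  then show ?thesis unfolding of_real_eq_iff by (simp add: orbit_inv_def)
qed

lemma Re_cube_le: "\<bar>Re (E ^ 3)\<bar> \<le> (cmod E) ^ 3"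
  using abs_Re_le_cmod[of "E ^ 3"] by (simp add: norm_power)

lemma Re_scaled_cube: "Re ((of_real s * E) ^ 3) = s ^ 3 * Re (E ^ 3)"
proof -
  have "(of_real s * E) ^ 3 = of_real (s ^ 3) * E ^ 3" by (simp add: power_mult_distrib)
  then show ?thesis
    by (simp only: Re_complex_of_real times_complex.simps Im_complex_of_real mult_zero_left diff_zero)
qed

text \<open>Subtracting the second equation from s^2 times the first removes t and leaves
  \<open>(s - 1) * Q = 0\<close>. A lower bound shows that Q is positive for every positive s other
  than 1.\<close>

lemma surface_star_shaped:
  assumes 1: "t\<^sup>2 = sextic E" and 2: "(s * t)\<^sup>2 = sextic (of_real s * E)" and s: "s > 0"
  shows "s = 1"
proof (rule ccontr)
  assume "s \<noteq> 1"
  define r K where "r = cmod E" and "K = Re (E ^ 3)"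
  have r: "r \<ge> 0" "K \<le> r ^ 3" using Re_cube_le[of E] by (auto simp: r_def K_def)
  have e1: "t\<^sup>2 = 27 - 18 * r\<^sup>2 + 8 * K - r ^ 4" using 1 by (simp add: sextic_def r_def K_def)
  have "Re ((of_real s * E) ^ 3) = s ^ 3 * K"
    unfolding K_def by (rule Re_scaled_cube)
  then have e2: "(s * t)\<^sup>2 = 27 - 18 * (s * r)\<^sup>2 + 8 * (s ^ 3 * K) - (s * r) ^ 4"
    using 2 s by (simp add: sextic_def r_def norm_mult)
  define Q where "Q = 27 * (s + 1) - 8 * K * s\<^sup>2 + r ^ 4 * s\<^sup>2 * (s + 1)"
  have "s\<^sup>2 * t\<^sup>2 = 27 - 18 * (s * r)\<^sup>2 + 8 * (s ^ 3 * K) - (s * r) ^ 4"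
    using e2 by (simp add: power_mult_distrib)
  moreover have "(s - 1) * Q = s\<^sup>2 * (27 - 18 * r\<^sup>2 + 8 * K - r ^ 4) - (27 - 18 * (s * r)\<^sup>2 + 8 * (s ^ 3 * K) - (s * r) ^ 4)"
    unfolding Q_def by (simp add: power2_eq_square power3_eq_cube power4_eq_xxxx algebra_simps)
  ultimately have "(s - 1) * Q = 0" unfolding e1 by simp
  then have "Q = 0" using \<open>s \<noteq> 1\<close> by simp
  \<comment> \<open>At the cusp E = 3 of the deltoid Q vanishes for s = 1, so the estimate has to be
    sharp there; this is x = 6, where 8 x^3 - x^4 has its maximum 432. The factor
    \<open>(s + 1) ^ 3\<close> makes the expression a polynomial in s and x.\<close>
  define x where "x = r * (s + 1)"
  have "Q * (s + 1) ^ 3 \<ge> (27 * (s + 1) - 8 * r ^ 3 * s\<^sup>2 + r ^ 4 * s\<^sup>2 * (s + 1)) * (s + 1) ^ 3"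
    unfolding Q_def using r s by (intro mult_right_mono) (auto intro!: mult_right_mono)
  also have "(27 * (s + 1) - 8 * r ^ 3 * s\<^sup>2 + r ^ 4 * s\<^sup>2 * (s + 1)) * (s + 1) ^ 3
     = 27 * (s - 1)\<^sup>2 * (s\<^sup>2 + 6 * s + 1) + s\<^sup>2 * ((x - 6)\<^sup>2 * (x\<^sup>2 + 4 * x + 12))"
    unfolding x_def by (simp add: power2_eq_square power3_eq_cube power4_eq_xxxx algebra_simps)
  finally have "27 * (s - 1)\<^sup>2 * (s\<^sup>2 + 6 * s + 1) + s\<^sup>2 * ((x - 6)\<^sup>2 * (x\<^sup>2 + 4 * x + 12)) \<le> 0"
    using \<open>Q = 0\<close> by simp
  moreover have "27 * (s - 1)\<^sup>2 * (s\<^sup>2 + 6 * s + 1) > 0"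
    using s \<open>s \<noteq> 1\<close> by (intro mult_pos_pos add_pos_pos) auto
  moreover have "s\<^sup>2 * ((x - 6)\<^sup>2 * (x\<^sup>2 + 4 * x + 12)) \<ge> 0"
    using r s by (intro mult_nonneg_nonneg add_nonneg_nonneg) (auto simp: x_def)
  ultimately show False by linarith
qed

lemma orbit_inv_nonzero: "orbit_inv z \<noteq> 0"
proof
  assume "orbit_inv z = 0"
  then show False using orbit_inv_surface[of z] by (simp add: sextic_def)
qed

lemma orbit_map_sphere: "orbit_map z \<in> sphere 0 1"
  using orbit_inv_nonzero[of z] by (simp add: orbit_map_def)

lemma orbit_map_eqD:
  assumes "orbit_map z = orbit_map w"
  shows "orbit_inv z = orbit_inv w"
proof -
  define s where "s = norm (orbit_inv w) / norm (orbit_inv z)"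
  have s: "s > 0" using orbit_inv_nonzero by (simp add: s_def)
  have "norm (orbit_inv w) *\<^sub>R orbit_map z = orbit_inv w"
    unfolding assms using orbit_inv_nonzero[of w] by (simp add: orbit_map_def)
  then have eq: "orbit_inv w = s *\<^sub>R orbit_inv z" by (simp add: orbit_map_def s_def divide_inverse)
  have "s = 1"
  proof (rule surface_star_shaped[OF _ _ s])
    show "(snd (orbit_inv z))\<^sup>2 = sextic (fst (orbit_inv z))" by (rule orbit_inv_surface)
    show "(s * snd (orbit_inv z))\<^sup>2 = sextic (of_real s * fst (orbit_inv z))"
      using orbit_inv_surface[of w] unfolding eq by (simp add: scaleR_conv_of_real)
  qed
  then show ?thesis using eq by simp
qed

text \<open>Equal sums and Vandermonde products give the same three characters up to a cyclic shift.
  A shift is realized by a power of \<open>omega\<close>, and points with the same characters differ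
  by a lattice element.\<close>

lemma orbit_map_eq_iff: "orbit_map z = orbit_map w \<longleftrightarrow> orbit_rel z w"
proof
  assume "orbit_rel z w"
  then obtain j l where "l \<in> eisenstein" "w = omega ^ j * z + l" by (auto simp: orbit_rel_def)
  then have "orbit_inv w = orbit_inv z" by (simp add: orbit_inv_add orbit_inv_power)
  then show "orbit_map z = orbit_map w" by (simp add: orbit_map_def)
next
  assume "orbit_map z = orbit_map w"
  then have eq: "orbit_inv z = orbit_inv w" by (rule orbit_map_eqD)
  have E: "ch1 z + ch2 z + ch3 z = ch1 w + ch2 w + ch3 w" using eq by (simp add: orbit_inv_def)
  have "vandermonde (ch1 z) (ch2 z) (ch3 z) = vandermonde (ch1 w) (ch2 w) (ch3 w)"
    using eq vandermonde_units_imaginary[OF ch_norm ch_prod, of z] vandermonde_units_imaginary[OF ch_norm ch_prod, of w]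
    by (simp add: orbit_inv_def)
  moreover have "ch1 z * ch2 z + ch2 z * ch3 z + ch3 z * ch1 z = ch1 w * ch2 w + ch2 w * ch3 w + ch3 w * ch1 w"
    using cnj_sum_units[OF ch_norm ch_prod, of z] cnj_sum_units[OF ch_norm ch_prod, of w] E by simp
  ultimately have "(ch1 w, ch2 w, ch3 w) \<in> {(ch1 z, ch2 z, ch3 z), (ch2 z, ch3 z, ch1 z), (ch3 z, ch1 z, ch2 z)}"
    using E by (intro vandermonde_cyclic) (simp_all add: ch_prod)
  moreover have "ch1 (omega ^ 1 * z) = ch2 z" "ch2 (omega ^ 1 * z) = ch3 z"
    "ch1 (omega ^ 2 * z) = ch3 z" "ch2 (omega ^ 2 * z) = ch1 z"
    by (simp_all add: ch_omega power2_eq_square mult.assoc)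
  moreover have "ch1 (omega ^ 0 * z) = ch1 z" "ch2 (omega ^ 0 * z) = ch2 z" by simp_all
  ultimately obtain j where "ch1 w = ch1 (omega ^ j * z)" "ch2 w = ch2 (omega ^ j * z)"
    by (elim insertE emptyE) (metis prod.inject)+
  then have "w - omega ^ j * z \<in> eisenstein" by (rule ch_eqD)
  then show "orbit_rel z w"
    unfolding orbit_rel_def by (intro exI[of _ j] bexI[of _ "w - omega ^ j * z"]) simp_all
qed

text \<open>The cubic is self-inversive: with a root a also 1 / cnj a is a root. If a is off the
  circle this is b or c, and then the Vandermonde product is real. Its square being - t^2, it
  vanishes, so two roots coincide, which is impossible in each case.\<close>

lemma root_on_circle:
  fixes a b c E :: complex
  assumes s: "a + b + c = E" "a * b + b * c + c * a = cnj E" "a * b * c = 1"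
    and V: "(vandermonde a b c)\<^sup>2 = - of_real (t\<^sup>2)"
  shows "cmod a = 1"
proof (rule ccontr)
  assume na: "cmod a \<noteq> 1"
  have nz: "a \<noteq> 0" "b \<noteq> 0" "c \<noteq> 0" using s(3) by auto
  have "a ^ 3 - (a + b + c) * a\<^sup>2 + (a * b + b * c + c * a) * a - a * b * c = 0"
    by (simp add: power2_eq_square power3_eq_cube algebra_simps)
  then have "a ^ 3 - E * a\<^sup>2 + cnj E * a - 1 = 0" unfolding s .
  then have "cnj (a ^ 3 - E * a\<^sup>2 + cnj E * a - 1) = 0" by simp
  then have *: "cnj a ^ 3 - cnj E * (cnj a)\<^sup>2 + E * cnj a - 1 = 0" by simp
  \<comment> \<open>The cubic with reversed coefficients, factored over the roots and evaluated at
    \<open>cnj a\<close>; it vanishes by conjugating the equation for a.\<close>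
  have "(cnj a * a - 1) * (cnj a * b - 1) * (cnj a * c - 1)
      = cnj a ^ 3 * (a * b * c) - (a * b + b * c + c * a) * (cnj a)\<^sup>2 + (a + b + c) * cnj a - 1"
    by (simp add: power2_eq_square power3_eq_cube algebra_simps)
  also have "\<dots> = 0" unfolding s using * by simp
  finally have "(cnj a * a - 1) * (cnj a * b - 1) * (cnj a * c - 1) = 0" .
  moreover have na': "cnj a * a \<noteq> 1" using na by (simp add: cnj_mult_self_eq_1_iff)
  ultimately have "cnj a * b = 1 \<or> cnj a * c = 1" by auto
  moreover have pair: False if ab: "cnj a * b = 1" and abc: "a * b * c = 1" and V: "(vandermonde a b c)\<^sup>2 = - of_real (t\<^sup>2)" for b c
  proof -
    have ba: "cnj b * a = 1" using arg_cong[OF ab, of cnj] by (simp add: mult.commute)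
    have "cnj a * cnj b * cnj c = 1" using arg_cong[OF abc, of cnj] by simp
    then have "(cnj a * cnj b * cnj c) * (a * b * c) = 1" using abc by simp
    moreover have "(cnj a * cnj b * cnj c) * (a * b * c) = (cnj a * b) * (cnj b * a) * (cnj c * c)"
      by (simp add: mult_ac)
    ultimately have cc: "cnj c * c = 1" using ab ba by simp
    let ?V = "vandermonde a b c"
    \<comment> \<open>Here the conjugates of a, b, c are 1/b, 1/a, 1/c. Conjugation inverts the
      roots and exchanges two of them, and the two sign changes cancel.\<close>
    have d1: "(cnj a - cnj b) * (a * b) = a - b"
    proof -
      have "(cnj a - cnj b) * (a * b) = a * (cnj a * b) - b * (cnj b * a)"
        by (simp add: algebra_simps)
      then show ?thesis using ab ba by simp
    qed
    have d2: "(cnj b - cnj c) * (c * a) = c - a"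
    proof -
      have "(cnj b - cnj c) * (c * a) = c * (cnj b * a) - a * (cnj c * c)"
        by (simp add: algebra_simps)
      then show ?thesis using ba cc by simp
    qed
    have d3: "(cnj c - cnj a) * (b * c) = b - c"
    proof -
      have "(cnj c - cnj a) * (b * c) = b * (cnj c * c) - c * (cnj a * b)"
        by (simp add: algebra_simps)
      then show ?thesis using ab cc by simp
    qed
    have "cnj ?V = cnj ?V * (a * b * c)\<^sup>2" using abc by simp
    also have "\<dots> = ((cnj a - cnj b) * (a * b)) * ((cnj b - cnj c) * (c * a)) * ((cnj c - cnj a) * (b * c))"
      by (simp add: vandermonde_def power2_eq_square mult_ac)
    also have "\<dots> = ?V" unfolding d1 d2 d3 vandermonde_def by (simp add: mult_ac)
    finally have "?V \<in> \<real>" by (simp add: Reals_cnj_iff)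
    then obtain x where x: "?V = of_real x" by (auto elim: Reals_cases)
    have "complex_of_real (x\<^sup>2) = of_real (- (t\<^sup>2))" using V unfolding x by simp
    then have "x\<^sup>2 = - (t\<^sup>2)" by (simp only: of_real_eq_iff)
    then have "x\<^sup>2 = 0" using zero_le_power2[of x] zero_le_power2[of t] by linarith
    then have "(a - b) * (b - c) * (c - a) = 0" using x by (simp add: vandermonde_def)
    then have "a = b \<or> b = c \<or> c = a" by auto
    then show False
    proof (elim disjE)
      assume "a = b" then show False using ab na' by simp
    next
      assume "c = a" then show False using cc na' by simp
    next
      assume "b = c"
      then have "cmod b = 1" using cc by (simp add: cnj_mult_self_eq_1_iff)
      then show False using arg_cong[OF ab, of cmod] na by (simp add: norm_mult)
    qed
  qed
  have "cnj a * b \<noteq> 1" using pair[of b c] s(3) V by blast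
  moreover have "cnj a * c \<noteq> 1"
  proof
    assume "cnj a * c = 1"
    moreover have "a * c * b = 1" using s(3) by (simp add: mult_ac)
    moreover have "vandermonde a c b = - vandermonde a b c"
      by (simp add: vandermonde_def algebra_simps)
    then have "(vandermonde a c b)\<^sup>2 = - of_real (t\<^sup>2)" using V by simp
    ultimately show False by (rule pair)
  qed
  ultimately show False by blast
qed

text \<open>One root a of X^3 - E X^2 + cnj E X - 1 exists by the fundamental theorem of algebra,
  the others solve a quadratic equation. The sign of t is adjusted by exchanging b and c.\<close>

lemma exists_unit_roots:
  assumes "t\<^sup>2 = sextic E"
  obtains a b c where "cmod a = 1" "cmod b = 1" "cmod c = 1" "a * b * c = 1" "a + b + c = E" "Im (vandermonde a b c) = t"
proof -
  have nc: "\<not> constant (poly [:-1, cnj E, - E, 1:])" by (simp add: constant_degree)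
  from fundamental_theorem_of_algebra[OF nc] obtain a where "poly [:-1, cnj E, - E, 1:] a = 0"
    by (elim exE)
  then have a: "a ^ 3 - E * a\<^sup>2 + cnj E * a - 1 = 0"
    by (simp add: algebra_simps power2_eq_square power3_eq_cube)
  then have "a \<noteq> 0" by auto
  define D where "D = csqrt ((E - a)\<^sup>2 - 4 / a)"
  have D: "D\<^sup>2 = (E - a)\<^sup>2 - 4 / a" by (simp add: D_def)
  define b c where "b = (E - a + D) / 2" and "c = (E - a - D) / 2"
  have s1: "a + b + c = E" by (simp add: b_def c_def field_simps)
  have "b * c = ((E - a)\<^sup>2 - D\<^sup>2) / 4" by (simp add: b_def c_def power2_eq_square field_simps)
  then have bc: "b * c = 1 / a" unfolding D by simp
  then have s3: "a * b * c = 1" using \<open>a \<noteq> 0\<close> by (simp add: mult.assoc)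
  have "a * (a * b + b * c + c * a) = a\<^sup>2 * (b + c) + a * b * c"
    by (simp add: power2_eq_square algebra_simps)
  also have "\<dots> = a\<^sup>2 * (E - a) + 1" using s1 s3 by (simp add: algebra_simps flip: s1)
  also have "\<dots> = a * cnj E" using a by (simp add: power2_eq_square power3_eq_cube algebra_simps)
  finally have "a * (a * b + b * c + c * a) = a * cnj E" .
  then have s2: "a * b + b * c + c * a = cnj E" using \<open>a \<noteq> 0\<close> by simp
  have V: "(vandermonde a b c)\<^sup>2 = - of_real (t\<^sup>2)"
    unfolding assms sextic_eq using vandermonde_sq[OF s3 s1[symmetric] s2[symmetric]] by simp
  have perm: "(vandermonde b c a)\<^sup>2 = (vandermonde a b c)\<^sup>2" "(vandermonde c a b)\<^sup>2 = (vandermonde a b c)\<^sup>2"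
    by (simp_all add: vandermonde_def mult_ac)
  have n: "cmod a = 1" "cmod b = 1" "cmod c = 1"
    using root_on_circle[OF s1 s2 s3 V] root_on_circle[of b c a E t] root_on_circle[of c a b E t] s1 s2 s3 V perm
    by (simp_all add: add_ac mult_ac)
  have "(vandermonde a b c)\<^sup>2 = - of_real ((Im (vandermonde a b c))\<^sup>2)"
    by (subst vandermonde_units_imaginary[OF n s3]) (simp add: power_mult_distrib)
  then have "complex_of_real ((Im (vandermonde a b c))\<^sup>2) = of_real (t\<^sup>2)" using V by simp
  then have "(Im (vandermonde a b c))\<^sup>2 = t\<^sup>2" by (simp only: of_real_eq_iff)
  then consider "Im (vandermonde a b c) = t" | "Im (vandermonde a b c) = - t"
    by (auto simp: power2_eq_iff)
  then show thesis
  proof cases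
    case 1 then show thesis using that[OF n s3 s1] by simp
  next
    case 2
    have "vandermonde a c b = - vandermonde a b c" by (simp add: vandermonde_def algebra_simps)
    then have "Im (vandermonde a c b) = t" using 2 by simp
    then show thesis using that[of a c b] n s1 s3 by (simp add: add_ac mult_ac)
  qed
qed

text \<open>Along the ray through x the function g, whose zeros are the points of the surface, is
  -27 at the origin and non-negative far out, so it has a zero. The roots found there are the
  characters of some z.\<close>

lemma orbit_map_surj:
  assumes "x \<in> sphere (0::complex \<times> real) 1"
  obtains z where "orbit_map z = x"
proof -
  obtain E0 t0 where x: "x = (E0, t0)" by (cases x)
  define r where "r = cmod E0"
  have "norm x = 1" using assms by simp
  then have nx: "r\<^sup>2 + t0\<^sup>2 = 1" unfolding x r_def by (simp add: norm_Pair real_sqrt_eq_1_iff)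
  define g where "g s = (s * t0)\<^sup>2 - sextic (of_real s * E0)" for s :: real
  have g: "g s = (s * t0)\<^sup>2 - 27 + 18 * (s * r)\<^sup>2 - 8 * (s ^ 3 * Re (E0 ^ 3)) + (s * r) ^ 4" if "s \<ge> 0" for s
  proof -
    have "Re ((of_real s * E0) ^ 3) = s ^ 3 * Re (E0 ^ 3)"
      by (rule Re_scaled_cube)
    then show ?thesis using that by (simp add: g_def sextic_def r_def norm_mult)
  qed
  have "\<exists>s>0. g s \<ge> 0"
  proof (cases "r = 0")
    case True
    then have "t0\<^sup>2 = 1" "E0 = 0" using nx by (simp_all add: r_def)
    then have "g 6 \<ge> 0" unfolding g_def by (simp add: sextic_def power_mult_distrib)
    then show ?thesis by (intro exI[of _ 6]) simp
  next
    case False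
    then have r: "r > 0" by (simp add: r_def)
    \<comment> \<open>The deltoid lies in the disc of radius 3; at radius 4 the terms add up to at
      least 517 - 8 * 64 = 5.\<close>
    define s where "s = 4 / r"
    have s: "s > 0" "s * r = 4" using r by (simp_all add: s_def)
    have "s ^ 3 * Re (E0 ^ 3) \<le> s ^ 3 * r ^ 3"
      using Re_cube_le[of E0] s by (intro mult_left_mono) (auto simp: r_def)
    also have "\<dots> = 64" using s(2) by (simp flip: power_mult_distrib)
    finally have Y: "s ^ 3 * Re (E0 ^ 3) \<le> 64" .
    have "g s = 517 + (s * t0)\<^sup>2 - 8 * (s ^ 3 * Re (E0 ^ 3))" using s g[of s] by simp
    then have "g s \<ge> 0" using Y zero_le_power2[of "s * t0"] by linarith
    then show ?thesis using s by blast
  qed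
  then obtain s1 where s1: "s1 > 0" "g s1 \<ge> 0" by blast
  have "g 0 \<le> 0" by (simp add: g_def sextic_def)
  moreover have "continuous_on {0..s1} g" unfolding g_def sextic_def by (intro continuous_intros)
  ultimately obtain s where s: "0 \<le> s" "g s = 0" using IVT'[of g 0 0 s1] s1 by auto
  have "g 0 \<noteq> 0" by (simp add: g_def sextic_def)
  then have "s \<noteq> 0" using s(2) by metis
  then have sp: "s > 0" using s by simp
  have "(s * t0)\<^sup>2 = sextic (of_real s * E0)" using s by (simp add: g_def)
  then obtain a b c where abc: "cmod a = 1" "cmod b = 1" "cmod c = 1" "a * b * c = 1" "a + b + c = of_real s * E0"
     "Im (vandermonde a b c) = s * t0" by (rule exists_unit_roots)
  \<comment> \<open>Chosen so that \<open>ch1 z = a\<close> and \<open>ch2 z = b\<close>; the minus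
    sign is the one in \<open>ch2\<close>. The third character is c because both products are
    1.\<close>
  define z where "z = of_real (Arg a / (2 * pi)) + of_real (- (Arg b / (2 * pi))) * omega"
  have cz: "coord1 z = Arg a / (2 * pi)" "coord2 z = - (Arg b / (2 * pi))"
    by (simp_all add: z_def del: of_real_divide of_real_minus)
  have c1: "ch1 z = a" "ch2 z = b"
  proof -
    have "a \<noteq> 0" "b \<noteq> 0" using abc(1,2) by auto
    then have "cis (Arg a) = a" "cis (Arg b) = b"
      using abc(1,2) cis_Arg[of a] cis_Arg[of b] by (simp_all add: sgn_eq)
    then show "ch1 z = a" "ch2 z = b" unfolding ch1_def ch2_def cz by simp_all
  qed
  have "a * b \<noteq> 0" using abc(4) by auto
  moreover have "a * b * ch3 z = a * b * c" using ch_prod[of z] c1 abc(4) by simp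
  ultimately have c3: "ch3 z = c" by simp
  have "orbit_inv z = s *\<^sub>R x"
    using abc(5,6) c1 c3 by (simp add: orbit_inv_def x scaleR_conv_of_real)
  then have "orbit_map z = x" using sp \<open>norm x = 1\<close> by (simp add: orbit_map_def)
  then show thesis by (rule that)
qed

section \<open>The orbit map as an open map and its local charts\<close>

lemma continuous_on_coord: "continuous_on S coord1" "continuous_on S coord2"
  unfolding coord1_def coord2_def by (auto intro!: continuous_intros)

lemma continuous_on_orbit_map: "continuous_on S orbit_map"
proof -
  have "continuous_on S ch1" "continuous_on S ch2" "continuous_on S ch3"
    unfolding ch1_def ch2_def ch3_def cis_conv_exp
      by (auto intro!: continuous_intros continuous_on_coord)
  then have "continuous_on S orbit_inv"
    unfolding orbit_inv_def vandermonde_def by (intro continuous_intros)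
  then show ?thesis
    unfolding orbit_map_def using orbit_inv_nonzero by (intro continuous_intros) auto
qed

lemma omega_power_eisenstein [simp]: "omega ^ j \<in> eisenstein"
  by (induction j) simp_all

lemma omega_power_mod: "\<exists>i<3. omega ^ j = omega ^ i"
proof -
  have "omega ^ j = omega ^ (3 * (j div 3) + j mod 3)" by simp
  also have "\<dots> = omega ^ (j mod 3)" unfolding power_add power_mult omega_cubed by simp
  finally show ?thesis by (intro exI[of _ "j mod 3"]) simp
qed

lemma norm_omega_power: "cmod (omega ^ j) = 1"
  by (simp add: norm_power norm_omega)

text \<open>A geometric sum. It lets the single condition on \<open>(1 - omega) * z\<close> control
  all rotations about z.\<close>

lemma one_minus_omega_power_dvd: "\<exists>e\<in>eisenstein. 1 - omega ^ j = (1 - omega) * e"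
proof (induction j)
  case (Suc j)
  then obtain e where e: "e \<in> eisenstein" "1 - omega ^ j = (1 - omega) * e" by blast
  have "1 - omega ^ Suc j = (1 - omega) + omega * (1 - omega ^ j)" by (simp add: algebra_simps)
  also have "\<dots> = (1 - omega) * (1 + omega * e)" unfolding e(2) by (simp add: algebra_simps)
  finally show ?case using e(1) by (intro bexI[of _ "1 + omega * e"]) simp_all
qed (intro bexI[of _ 0], simp_all)

lemma eisenstein_norm_ge_1:
  assumes "z \<in> eisenstein" "z \<noteq> 0"
  shows "cmod z \<ge> 1"
proof -
  obtain n :: nat where n: "(cmod z)\<^sup>2 = real n" by (rule norm_eisenstein_nat[OF assms(1)])
  have "n \<noteq> 0"
  proof
    assume "n = 0"
    then have "cmod z = 0" using n by simp
    then show False using assms(2) by simp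
  qed
  then have "1\<^sup>2 \<le> (cmod z)\<^sup>2" unfolding n by simp
  then show ?thesis by (rule power2_le_imp_le) simp
qed

text \<open>Two points of \<open>v + eisenstein\<close> of norm below 1/2 differ by a lattice vector
  shorter than 1, hence by 0. So at most one non-zero point is that small, and its norm can serve as
  e.\<close>

lemma eisenstein_translate_discrete:
  obtains e where "e > 0" "\<And>l. l \<in> eisenstein \<Longrightarrow> cmod (v + l) < e \<Longrightarrow> v + l = 0"
proof (cases "\<exists>l\<in>eisenstein. v + l \<noteq> 0 \<and> cmod (v + l) < 1/2")
  case True
  then obtain k where k: "k \<in> eisenstein" "v + k \<noteq> 0" "cmod (v + k) < 1/2" by blast
  show thesis
  proof (rule that[of "cmod (v + k)"])
    show "cmod (v + k) > 0" using k by simp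
    fix l assume l: "l \<in> eisenstein" "cmod (v + l) < cmod (v + k)"
    have "cmod (l - k) \<le> cmod (v + l) + cmod (v + k)"
      using norm_triangle_ineq4[of "v + l" "v + k"] by simp
    then have "cmod (l - k) < 1" using l(2) k(3) by linarith
    then have "l - k = 0"
      using eisenstein_norm_ge_1[OF eisenstein_ring(5)[OF l(1) k(1)]] by (cases "l - k = 0") linarith+
    then show "v + l = 0" using l(2) by simp
  qed
next
  case False
  then show thesis by (intro that[of "1/2"]) auto
qed

text \<open>The order of the stabilizer of z in the rotation group: \<open>omega * z + l = z\<close>
  has a solution l in the lattice exactly if \<open>(1 - omega) * z\<close> is in the
  lattice.\<close>

definition stab :: "complex \<Rightarrow> nat" where
  "stab z = (if (1 - omega) * z \<in> eisenstein then 3 else 1)"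

lemma orbit_rel_sym: "orbit_rel z w \<Longrightarrow> orbit_rel w z"
  by (metis orbit_map_eq_iff)

lemma orbit_rel_mult:
  assumes "\<alpha> \<in> eisenstein" "orbit_rel z w"
  shows "orbit_rel (\<alpha> * z) (\<alpha> * w)"
proof -
  obtain j l where l: "l \<in> eisenstein" "w = omega ^ j * z + l"
    using assms(2) unfolding orbit_rel_def by blast
  then have "\<alpha> * w = omega ^ j * (\<alpha> * z) + \<alpha> * l" by (simp add: algebra_simps)
  then show ?thesis
    unfolding orbit_rel_def using l(1) assms(1) by (intro exI[of _ j] bexI[of _ "\<alpha> * l"]) simp_all
qed

lemma stab_orbit_rel:
  assumes "orbit_rel z w"
  shows "stab z = stab w"
proof -
  have imp: "(1 - omega) * w \<in> eisenstein" if zw: "orbit_rel z w" "(1 - omega) * z \<in> eisenstein" for z w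
  proof -
    obtain j l where l: "l \<in> eisenstein" "w = omega ^ j * z + l"
      using zw(1) unfolding orbit_rel_def by blast
    have "(1 - omega) * w = omega ^ j * ((1 - omega) * z) + (1 - omega) * l"
      unfolding l(2) by (simp add: algebra_simps)
    also have "\<dots> \<in> eisenstein" by (intro eisenstein_ring(4) eisenstein_ring(6) zw(2) l(1)) simp_all
    finally show ?thesis .
  qed
  show ?thesis unfolding stab_def using imp[OF assms] imp[OF orbit_rel_sym[OF assms]] by auto
qed

text \<open>Cone points go to cone points under multiplication by \<alpha>, so the exponent
  \<open>stab (\<alpha> * z) div stab z\<close> used later is an exact quotient.\<close>

lemma stab_mult: "\<alpha> \<in> eisenstein \<Longrightarrow> stab z dvd stab (\<alpha> * z)"
proof -
  assume a: "\<alpha> \<in> eisenstein"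
  have "(1 - omega) * (\<alpha> * z) \<in> eisenstein" if "(1 - omega) * z \<in> eisenstein"
    using eisenstein_ring(6)[OF a that] by (simp add: mult_ac)
  then show ?thesis by (auto simp: stab_def)
qed

lemma cube_root_omega:
  fixes u v :: complex
  assumes "v ^ 3 = u ^ 3"
  obtains j where "v = omega ^ j * u"
proof -
  have "(v - u) * (v - omega * u) * (v - omega * omega * u) = 0"
  proof -
    have "(v - u) * (v - omega * u) * (v - omega * omega * u)
       = v ^ 3 - v\<^sup>2 * u * (1 + omega + omega * omega) + v * u\<^sup>2 * omega * (1 + omega + omega * omega) - omega ^ 3 * u ^ 3"
      by (simp add: power2_eq_square power3_eq_cube algebra_simps)
    also have "1 + omega + omega * omega = 0" by (simp add: omega_sq)
    finally show ?thesis using assms by (simp add: omega_cubed)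
  qed
  then consider "v = u" | "v = omega * u" | "v = omega * omega * u" by auto
  then show thesis
  proof cases
    case 1 then show thesis using that[of 0] by simp
  next
    case 2 then show thesis using that[of 1] by simp
  next
    case 3 then show thesis using that[of 2] by (simp add: power2_eq_square)
  qed
qed

text \<open>By discreteness only group elements that fix z can relate two points near z. These act
  on the displacement by powers of \<open>omega\<close>, so its power with exponent
  \<open>stab z\<close> is an invariant that separates nearby orbits.\<close>

lemma orbit_map_local:
  obtains e where "e > 0"
    "\<And>u v. cmod u < e \<Longrightarrow> cmod v < e \<Longrightarrow> orbit_map (z + u) = orbit_map (z + v) \<longleftrightarrow> u ^ stab z = v ^ stab z"
proof -
  have "\<exists>e>0. \<forall>l\<in>eisenstein. cmod (((omega ^ j) * z - z) + l) < e \<longrightarrow> ((omega ^ j) * z - z) + l = 0" for j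
    using eisenstein_translate_discrete[of "(omega ^ j) * z - z"] by metis
  then obtain d where d: "\<And>j. d j > 0" "\<And>j l. l \<in> eisenstein \<Longrightarrow> cmod (((omega ^ j) * z - z) + l) < d j \<Longrightarrow> ((omega ^ j) * z - z) + l = 0"
    by metis
  \<comment> \<open>Half the smallest of three radii, because \<open>v - omega ^ j * u\<close> can
    be as long as the two displacements together; by periodicity j < 3 suffices.\<close>
  define e where "e = Min (d ` {..<3}) / 2"
  have e: "e > 0" "\<And>i. i < 3 \<Longrightarrow> 2 * e \<le> d i"
  proof -
    have ne: "finite (d ` {..<3})" "d ` {..<3} \<noteq> {}" by (simp_all add: lessThan_empty_iff)
    show "e > 0" unfolding e_def using Min_gr_iff[OF ne, of 0] d(1) by simp
    show "2 * e \<le> d i" if "i < 3" for i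
      unfolding e_def using Min_le[OF ne(1), of "d i"] that by simp
  qed
  show thesis
  proof (rule that[OF e(1)])
    fix u v assume uv: "cmod u < e" "cmod v < e"
    show "orbit_map (z + u) = orbit_map (z + v) \<longleftrightarrow> u ^ stab z = v ^ stab z"
    proof
      assume "orbit_map (z + u) = orbit_map (z + v)"
      then obtain j0 l where l: "l \<in> eisenstein" "z + v = omega ^ j0 * (z + u) + l"
        unfolding orbit_map_eq_iff orbit_rel_def by blast
      obtain j where j: "j < 3" "omega ^ j0 = omega ^ j" using omega_power_mod by blast
      have eq: "((omega ^ j) * z - z) + l = v - omega ^ j * u"
        using l(2) unfolding j(2) by (simp add: algebra_simps)
      have "cmod (v - omega ^ j * u) \<le> cmod v + cmod u"
        using norm_triangle_ineq4[of v "omega ^ j * u"] by (simp add: norm_mult norm_omega_power)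
      then have "cmod (v - omega ^ j * u) < d j" using uv e(2)[OF j(1)] by linarith
      then have 0: "((omega ^ j) * z - z) + l = 0" using d(2)[OF l(1), of j] unfolding eq by blast
      then have v: "v = omega ^ j * u" using eq by simp
      have lz: "(1 - omega ^ j) * z = l" using 0 by (simp add: algebra_simps)
      show "u ^ stab z = v ^ stab z"
      proof (cases "stab z = 3")
        case True
        have "(omega ^ j) ^ 3 = 1"
          by (simp add: omega_cubed flip: power_mult) (simp add: mult.commute[of j] power_mult omega_cubed)
        then show ?thesis unfolding True v by (simp add: power_mult_distrib)
      next
        case False
        then have s: "stab z = 1" "(1 - omega) * z \<notin> eisenstein"
          by (auto simp: stab_def split: if_splits)
        have "j = 0"
        proof (rule ccontr)
          assume "j \<noteq> 0"
          then consider "j = 1" | "j = 2" using j(1) by linarith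
          then show False
          proof cases
            case 1 then show False using lz l(1) s(2) by simp
          next
            case 2
            have "(1 - omega) * z = - (omega * ((1 - omega ^ 2) * z))"
            proof -
              have "- (omega * (1 - omega ^ 2)) = 1 - omega"
                using omega_cubed by (simp add: algebra_simps power2_eq_square power3_eq_cube)
              then show ?thesis by (metis mult.assoc mult_minus_left)
            qed
            also have "\<dots> = - (omega * l)" using lz 2 by simp
            also have "\<dots> \<in> eisenstein" using l(1) by simp
            finally show False using s(2) by simp
          qed
        qed
        then show ?thesis using v by simp
      qed
    next
      assume pow: "u ^ stab z = v ^ stab z"
      show "orbit_map (z + u) = orbit_map (z + v)"
      proof (cases "stab z = 3")
        case True
        then have "v ^ 3 = u ^ 3" using pow by simp
        then obtain j where j: "v = omega ^ j * u" by (rule cube_root_omega)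
        obtain e' where e': "e' \<in> eisenstein" "1 - omega ^ j = (1 - omega) * e'"
          using one_minus_omega_power_dvd by blast
        have "(1 - omega) * z \<in> eisenstein" using True by (auto simp: stab_def split: if_splits)
        then have "e' * ((1 - omega) * z) \<in> eisenstein" using e'(1) by simp
        moreover have "e' * ((1 - omega) * z) = (1 - omega ^ j) * z"
          unfolding e'(2) by (simp add: mult_ac)
        ultimately have "(1 - omega ^ j) * z \<in> eisenstein" by simp
        moreover have "z + v = omega ^ j * (z + u) + (1 - omega ^ j) * z"
          unfolding j by (simp add: algebra_simps)
        ultimately show ?thesis unfolding orbit_map_eq_iff orbit_rel_def by blast
      next
        case False
        then have "stab z = 1" by (auto simp: stab_def split: if_splits)
        then show ?thesis using pow by simp
      qed
    qed
  qed
qed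

text \<open>Reduction to the fundamental parallelogram of the lattice. It supplies the compactness
  behind the openness of \<open>orbit_map\<close>.\<close>

lemma orbit_rel_bounded_rep: "\<exists>w. orbit_rel z w \<and> cmod w \<le> 2"
proof -
  define l where "l = of_int (- \<lfloor>coord1 z\<rfloor>) + of_int (- \<lfloor>coord2 z\<rfloor>) * omega"
  have l: "l \<in> eisenstein"
    unfolding l_def by (intro eisenstein_ring(4) eisenstein_ring(6) eisenstein_of_int eisenstein_ring(3))
  have c: "coord1 (z + l) = frac (coord1 z)" "coord2 (z + l) = frac (coord2 z)"
    by (simp_all add: l_def frac_def)
  have "z + l = of_real (frac (coord1 z)) + of_real (frac (coord2 z)) * omega"
    by (subst coord_expand) (simp only: c)
  then have "cmod (z + l) \<le> \<bar>frac (coord1 z)\<bar> + \<bar>frac (coord2 z)\<bar>"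
    using norm_triangle_ineq[of "of_real (frac (coord1 z))" "of_real (frac (coord2 z)) * omega"]
      by (simp add: norm_mult norm_omega)
  also have "\<dots> \<le> 2" using frac_lt_1[of "coord1 z"] frac_lt_1[of "coord2 z"] by simp
  finally have "cmod (z + l) \<le> 2" .
  moreover have "orbit_rel z (z + l)"
    unfolding orbit_rel_def using l by (intro exI[of _ 0] bexI[of _ l]) simp_all
  ultimately show ?thesis by blast
qed

abbreviation usphere :: "(complex \<times> real) set" where "usphere \<equiv> sphere 0 1"

lemma orbit_map_image: "range orbit_map = usphere"
proof
  show "range orbit_map \<subseteq> usphere" using orbit_map_sphere by blast
  show "usphere \<subseteq> range orbit_map"
  proof
    fix x assume "x \<in> usphere"
    then obtain z where "orbit_map z = x" by (rule orbit_map_surj)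
    then show "x \<in> range orbit_map" by blast
  qed
qed

text \<open>The union F of the orbits that miss W is closed. Every orbit meets
  \<open>cball 0 2\<close>, so F has the same image as a compact set; this image is closed, and the
  image of W is its complement.\<close>

lemma openin_orbit_map_image:
  assumes "open W"
  shows "openin (top_of_set usphere) (orbit_map ` W)"
proof -
  define F where "F = - {z. orbit_map z \<in> orbit_map ` W}"
  have "{z. orbit_map z \<in> orbit_map ` W} = (\<Union>j. \<Union>l\<in>eisenstein. (\<lambda>z. omega ^ j * z + l) -` W)"
  proof (intro equalityI subsetI)
    fix z assume "z \<in> {z. orbit_map z \<in> orbit_map ` W}"
    then have "orbit_map z \<in> orbit_map ` W" by simp
    then obtain w where w: "orbit_map z = orbit_map w" "w \<in> W" by (rule imageE)
    then obtain j l where "l \<in> eisenstein" "w = omega ^ j * z + l"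
      unfolding orbit_map_eq_iff orbit_rel_def by blast
    then show "z \<in> (\<Union>j. \<Union>l\<in>eisenstein. (\<lambda>z. omega ^ j * z + l) -` W)"
      using w(2) by (intro UN_I[of j] UN_I[of l]) simp_all
  next
    fix z assume "z \<in> (\<Union>j. \<Union>l\<in>eisenstein. (\<lambda>z. omega ^ j * z + l) -` W)"
    then obtain j l where jl: "l \<in> eisenstein" "omega ^ j * z + l \<in> W" by auto
    then have "orbit_map z = orbit_map (omega ^ j * z + l)"
      unfolding orbit_map_eq_iff orbit_rel_def by blast
    then show "z \<in> {z. orbit_map z \<in> orbit_map ` W}" using jl(2) by simp
  qed
  moreover have "open ((\<lambda>z. omega ^ j * z + l) -` W)" for j l
    by (rule open_vimage[OF assms]) (intro continuous_intros)
  ultimately have "open {z. orbit_map z \<in> orbit_map ` W}" by (simp add: open_UN)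
  then have "closed F" by (simp add: F_def closed_Compl)
  then have "compact (F \<inter> cball 0 2)" by (intro closed_Int_compact) auto
  then have "compact (orbit_map ` (F \<inter> cball 0 2))"
    by (intro compact_continuous_image continuous_on_orbit_map)
  then have "closed (orbit_map ` (F \<inter> cball 0 2))" by (rule compact_imp_closed)
  moreover have "orbit_map ` W = usphere - orbit_map ` (F \<inter> cball 0 2)"
  proof (intro equalityI subsetI)
    fix x assume x: "x \<in> orbit_map ` W"
    then have "x \<in> usphere" using orbit_map_sphere by blast
    moreover have "x \<notin> orbit_map ` (F \<inter> cball 0 2)"
    proof
      assume "x \<in> orbit_map ` (F \<inter> cball 0 2)"
      then obtain z where "x = orbit_map z" "z \<in> F" by blast
      then show False using x by (simp add: F_def)
    qed
    ultimately show "x \<in> usphere - orbit_map ` (F \<inter> cball 0 2)" by blast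
  next
    fix x assume x: "x \<in> usphere - orbit_map ` (F \<inter> cball 0 2)"
    then have "x \<in> usphere" by blast
    then obtain z where z: "orbit_map z = x" by (rule orbit_map_surj)
    obtain w where w: "orbit_rel z w" "cmod w \<le> 2" using orbit_rel_bounded_rep by blast
    have wx: "orbit_map w = x" using iffD2[OF orbit_map_eq_iff w(1)] z by simp
    show "x \<in> orbit_map ` W"
    proof (rule ccontr)
      assume "x \<notin> orbit_map ` W"
      then have "w \<in> F \<inter> cball 0 2" using wx w(2) by (simp add: F_def)
      then have "x \<in> orbit_map ` (F \<inter> cball 0 2)" using wx by blast
      then show False using x by blast
    qed
  qed
  ultimately show ?thesis by (simp add: Diff_eq open_Compl openin_open_Int)
qed

lemma open_power_image:
  fixes c z0 :: complex
  assumes "open A" "c \<noteq> 0" "s > 0"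
  shows "open ((\<lambda>z. (c * (z - z0)) ^ s) ` A)"
proof (rule open_mapping_thm[of "\<lambda>z. (c * (z - z0)) ^ s" UNIV])
  show "(\<lambda>z. (c * (z - z0)) ^ s) holomorphic_on UNIV" by (intro holomorphic_intros)
  show "\<not> (\<lambda>z. (c * (z - z0)) ^ s) constant_on UNIV"
  proof
    assume "(\<lambda>z. (c * (z - z0)) ^ s) constant_on UNIV"
    then have "(c * (z0 - z0)) ^ s = (c * ((z0 + 1 / c) - z0)) ^ s"
      unfolding constant_on_def by (metis UNIV_I)
    then show False using assms(2,3) by (simp add: power_0_left)
  qed
qed (use assms in auto)

text \<open>The power of the displacement descends to a chart of the sphere around the image of z0.
  The free factor c allows the source chart of the induced map to absorb the multiplication by
  \<alpha>.\<close>

lemma orbit_map_chart: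
  assumes "c \<noteq> 0" and "r > 0"
    and loc: "\<And>u v. cmod u < r \<Longrightarrow> cmod v < r \<Longrightarrow> orbit_map (z0 + u) = orbit_map (z0 + v) \<longleftrightarrow> u ^ stab z0 = v ^ stab z0"
  obtains \<phi> where "homeomorphic_map (subtopology (top_of_set usphere) (orbit_map ` ball z0 r))
      (top_of_set ((\<lambda>z. (c * (z - z0)) ^ stab z0) ` ball z0 r)) \<phi>"
    "\<And>z. z \<in> ball z0 r \<Longrightarrow> \<phi> (orbit_map z) = (c * (z - z0)) ^ stab z0"
proof -
  let ?s = "stab z0" let ?B = "ball z0 r" let ?U = "orbit_map ` ?B" let ?m = "\<lambda>z. (c * (z - z0)) ^ ?s"
  have s: "?s > 0" by (simp add: stab_def)
  have iff: "orbit_map z = orbit_map w \<longleftrightarrow> ?m z = ?m w" if "z \<in> ?B" "w \<in> ?B" for z w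
  proof -
    have "orbit_map z = orbit_map w \<longleftrightarrow> (z - z0) ^ ?s = (w - z0) ^ ?s"
      using loc[of "z - z0" "w - z0"] that by (simp add: dist_norm norm_minus_commute)
    then show ?thesis using assms(1) by (simp add: power_mult_distrib)
  qed
  define \<phi> where "\<phi> x = ?m (SOME z. z \<in> ?B \<and> orbit_map z = x)" for x
  have \<phi>: "\<phi> (orbit_map z) = ?m z" if "z \<in> ?B" for z
  proof -
    have "\<exists>w. w \<in> ?B \<and> orbit_map w = orbit_map z" using that by blast
    from someI_ex[OF this] have "(SOME w. w \<in> ?B \<and> orbit_map w = orbit_map z) \<in> ?B"
      "orbit_map (SOME w. w \<in> ?B \<and> orbit_map w = orbit_map z) = orbit_map z" by blast+
    then show ?thesis unfolding \<phi>_def using iff[OF _ that] by blast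
  qed
  have US: "?U \<subseteq> usphere" using orbit_map_sphere by blast
  have sub: "subtopology (top_of_set usphere) ?U = top_of_set ?U"
    using US by (simp add: subtopology_subtopology Int_absorb1)
  have oU: "openin (top_of_set usphere) ?U" by (rule openin_orbit_map_image) simp
  have im: "\<phi> ` ?U = ?m ` ?B" unfolding image_image by (rule image_cong[OF refl \<phi>])
  have inj: "inj_on \<phi> ?U"
  proof (rule inj_onI)
    fix x y assume "x \<in> ?U" "y \<in> ?U" and eq: "\<phi> x = \<phi> y"
    then obtain z w where zw: "z \<in> ?B" "w \<in> ?B" "x = orbit_map z" "y = orbit_map w" by blast
    then have "?m z = ?m w" using eq \<phi> by simp
    then show "x = y" using iff[OF zw(1,2)] zw by blast
  qed
  have cont: "continuous_on ?U \<phi>"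
    unfolding continuous_openin_preimage_eq
  proof (intro allI impI)
    fix O' :: "complex set" assume O': "open O'"
    have "open (?B \<inter> ?m -` O')" by (intro open_Int open_ball open_vimage[OF O'] continuous_intros)
    then have "openin (top_of_set usphere) (orbit_map ` (?B \<inter> ?m -` O'))"
      by (rule openin_orbit_map_image)
    then have "openin (top_of_set ?U) (orbit_map ` (?B \<inter> ?m -` O'))"
      by (rule openin_subset_trans) (use US in auto)
    moreover have "?U \<inter> \<phi> -` O' = orbit_map ` (?B \<inter> ?m -` O')" using \<phi> by auto
    ultimately show "openin (top_of_set ?U) (?U \<inter> \<phi> -` O')" by simp
  qed
  have opn: "openin (top_of_set (?m ` ?B)) (\<phi> ` T)" if "openin (top_of_set ?U) T" for T
  proof -
    obtain T' where T': "open T'" "T = ?U \<inter> T'"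
      using \<open>openin (top_of_set ?U) T\<close> by (auto simp: openin_open)
    have "open (?B \<inter> orbit_map -` T')"
      by (intro open_Int open_ball open_vimage[OF T'(1)] continuous_on_orbit_map)
    then have op: "open (?m ` (?B \<inter> orbit_map -` T'))" by (rule open_power_image[OF _ assms(1) s])
    have eqT: "T = orbit_map ` (?B \<inter> orbit_map -` T')" unfolding T'(2) by blast
    have "\<phi> ` T = (\<lambda>z. \<phi> (orbit_map z)) ` (?B \<inter> orbit_map -` T')"
      using arg_cong[OF eqT, of "image \<phi>"] unfolding image_image .
    also have "\<dots> = ?m ` (?B \<inter> orbit_map -` T')" by (rule image_cong[OF refl \<phi>]) simp
    finally have imT: "\<phi> ` T = ?m ` (?B \<inter> orbit_map -` T')" .
    show ?thesis unfolding imT by (rule open_subset[OF image_mono op]) simp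
  qed
  have "homeomorphic_map (top_of_set ?U) (top_of_set (?m ` ?B)) \<phi>"
  proof (rule bijective_open_imp_homeomorphic_map)
    show "continuous_map (top_of_set ?U) (top_of_set (?m ` ?B)) \<phi>"
    proof -
      have "\<phi> \<in> ?U \<rightarrow> ?m ` ?B" using im by blast
      then show ?thesis using cont by (simp add: continuous_map_in_subtopology)
    qed
    show "open_map (top_of_set ?U) (top_of_set (?m ` ?B)) \<phi>"
      unfolding open_map_def using opn by blast
    show "\<phi> ` topspace (top_of_set ?U) = topspace (top_of_set (?m ` ?B))" using im by simp
    show "inj_on \<phi> (topspace (top_of_set ?U))" using inj by simp
  qed
  then show thesis using that[of \<phi>] \<phi> unfolding sub by blast
qed

section \<open>Lattes maps: multiplication by an Eisenstein integer, descended to the sphere\<close>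

definition lattes :: "complex \<Rightarrow> complex \<times> real \<Rightarrow> complex \<times> real" where
  "lattes \<alpha> x = orbit_map (\<alpha> * (SOME z. orbit_map z = x))"

text \<open>The chosen representative does not matter: multiplication by \<alpha> commutes with
  powers of \<open>omega\<close> and maps the lattice into itself, so orbits go into orbits.\<close>

lemma lattes_orbit_map:
  assumes "\<alpha> \<in> eisenstein"
  shows "lattes \<alpha> (orbit_map z) = orbit_map (\<alpha> * z)"
proof -
  define w where "w = (SOME w. orbit_map w = orbit_map z)"
  have "orbit_map w = orbit_map z" unfolding w_def by (rule someI) (rule refl)
  then have "orbit_map (\<alpha> * w) = orbit_map (\<alpha> * z)"
    unfolding orbit_map_eq_iff by (rule orbit_rel_mult[OF assms])
  then show ?thesis by (simp add: lattes_def w_def)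
qed

text \<open>As \<open>orbit_map\<close> is open and onto the sphere, continuity of the map from z to
  \<open>orbit_map (\<alpha> * z)\<close> descends.\<close>

lemma lattes_continuous:
  assumes "\<alpha> \<in> eisenstein"
  shows "continuous_map (top_of_set usphere) (top_of_set usphere) (lattes \<alpha>)"
proof -
  have "continuous_on usphere (lattes \<alpha>)"
    unfolding continuous_openin_preimage_eq
  proof (intro allI impI)
    fix O' :: "(complex \<times> real) set" assume O': "open O'"
    have "open ((\<lambda>z. orbit_map (\<alpha> * z)) -` O')"
      by (rule open_vimage[OF O']) (rule continuous_on_compose2[OF continuous_on_orbit_map[of UNIV]], auto intro!: continuous_intros)
    then have "openin (top_of_set usphere) (orbit_map ` ((\<lambda>z. orbit_map (\<alpha> * z)) -` O'))"
      by (rule openin_orbit_map_image)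
    moreover have "usphere \<inter> lattes \<alpha> -` O' = orbit_map ` ((\<lambda>z. orbit_map (\<alpha> * z)) -` O')"
      unfolding orbit_map_image[symmetric] using lattes_orbit_map[OF assms] by auto
    ultimately show "openin (top_of_set usphere) (usphere \<inter> lattes \<alpha> -` O')" by simp
  qed
  moreover have "lattes \<alpha> ` usphere \<subseteq> usphere" using orbit_map_sphere by (auto simp: lattes_def)
  ultimately show ?thesis by (simp add: continuous_map_in_subtopology Pi_iff image_subset_iff)
qed

text \<open>Charts at z and \<alpha> * z are powers of the displacement with exponents s and t, and
  s divides t. With the factor \<alpha> built into the source chart, the map becomes exactly the
  power t / s.\<close>

lemma lattes_power_map:
  assumes \<alpha>: "\<alpha> \<in> eisenstein" "\<alpha> \<noteq> 0"
  shows "locally_power_map (top_of_set usphere) (top_of_set usphere) (lattes \<alpha>) (orbit_map z) (stab (\<alpha> * z) div stab z)"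
proof -
  let ?s = "stab z" let ?t = "stab (\<alpha> * z)"
  define k where "k = ?t div ?s"
  have t: "?t = ?s * k" using stab_mult[OF \<alpha>(1), of z] by (simp add: k_def)
  have "?t > 0" by (simp add: stab_def)
  then have k: "k \<ge> 1" using t by (cases k) auto
  obtain e1 where e1: "e1 > 0" "\<And>u v. cmod u < e1 \<Longrightarrow> cmod v < e1 \<Longrightarrow> orbit_map (z + u) = orbit_map (z + v) \<longleftrightarrow> u ^ ?s = v ^ ?s"
    using orbit_map_local[of z] by metis
  obtain e2 where e2: "e2 > 0" "\<And>u v. cmod u < e2 \<Longrightarrow> cmod v < e2 \<Longrightarrow> orbit_map (\<alpha> * z + u) = orbit_map (\<alpha> * z + v) \<longleftrightarrow> u ^ ?t = v ^ ?t"
    using orbit_map_local[of "\<alpha> * z"] by metis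
  define r where "r = min e1 (e2 / cmod \<alpha>)"
  have r: "r > 0" "r \<le> e1" "cmod \<alpha> * r \<le> e2"
    using e1(1) e2(1) \<alpha>(2) by (auto simp: r_def min_def field_simps)
  have R: "cmod \<alpha> * r > 0" using r \<alpha>(2) by simp
  obtain \<phi> where \<phi>: "homeomorphic_map (subtopology (top_of_set usphere) (orbit_map ` ball z r))
      (top_of_set ((\<lambda>w. (\<alpha> * (w - z)) ^ ?s) ` ball z r)) \<phi>"
    "\<And>w. w \<in> ball z r \<Longrightarrow> \<phi> (orbit_map w) = (\<alpha> * (w - z)) ^ ?s"
    by (rule orbit_map_chart[OF \<alpha>(2) r(1), of z]) (use e1(2) r(2) in auto)
  obtain \<psi> where \<psi>: "homeomorphic_map (subtopology (top_of_set usphere) (orbit_map ` ball (\<alpha> * z) (cmod \<alpha> * r)))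
      (top_of_set ((\<lambda>w. (1 * (w - \<alpha> * z)) ^ ?t) ` ball (\<alpha> * z) (cmod \<alpha> * r))) \<psi>"
    "\<And>w. w \<in> ball (\<alpha> * z) (cmod \<alpha> * r) \<Longrightarrow> \<psi> (orbit_map w) = (1 * (w - \<alpha> * z)) ^ ?t"
    by (rule orbit_map_chart[OF one_neq_zero R, of "\<alpha> * z"]) (use e2(2) r(3) in auto)
  have ball: "\<alpha> * w \<in> ball (\<alpha> * z) (cmod \<alpha> * r)" if "w \<in> ball z r" for w
    using that \<alpha>(2) by (simp add: dist_norm norm_mult flip: right_diff_distrib)
  show ?thesis unfolding locally_power_map_def k_def[symmetric]
  proof (intro conjI exI)
    show "k \<ge> 1" by (fact k)
    show "openin (top_of_set usphere) (orbit_map ` ball z r)"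
      "openin (top_of_set usphere) (orbit_map ` ball (\<alpha> * z) (cmod \<alpha> * r))"
        by (simp_all add: openin_orbit_map_image)
    show "orbit_map z \<in> orbit_map ` ball z r" using r(1) by simp
    show "lattes \<alpha> ` orbit_map ` ball z r \<subseteq> orbit_map ` ball (\<alpha> * z) (cmod \<alpha> * r)"
      using ball lattes_orbit_map[OF \<alpha>(1)] by (force simp: image_iff)
    show "open ((\<lambda>w. (\<alpha> * (w - z)) ^ ?s) ` ball z r)" "open ((\<lambda>w. (1 * (w - \<alpha> * z)) ^ ?t) ` ball (\<alpha> * z) (cmod \<alpha> * r))"
      by (rule open_power_image; use \<alpha>(2) in \<open>simp add: stab_def\<close>)+
    show "homeomorphic_map (subtopology (top_of_set usphere) (orbit_map ` ball z r))
      (top_of_set ((\<lambda>w. (\<alpha> * (w - z)) ^ ?s) ` ball z r)) \<phi>" by (fact \<phi>(1))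
    show "homeomorphic_map (subtopology (top_of_set usphere) (orbit_map ` ball (\<alpha> * z) (cmod \<alpha> * r)))
      (top_of_set ((\<lambda>w. (1 * (w - \<alpha> * z)) ^ ?t) ` ball (\<alpha> * z) (cmod \<alpha> * r))) \<psi>" by (fact \<psi>(1))
    show "\<phi> (orbit_map z) = 0" using \<phi>(2)[of z] r(1) by (simp add: stab_def)
    show "\<psi> (lattes \<alpha> (orbit_map z)) = 0"
      unfolding lattes_orbit_map[OF \<alpha>(1)] using \<psi>(2)[of "\<alpha> * z"] R by (simp add: stab_def)
    show "\<forall>u\<in>orbit_map ` ball z r. \<psi> (lattes \<alpha> u) = \<phi> u ^ k"
    proof
      fix u assume "u \<in> orbit_map ` ball z r"
      then obtain w where w: "u = orbit_map w" "w \<in> ball z r" by (rule imageE)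
      have "\<psi> (lattes \<alpha> u) = (\<alpha> * w - \<alpha> * z) ^ ?t"
        unfolding w(1) lattes_orbit_map[OF \<alpha>(1)] using \<psi>(2)[OF ball[OF w(2)]] by simp
      also have "\<dots> = \<phi> u ^ k"
        unfolding w(1) \<phi>(2)[OF w(2)] t by (simp add: power_mult right_diff_distrib)
      finally show "\<psi> (lattes \<alpha> u) = \<phi> u ^ k" .
    qed
  qed
qed

section \<open>Fibres of the quotient of multiplication by an Eisenstein integer\<close>

text \<open>Whenever \<open>omega ^ j\<close> is not 1, the numbers \<open>1 - omega ^ j\<close> and
  \<open>1 - omega\<close> differ only by a unit.\<close>

lemma eisenstein_one_minus_omega:
  assumes "(1 - omega ^ j) * w \<in> eisenstein" "omega ^ j \<noteq> 1"
  shows "(1 - omega) * w \<in> eisenstein"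
proof -
  obtain i where i: "i < 3" "omega ^ j = omega ^ i" using omega_power_mod by blast
  have "i \<noteq> 0"
  proof
    assume "i = 0"
    then show False using assms(2) i(2) by simp
  qed
  then consider "i = 1" | "i = 2" using i(1) by linarith
  then show ?thesis
  proof cases
    case 1 then show ?thesis using assms(1) i(2) by simp
  next
    case 2
    have "omega * (omega ^ j) = omega ^ 3"
      unfolding i(2) 2 by (simp add: numeral_3_eq_3 numeral_2_eq_2)
    then have e: "1 - omega = - (omega * (1 - omega ^ j))"
      by (simp add: right_diff_distrib omega_cubed)
    have "(1 - omega) * w = - (omega * (1 - omega ^ j)) * w" by (rule arg_cong[OF e])
    also have "\<dots> = - (omega * ((1 - omega ^ j) * w))" by (simp only: mult_minus_left mult.assoc)
    also have "\<dots> \<in> eisenstein"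
      by (rule eisenstein_ring(7)[OF eisenstein_ring(6)[OF _ assms(1)]]) simp
    finally show ?thesis .
  qed
qed

lemma stab_neq_3:
  assumes "stab w \<noteq> 3"
  shows "stab w = 1" "(1 - omega) * w \<notin> eisenstein"
  using assms by (auto simp: stab_def split: if_splits)

lemma omega_power_inj:
  assumes "i < 3" "j < 3" "omega ^ i = omega ^ j"
  shows "i = j"
proof -
  have o2: "omega ^ 2 = - 1 - omega" by (simp add: power2_eq_square omega_sq)
  have "omega \<noteq> 1" "omega ^ 2 \<noteq> 1" "omega ^ 2 \<noteq> omega"
    unfolding o2 by (auto simp: omega_def complex_eq_iff)
  moreover have "i \<in> {0, 1, 2}" "j \<in> {0, 1, 2}" using assms by auto
  ultimately show ?thesis using assms(3) by auto
qed

lemma transversal_rep: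
  assumes "transversal \<alpha> R"
  obtains \<rho> where "\<And>z. z \<in> eisenstein \<Longrightarrow> \<rho> z \<in> R"
    "\<And>z l. z \<in> eisenstein \<Longrightarrow> l \<in> R \<Longrightarrow> \<rho> z = l \<longleftrightarrow> l - z \<in> eisenstein_ideal \<alpha>"
proof -
  have "\<forall>z\<in>eisenstein. \<exists>r. r \<in> R \<and> z - r \<in> eisenstein_ideal \<alpha>"
    using transversal_ex[OF assms] by blast
  then obtain \<rho> where \<rho>: "\<forall>z\<in>eisenstein. \<rho> z \<in> R \<and> z - \<rho> z \<in> eisenstein_ideal \<alpha>" by metis
  show thesis
  proof (rule that[of \<rho>])
    show "\<rho> z \<in> R" if "z \<in> eisenstein" for z using \<rho> that by blast
    show "\<rho> z = l \<longleftrightarrow> l - z \<in> eisenstein_ideal \<alpha>" if zl: "z \<in> eisenstein" "l \<in> R" for z l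
    proof
      assume "\<rho> z = l"
      then have "z - l \<in> eisenstein_ideal \<alpha>" using \<rho> zl(1) by blast
      then show "l - z \<in> eisenstein_ideal \<alpha>" using eisenstein_ideal_closed(4)[of "z - l" \<alpha>] by simp
    next
      assume "l - z \<in> eisenstein_ideal \<alpha>"
      then have "(z - \<rho> z) + (l - z) \<in> eisenstein_ideal \<alpha>"
        using \<rho> zl(1) by (intro eisenstein_ideal_closed(2)) auto
      then have "l - \<rho> z \<in> eisenstein_ideal \<alpha>" by simp
      then have "l = \<rho> z" using \<rho> zl by (intro transversal_unique[OF assms]) auto
      then show "\<rho> z = l" by simp
    qed
  qed
qed

context
  fixes \<alpha> :: complex
  assumes \<alpha>: "\<alpha> \<in> eisenstein" "\<alpha> \<noteq> 0"
begin

text \<open>Labels the fibre over the orbit of w by lattice elements: the points z with \<alpha> * z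
  = w + l. On the torus the label counts modulo \<alpha>; on the sphere rotations identify further
  labels.\<close>

definition preim :: "complex \<Rightarrow> complex \<Rightarrow> complex \<times> real" where
  "preim w l = orbit_map ((w + l) / \<alpha>)"

lemma lattes_fibre:
  "usphere \<inter> lattes \<alpha> -` {orbit_map w} = preim w ` eisenstein"
proof (intro equalityI subsetI)
  fix x assume x: "x \<in> usphere \<inter> lattes \<alpha> -` {orbit_map w}"
  then have "x \<in> usphere" by blast
  then obtain z where z: "orbit_map z = x" by (rule orbit_map_surj)
  have "orbit_map (\<alpha> * z) = orbit_map w" using x lattes_orbit_map[OF \<alpha>(1), of z] unfolding z by simp
  then obtain j l where l: "l \<in> eisenstein" "w = omega ^ j * (\<alpha> * z) + l"
    unfolding orbit_map_eq_iff orbit_rel_def by blast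
  have "(w + - l) / \<alpha> = omega ^ j * z" using l(2) \<alpha>(2) by simp
  moreover have "orbit_rel z (omega ^ j * z)"
    unfolding orbit_rel_def by (intro exI[of _ j] bexI[of _ 0]) simp_all
  ultimately have "preim w (- l) = x"
    unfolding preim_def using z orbit_map_eq_iff[of z "omega ^ j * z"] by simp
  then show "x \<in> preim w ` eisenstein" using l(1) by (intro image_eqI[of _ _ "- l"]) simp_all
next
  fix x assume "x \<in> preim w ` eisenstein"
  then obtain l where l: "x = preim w l" "l \<in> eisenstein" by (rule imageE)
  have "orbit_rel w (w + l)"
    unfolding orbit_rel_def using l(2) by (intro exI[of _ 0] bexI[of _ l]) simp_all
  then have "orbit_map w = orbit_map (w + l)" by (rule iffD2[OF orbit_map_eq_iff])
  moreover have "lattes \<alpha> x = orbit_map (w + l)"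
    unfolding l(1) preim_def lattes_orbit_map[OF \<alpha>(1)] using \<alpha>(2) by simp
  moreover have "x \<in> usphere" unfolding l(1) preim_def by (rule orbit_map_sphere)
  ultimately show "x \<in> usphere \<inter> lattes \<alpha> -` {orbit_map w}" by simp
qed

text \<open>Multiplication by \<open>omega ^ j\<close> turns w + k into w plus the label in
  parentheses, and a lattice translation of the preimage changes its label by a multiple of
  \<alpha>.\<close>

lemma preim_eq_iff:
  "preim w k = preim w l \<longleftrightarrow> (\<exists>j. l - (omega ^ j * k + (omega ^ j - 1) * w) \<in> eisenstein_ideal \<alpha>)"
proof -
  have "(w + l) / \<alpha> = omega ^ j * ((w + k) / \<alpha>) + m \<longleftrightarrow> l - (omega ^ j * k + (omega ^ j - 1) * w) = \<alpha> * m" for j m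
    using \<alpha>(2) by (simp add: field_simps)
  then show ?thesis
    unfolding preim_def orbit_map_eq_iff orbit_rel_def eisenstein_ideal_def image_iff by simp
qed

lemma stab_preim: "stab (\<alpha> * ((w + l) / \<alpha>)) = stab w" if "l \<in> eisenstein"
proof -
  have "orbit_rel w (w + l)"
    unfolding orbit_rel_def using that by (intro exI[of _ 0] bexI[of _ l]) simp_all
  then show ?thesis using stab_orbit_rel \<alpha>(2) by simp
qed

lemma local_degree_preim:
  assumes "l \<in> eisenstein"
  shows "local_degree (top_of_set usphere) (top_of_set usphere) (lattes \<alpha>) (preim w l) = stab w div stab ((w + l) / \<alpha>)"
  using local_degree_eq[OF lattes_power_map[OF \<alpha>, of "(w + l) / \<alpha>"]]
    unfolding stab_preim[OF assms] preim_def .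

text \<open>Orbit and stabilizer: if w is a cone point, the powers of \<open>omega\<close> act on
  the labels modulo \<alpha> with orbits the points of the fibre. A label is fixed exactly if
  \<open>(w + k) / \<alpha>\<close> is a cone point too, so the orbit length 1 or 3 is the local
  degree.\<close>

lemma card_preim:
  assumes R: "transversal \<alpha> R" and k: "k \<in> eisenstein"
  shows "card {l \<in> R. preim w l = preim w k} = stab w div stab ((w + k) / \<alpha>)"
proof -
  let ?g = "\<lambda>j. omega ^ j * k + (omega ^ j - 1) * w"
  let ?z = "(w + k) / \<alpha>"
  have zw: "\<alpha> * ?z = w + k" using \<alpha>(2) by simp
  obtain \<rho> where \<rho>: "\<And>z. z \<in> eisenstein \<Longrightarrow> \<rho> z \<in> R"
    "\<And>z l. z \<in> eisenstein \<Longrightarrow> l \<in> R \<Longrightarrow> \<rho> z = l \<longleftrightarrow> l - z \<in> eisenstein_ideal \<alpha>"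
      using transversal_rep[OF R] by blast
  have RE: "R \<subseteq> eisenstein" using R by (simp add: transversal_def)
  have diff: "?g i - ?g j = \<alpha> * ((omega ^ i - omega ^ j) * ?z)" for i j
  proof -
    have "?g i - ?g j = (omega ^ i - omega ^ j) * (w + k)" by (simp add: algebra_simps)
    also have "\<dots> = (omega ^ i - omega ^ j) * (\<alpha> * ?z)" by (simp only: zw)
    also have "\<dots> = \<alpha> * ((omega ^ i - omega ^ j) * ?z)" by (rule mult.left_commute)
    finally show ?thesis .
  qed
  have ideal_iff: "?g i - ?g j \<in> eisenstein_ideal \<alpha> \<longleftrightarrow> (omega ^ i - omega ^ j) * ?z \<in> eisenstein" for i j
  proof
    assume "?g i - ?g j \<in> eisenstein_ideal \<alpha>"
    then obtain e where e: "e \<in> eisenstein" "?g i - ?g j = \<alpha> * e" by (rule eisenstein_idealE)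
    then have "\<alpha> * ((omega ^ i - omega ^ j) * ?z) = \<alpha> * e" unfolding diff by simp
    then have "(omega ^ i - omega ^ j) * ?z = e" by (rule mult_left_cancel[OF \<alpha>(2), THEN iffD1])
    then show "(omega ^ i - omega ^ j) * ?z \<in> eisenstein" using e(1) by (simp only:)
  next
    assume "(omega ^ i - omega ^ j) * ?z \<in> eisenstein"
    then show "?g i - ?g j \<in> eisenstein_ideal \<alpha>" unfolding diff by (rule eisenstein_idealI)
  qed
  show ?thesis
  proof (cases "stab w = 3")
    case True
    then have w: "(1 - omega) * w \<in> eisenstein" by (auto simp: stab_def split: if_splits)
    \<comment> \<open>For a cone point w the number \<open>(omega ^ j - 1) * w\<close> is in the
      lattice, so rotated labels are again labels.\<close>
    have gE: "?g j \<in> eisenstein" for j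
    proof -
      obtain e where e: "e \<in> eisenstein" "1 - omega ^ j = (1 - omega) * e"
        using one_minus_omega_power_dvd by blast
      have "(omega ^ j - 1) * w = - ((1 - omega ^ j) * w)" by (simp add: algebra_simps)
      also have "\<dots> = - (e * ((1 - omega) * w))" unfolding e(2) by (simp add: mult_ac)
      also have "\<dots> \<in> eisenstein" by (rule eisenstein_ring(7)[OF eisenstein_ring(6)[OF e(1) w]])
      finally have "(omega ^ j - 1) * w \<in> eisenstein" .
      moreover have "omega ^ j * k \<in> eisenstein" using k by (intro eisenstein_ring(6)) simp_all
      ultimately show ?thesis by (intro eisenstein_ring(4))
    qed
    have set: "{l \<in> R. preim w l = preim w k} = (\<lambda>j. \<rho> (?g j)) ` {..<3}"
    proof (intro equalityI subsetI)
      fix l assume "l \<in> {l \<in> R. preim w l = preim w k}"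
      then have l: "l \<in> R" "preim w k = preim w l" by simp_all
      then obtain j0 where "l - ?g j0 \<in> eisenstein_ideal \<alpha>" unfolding preim_eq_iff by blast
      moreover obtain j where j: "j < 3" "omega ^ j0 = omega ^ j" using omega_power_mod by blast
      ultimately have "l - ?g j \<in> eisenstein_ideal \<alpha>" by simp
      then have "\<rho> (?g j) = l" by (rule iffD2[OF \<rho>(2)[OF gE l(1)]])
      then show "l \<in> (\<lambda>j. \<rho> (?g j)) ` {..<3}" using j(1) by (intro image_eqI[of _ _ j]) simp_all
    next
      fix l assume "l \<in> (\<lambda>j. \<rho> (?g j)) ` {..<3}"
      then obtain j where j: "l = \<rho> (?g j)" by blast
      have lR: "l \<in> R" unfolding j by (rule \<rho>(1)[OF gE])
      then have "l - ?g j \<in> eisenstein_ideal \<alpha>" using \<rho>(2)[OF gE lR] j by blast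
      then have "preim w k = preim w l" unfolding preim_eq_iff by blast
      then show "l \<in> {l \<in> R. preim w l = preim w k}" using lR by simp
    qed
    have eq_iff: "\<rho> (?g i) = \<rho> (?g j) \<longleftrightarrow> (omega ^ j - omega ^ i) * ?z \<in> eisenstein" for i j
    proof -
      have "\<rho> (?g i) = \<rho> (?g j) \<longleftrightarrow> \<rho> (?g j) - ?g i \<in> eisenstein_ideal \<alpha>"
        by (rule \<rho>(2)[OF gE \<rho>(1)[OF gE]])
      also have "\<dots> \<longleftrightarrow> ?g j - ?g i \<in> eisenstein_ideal \<alpha>"
      proof -
        have c: "\<rho> (?g j) - ?g j \<in> eisenstein_ideal \<alpha>" using \<rho>(2)[OF gE \<rho>(1)[OF gE], of j j] by simp
        have e: "(\<rho> (?g j) - ?g i) - (\<rho> (?g j) - ?g j) = ?g j - ?g i" "(?g j - ?g i) + (\<rho> (?g j) - ?g j) = \<rho> (?g j) - ?g i"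
          by simp_all
        show ?thesis
          using eisenstein_ideal_closed(3)[OF _ c, of "\<rho> (?g j) - ?g i"] eisenstein_ideal_closed(2)[OF _ c, of "?g j - ?g i"] unfolding e by blast
      qed
      finally show ?thesis unfolding ideal_iff .
    qed
    show ?thesis
    proof (cases "stab ?z = 3")
      case z3: True
      then have z: "(1 - omega) * ?z \<in> eisenstein" by (simp only: stab_def split: if_splits)
      have "\<rho> (?g j) = \<rho> (?g 0)" for j
      proof -
        obtain e where e: "e \<in> eisenstein" "1 - omega ^ j = (1 - omega) * e"
          using one_minus_omega_power_dvd by blast
        have "(omega ^ 0 - omega ^ j) * ?z = e * ((1 - omega) * ?z)"
          using e(2) by (simp add: mult_ac)
        also have "\<dots> \<in> eisenstein" by (rule eisenstein_ring(6)[OF e(1) z])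
        finally show ?thesis unfolding eq_iff .
      qed
      then have "(\<lambda>j. \<rho> (?g j)) ` {..<3} = {\<rho> (?g 0)}"
        by (auto simp: lessThan_def intro!: image_eqI[of _ _ 0])
      then show ?thesis unfolding set True z3 by simp
    next
      case False
      note z1 = stab_neq_3[OF False]
      \<comment> \<open>Multiplying by \<open>omega ^ (3 - i)\<close> turns a coincidence of labels
        into \<open>(1 - omega ^ (j - i)) * ?z\<close> being in the lattice, which would make
        \<open>?z\<close> a cone point.\<close>
      have ne: "\<rho> (?g i) \<noteq> \<rho> (?g j)" if ij: "i < j" "j < 3" for i j
      proof
        assume "\<rho> (?g i) = \<rho> (?g j)"
        then have "(omega ^ j - omega ^ i) * ?z \<in> eisenstein" unfolding eq_iff .
        then have "- ((omega ^ j - omega ^ i) * ?z) \<in> eisenstein" by (rule eisenstein_ring(7))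
        moreover have pw: "omega ^ j = omega ^ i * omega ^ (j - i)"
          using ij by (simp flip: power_add)
        have "- ((a * b - a) * z) = a * ((1 - b) * z)" for a b z :: complex
          by (simp add: algebra_simps)
        then have "- ((omega ^ j - omega ^ i) * ?z) = omega ^ i * ((1 - omega ^ (j - i)) * ?z)"
          unfolding pw .
        ultimately have "omega ^ i * ((1 - omega ^ (j - i)) * ?z) \<in> eisenstein" by (simp only:)
        then have "omega ^ (3 - i) * (omega ^ i * ((1 - omega ^ (j - i)) * ?z)) \<in> eisenstein"
          by (rule eisenstein_ring(6)[OF omega_power_eisenstein])
        moreover have inv: "omega ^ (3 - i) * omega ^ i = 1"
          using ij omega_cubed by (simp flip: power_add)
        have "omega ^ (3 - i) * (omega ^ i * ((1 - omega ^ (j - i)) * ?z)) = (1 - omega ^ (j - i)) * ?z"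
          by (simp only: mult.assoc[symmetric] inv mult_1_left)
        ultimately have "(1 - omega ^ (j - i)) * ?z \<in> eisenstein" by (simp only:)
        moreover have "omega ^ (j - i) \<noteq> 1"
        proof
          assume "omega ^ (j - i) = 1"
          then have "j - i = 0" using ij by (intro omega_power_inj) simp_all
          then show False using ij by simp
        qed
        ultimately show False using eisenstein_one_minus_omega z1(2) by blast
      qed
      have "inj_on (\<lambda>j. \<rho> (?g j)) {..<3}"
      proof (rule inj_onI)
        fix i j assume "i \<in> {..<3::nat}" "j \<in> {..<3}" "\<rho> (?g i) = \<rho> (?g j)"
        then show "i = j" using ne[of i j] ne[of j i] by (cases i j rule: linorder_cases) simp_all
      qed
      then show ?thesis unfolding set True z1(1) by (simp add: card_image)
    qed
  next
    case False
    then have w: "stab w = 1" "(1 - omega) * w \<notin> eisenstein"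
      by (auto simp: stab_def split: if_splits)
    have "stab ?z dvd 1" using stab_mult[OF \<alpha>(1), of ?z] unfolding stab_preim[OF k] w(1) .
    then have z1: "stab ?z = 1" by simp
    \<comment> \<open>A non-trivial rotation would put \<open>(1 - omega ^ j) * w\<close> in the
      lattice, against \<open>stab w = 1\<close>; labels are therefore identified only modulo
      \<alpha>.\<close>
    have "{l \<in> R. preim w l = preim w k} = {\<rho> k}"
    proof (intro equalityI subsetI)
      fix l assume "l \<in> {l \<in> R. preim w l = preim w k}"
      then have l: "l \<in> R" "preim w k = preim w l" by simp_all
      then obtain j where j: "l - ?g j \<in> eisenstein_ideal \<alpha>" unfolding preim_eq_iff by blast
      then obtain e where e: "e \<in> eisenstein" "l - ?g j = \<alpha> * e" by (rule eisenstein_idealE)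
      have lE: "l \<in> eisenstein" using l(1) RE by blast
      have "(1 - omega ^ j) * w = \<alpha> * e + omega ^ j * k - l" using e(2) by (simp add: algebra_simps)
      also have "\<dots> \<in> eisenstein"
        by (intro eisenstein_ring(5) eisenstein_ring(4) eisenstein_ring(6) \<alpha>(1) e(1) k lE omega_power_eisenstein)
      finally have "omega ^ j = 1" using eisenstein_one_minus_omega w(2) by blast
      then have "l - k \<in> eisenstein_ideal \<alpha>" using j by simp
      then have "\<rho> k = l" by (rule iffD2[OF \<rho>(2)[OF k l(1)]])
      then show "l \<in> {\<rho> k}" by simp
    next
      fix l assume "l \<in> {\<rho> k}"
      then have l: "\<rho> k = l" "l \<in> R" using \<rho>(1)[OF k] by auto
      then have "l - ?g 0 \<in> eisenstein_ideal \<alpha>" using iffD1[OF \<rho>(2)[OF k l(2)]] by simp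
      then have "preim w k = preim w l" unfolding preim_eq_iff by blast
      then show "l \<in> {l \<in> R. preim w l = preim w k}" using l(2) by simp
    qed
    then show ?thesis unfolding w(1) z1 by simp
  qed
qed

text \<open>Sorting a transversal by the fibre point that each label produces gives every point as
  often as its local degree, and the transversal has d elements.\<close>

lemma fibre_local_degree_sum:
  assumes d: "(cmod \<alpha>)\<^sup>2 = real d"
  shows "finite (usphere \<inter> lattes \<alpha> -` {orbit_map w})"
    "(\<Sum>x\<in>usphere \<inter> lattes \<alpha> -` {orbit_map w}. local_degree (top_of_set usphere) (top_of_set usphere) (lattes \<alpha>) x) = d"
proof -
  obtain R where R: "finite R" "transversal \<alpha> R" "real (card R) = (cmod \<alpha>)\<^sup>2"
    by (rule exists_transversal[OF \<alpha>])
  have RE: "R \<subseteq> eisenstein" using R(2) by (simp add: transversal_def)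
  have im: "preim w ` eisenstein = preim w ` R"
  proof (intro equalityI subsetI)
    fix x assume "x \<in> preim w ` eisenstein"
    then obtain l where l: "x = preim w l" "l \<in> eisenstein" by (rule imageE)
    obtain r where r: "r \<in> R" "l - r \<in> eisenstein_ideal \<alpha>" by (rule transversal_ex[OF R(2) l(2)])
    have "l - (omega ^ 0 * r + (omega ^ 0 - 1) * w) \<in> eisenstein_ideal \<alpha>" using r(2) by simp
    then have "preim w r = preim w l" unfolding preim_eq_iff by blast
    then show "x \<in> preim w ` R" using r(1) l(1) by (intro image_eqI[of _ _ r]) simp_all
  qed (use RE in blast)
  show "finite (usphere \<inter> lattes \<alpha> -` {orbit_map w})" unfolding lattes_fibre im using R(1) by simp
  have "d = card R" using R(3) d by simp
  also have "\<dots> = (\<Sum>x\<in>preim w ` R. card {l \<in> R. preim w l = x})"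
    using sum.image_gen[OF R(1), of "\<lambda>_. 1::nat" "preim w"] by simp
  also have "\<dots> = (\<Sum>x\<in>preim w ` R. local_degree (top_of_set usphere) (top_of_set usphere) (lattes \<alpha>) x)"
  proof (rule sum.cong[OF refl])
    fix x assume "x \<in> preim w ` R"
    then obtain k where k: "x = preim w k" "k \<in> R" by (rule imageE)
    then have kE: "k \<in> eisenstein" using RE by blast
    show "card {l \<in> R. preim w l = x} = local_degree (top_of_set usphere) (top_of_set usphere) (lattes \<alpha>) x"
      unfolding k(1) card_preim[OF R(2) kE] local_degree_preim[OF kE] ..
  qed
  finally show "(\<Sum>x\<in>usphere \<inter> lattes \<alpha> -` {orbit_map w}. local_degree (top_of_set usphere) (top_of_set usphere) (lattes \<alpha>) x) = d"
    unfolding lattes_fibre im by simp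
qed

text \<open>The point labelled l is a cone point exactly if \<alpha> divides
  \<open>(1 - omega) * (w + l)\<close>. For norm 3 k + 1 the number \<open>1 - omega\<close> is
  invertible modulo \<alpha>, so this linear congruence has one solution modulo \<alpha>.\<close>

lemma unique_unramified_preim:
  assumes d: "(cmod \<alpha>)\<^sup>2 = real (3 * k + 1)" and w: "(1 - omega) * w \<in> eisenstein"
  obtains l0 where "l0 \<in> eisenstein" "stab ((w + l0) / \<alpha>) = 3"
    "\<And>l. l \<in> eisenstein \<Longrightarrow> stab ((w + l) / \<alpha>) = 3 \<Longrightarrow> preim w l = preim w l0"
proof -
  define m where "m = (1 - omega) * w"
  have mE: "m \<in> eisenstein" using w by (simp add: m_def)
  have n: "\<alpha> * cnj \<alpha> = 3 * of_nat k + 1"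
    using complex_norm_square[of \<alpha>, symmetric] unfolding d by (simp del: complex_mult_cnj add: add.commute)
  \<comment> \<open>From (1 - omega) (2 + omega) = 3 and 3 k + 1 = \<alpha> * cnj \<alpha> it
    follows that b is minus the inverse of \<open>1 - omega\<close> modulo \<alpha>.\<close>
  define b where "b = (2 + omega) * of_nat k"
  have bE: "b \<in> eisenstein"
    unfolding b_def using eisenstein_of_int(1)[of 2] by (intro eisenstein_ring(6) eisenstein_ring(4)) simp_all
  have b: "(1 - omega) * b = 3 * of_nat k"
  proof -
    have "(1 - omega) * (2 + omega) = 2 - omega - omega * omega" by (simp add: algebra_simps)
    also have "\<dots> = 3" by (simp add: omega_sq)
    finally show ?thesis unfolding b_def mult.assoc[symmetric] by (rule arg_cong)
  qed
  define l0 where "l0 = b * m"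
  have l0E: "l0 \<in> eisenstein" unfolding l0_def by (rule eisenstein_ring(6)[OF bE mE])
  have key: "(1 - omega) * (w + l0) = \<alpha> * (cnj \<alpha> * m)"
  proof -
    have "(1 - omega) * (w + l0) = m + ((1 - omega) * b) * m"
      by (simp add: l0_def m_def algebra_simps)
    also have "\<dots> = (\<alpha> * cnj \<alpha>) * m" unfolding b n by (simp add: algebra_simps)
    finally show ?thesis by (simp add: mult.assoc)
  qed
  show thesis
  proof (rule that[OF l0E])
    have "(1 - omega) * ((w + l0) / \<alpha>) = cnj \<alpha> * m"
      by (simp only: times_divide_eq_right key nonzero_mult_div_cancel_left[OF \<alpha>(2)])
    moreover have "cnj \<alpha> * m \<in> eisenstein" using \<alpha>(1) mE by simp
    ultimately have "(1 - omega) * ((w + l0) / \<alpha>) \<in> eisenstein" by (simp only:)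
    then show "stab ((w + l0) / \<alpha>) = 3" by (simp only: stab_def if_True)
    fix l assume l: "l \<in> eisenstein" "stab ((w + l) / \<alpha>) = 3"
    define \<mu> where "\<mu> = (1 - omega) * ((w + l) / \<alpha>)"
    have \<mu>: "\<mu> \<in> eisenstein" using l(2) unfolding \<mu>_def by (simp only: stab_def split: if_splits)
    have \<mu>': "(1 - omega) * (w + l) = \<alpha> * \<mu>" using \<alpha>(2) by (simp add: \<mu>_def)
    have "(1 - omega) * (l - l0) = (1 - omega) * (w + l) - (1 - omega) * (w + l0)"
      by (simp add: algebra_simps)
    then have \<nu>: "(1 - omega) * (l - l0) = \<alpha> * (\<mu> - cnj \<alpha> * m)"
      unfolding \<mu>' key by (simp only: right_diff_distrib)
    \<comment> \<open>The Bezout identity 1 = \<alpha> * cnj \<alpha> - b * (1 - omega), multiplied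
      by l - l0; both terms on the right are multiples of \<alpha>.\<close>
    have "l - l0 = (\<alpha> * cnj \<alpha>) * (l - l0) - b * ((1 - omega) * (l - l0))"
    proof -
      have e: "b * ((1 - omega) * (l - l0)) = ((1 - omega) * b) * (l - l0)" by (simp only: mult_ac)
      show ?thesis unfolding e n b by (simp add: algebra_simps)
    qed
    also have "\<dots> = \<alpha> * (cnj \<alpha> * (l - l0) - b * (\<mu> - cnj \<alpha> * m))"
      unfolding \<nu> by (simp add: algebra_simps)
    also have "\<dots> \<in> eisenstein_ideal \<alpha>"
      by (intro eisenstein_idealI eisenstein_ring(5) eisenstein_ring(6) eisenstein_ring(8) \<alpha>(1) l(1) l0E bE \<mu> mE)
    finally have "l - (omega ^ 0 * l0 + (omega ^ 0 - 1) * w) \<in> eisenstein_ideal \<alpha>" by simp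
    then have "preim w l0 = preim w l" unfolding preim_eq_iff by blast
    then show "preim w l = preim w l0" by simp
  qed
qed

text \<open>The single cone point in the fibre has degree 3 / 3 and all other points have degree 3 /
  1; the total 3 k + 1 leaves room for exactly k of the latter.\<close>

lemma local_degrees_over_lattes:
  assumes d: "(cmod \<alpha>)\<^sup>2 = real (3 * k + 1)" and w: "stab w = 3"
  shows "local_degrees_over (top_of_set usphere) (top_of_set usphere) (lattes \<alpha>) (orbit_map w) = replicate_mset k 3 + {#1#}"
proof -
  let ?ld = "local_degree (top_of_set usphere) (top_of_set usphere) (lattes \<alpha>)"
  define F where "F = usphere \<inter> lattes \<alpha> -` {orbit_map w}"
  have F: "finite F" "(\<Sum>x\<in>F. ?ld x) = 3 * k + 1"
    unfolding F_def using fibre_local_degree_sum[OF d] by blast+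
  have w': "(1 - omega) * w \<in> eisenstein" using w by (auto simp: stab_def split: if_splits)
  obtain l0 where l0: "l0 \<in> eisenstein" "stab ((w + l0) / \<alpha>) = 3"
    "\<And>l. l \<in> eisenstein \<Longrightarrow> stab ((w + l) / \<alpha>) = 3 \<Longrightarrow> preim w l = preim w l0"
    using unique_unramified_preim[OF d w'] by blast
  let ?x0 = "preim w l0"
  have x0: "?x0 \<in> F" unfolding F_def lattes_fibre using l0(1) by blast
  have ld0: "?ld ?x0 = 1" unfolding local_degree_preim[OF l0(1)] w l0(2) by simp
  have ld3: "?ld x = 3" if x: "x \<in> F - {?x0}" for x
  proof -
    have "x \<in> preim w ` eisenstein" using x unfolding F_def lattes_fibre by blast
    then obtain l where l: "x = preim w l" "l \<in> eisenstein" by (rule imageE)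
    then have "stab ((w + l) / \<alpha>) \<noteq> 3" using l0(3)[OF l(2)] x by blast
    then have "stab ((w + l) / \<alpha>) = 1" by (rule stab_neq_3(1))
    then show ?thesis unfolding l(1) local_degree_preim[OF l(2)] w by simp
  qed
  have "(\<Sum>x\<in>F. ?ld x) = ?ld ?x0 + (\<Sum>x\<in>F - {?x0}. ?ld x)" by (rule sum.remove[OF F(1) x0])
  also have "(\<Sum>x\<in>F - {?x0}. ?ld x) = (\<Sum>x\<in>F - {?x0}. 3)" by (rule sum.cong[OF refl ld3])
  finally have card: "card (F - {?x0}) = k" using F(2) ld0 by simp
  have "F = insert ?x0 (F - {?x0})" using x0 by blast
  then have "mset_set F = add_mset ?x0 (mset_set (F - {?x0}))"
    using F(1) mset_set.insert[of "F - {?x0}" ?x0] by simp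
  moreover have "image_mset ?ld (mset_set (F - {?x0})) = image_mset (\<lambda>_. 3) (mset_set (F - {?x0}))"
    using F(1) ld3 by (intro image_mset_cong) simp
  ultimately have "image_mset ?ld (mset_set F) = replicate_mset k 3 + {#1#}"
    using ld0 card by (simp add: image_mset_const_eq)
  moreover have "fibre (top_of_set usphere) (lattes \<alpha>) (orbit_map w) = F"
    by (auto simp: fibre_def F_def)
  ultimately show ?thesis unfolding local_degrees_over_def by simp
qed

lemma local_degree_lattes_unramified:
  assumes "stab w = 1" "x \<in> usphere \<inter> lattes \<alpha> -` {orbit_map w}"
  shows "local_degree (top_of_set usphere) (top_of_set usphere) (lattes \<alpha>) x = 1"
proof -
  obtain l where l: "x = preim w l" "l \<in> eisenstein"
    using assms(2) unfolding lattes_fibre by (rule imageE)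
  have "stab ((w + l) / \<alpha>) dvd 1"
    using stab_mult[OF \<alpha>(1), of "(w + l) / \<alpha>"] unfolding stab_preim[OF l(2)] assms(1) .
  then show ?thesis unfolding l(1) local_degree_preim[OF l(2)] assms(1) by simp
qed

end

text \<open>Cone points are the images of m / (1 - omega) with m in the lattice. As omega is 1
  modulo \<open>1 - omega\<close>, two of them are in the same orbit exactly if the numerators are
  congruent modulo \<open>1 - omega\<close>, an ideal of index 3.\<close>

lemma card_cone_points: "card (orbit_map ` {w. stab w = 3}) = 3"
proof -
  let ?\<beta> = "1 - omega"
  have \<beta>: "?\<beta> \<in> eisenstein" "?\<beta> \<noteq> 0" using omega_neq by auto
  obtain R where R: "finite R" "transversal ?\<beta> R" "real (card R) = (cmod ?\<beta>)\<^sup>2"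
    by (rule exists_transversal[OF \<beta>])
  have "(cmod ?\<beta>)\<^sup>2 = 3" unfolding norm_coord by simp
  then have c: "card R = 3" using R(3) by simp
  have im: "orbit_map ` {w. stab w = 3} = (\<lambda>m. orbit_map (m / ?\<beta>)) ` eisenstein"
  proof (intro equalityI subsetI)
    fix x assume "x \<in> orbit_map ` {w. stab w = 3}"
    then obtain w where w: "x = orbit_map w" "stab w = 3" by blast
    then have "?\<beta> * w \<in> eisenstein" by (simp only: stab_def split: if_splits)
    moreover have "?\<beta> * w / ?\<beta> = w" using \<beta>(2) by simp
    ultimately show "x \<in> (\<lambda>m. orbit_map (m / ?\<beta>)) ` eisenstein"
      using w(1) by (intro image_eqI[of _ _ "?\<beta> * w"]) simp_all
  next
    fix x assume "x \<in> (\<lambda>m. orbit_map (m / ?\<beta>)) ` eisenstein"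
    then obtain m where m: "x = orbit_map (m / ?\<beta>)" "m \<in> eisenstein" by blast
    have "?\<beta> * (m / ?\<beta>) = m" using \<beta>(2) by simp
    then have "stab (m / ?\<beta>) = 3" using m(2) by (simp only: stab_def if_True)
    then show "x \<in> orbit_map ` {w. stab w = 3}" using m(1) by blast
  qed
  have ker: "orbit_map (m / ?\<beta>) = orbit_map (n / ?\<beta>) \<longleftrightarrow> m - n \<in> eisenstein_ideal ?\<beta>" if mn: "m \<in> eisenstein" "n \<in> eisenstein" for m n
  proof
    assume "orbit_map (m / ?\<beta>) = orbit_map (n / ?\<beta>)"
    then obtain j l where l: "l \<in> eisenstein" "n / ?\<beta> = omega ^ j * (m / ?\<beta>) + l"
      unfolding orbit_map_eq_iff orbit_rel_def by blast
    obtain e where e: "e \<in> eisenstein" "1 - omega ^ j = ?\<beta> * e"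
      using one_minus_omega_power_dvd by blast
    have "n = ?\<beta> * (n / ?\<beta>)" using \<beta>(2) by simp
    also have "\<dots> = omega ^ j * m + ?\<beta> * l" unfolding l(2) using \<beta>(2) by (simp add: distrib_left)
    finally have "m - n = (1 - omega ^ j) * m - ?\<beta> * l" by (simp add: algebra_simps)
    also have "\<dots> = ?\<beta> * (e * m - l)" unfolding e(2) by (simp add: algebra_simps)
    finally show "m - n \<in> eisenstein_ideal ?\<beta>"
      using eisenstein_idealI[of "e * m - l" ?\<beta>] e(1) mn(1) l(1) by simp
  next
    assume "m - n \<in> eisenstein_ideal ?\<beta>"
    then obtain e where e: "e \<in> eisenstein" "m - n = ?\<beta> * e" by (rule eisenstein_idealE)
    have "n = m - ?\<beta> * e" using e(2) by (simp add: algebra_simps)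
    then have "n / ?\<beta> = m / ?\<beta> - e" using \<beta>(2) by (simp add: diff_divide_distrib)
    then have "n / ?\<beta> = omega ^ 0 * (m / ?\<beta>) + - e" by simp
    then show "orbit_map (m / ?\<beta>) = orbit_map (n / ?\<beta>)"
      unfolding orbit_map_eq_iff orbit_rel_def using eisenstein_ring(7)[OF e(1)] by blast
  qed
  have "bij_betw (\<lambda>m. orbit_map (m / ?\<beta>)) R ((\<lambda>m. orbit_map (m / ?\<beta>)) ` eisenstein)"
    by (rule transversal_bij_betw[OF R(2) ker])
  then show ?thesis using bij_betw_same_card c unfolding im by fastforce
qed

lemma realizable_333_if:
  assumes k: "k \<ge> 1" and \<alpha>: "\<alpha> \<in> eisenstein" "(cmod \<alpha>)\<^sup>2 = real (3 * k + 1)" and P: "P = replicate_mset k 3 + {#1#}"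
  shows "realizable (top_of_set usphere) (top_of_set usphere) (3 * k + 1) {#P, P, P#}"
proof -
  let ?X = "top_of_set usphere" let ?f = "lattes \<alpha>"
  have \<alpha>0: "\<alpha> \<noteq> 0" using \<alpha>(2) by auto
  have fib: "fibre ?X ?f y = usphere \<inter> ?f -` {y}" for y by (auto simp: fibre_def)
  define B where "B = orbit_map ` {w. stab w = 3}"
  have cB: "card B = 3" unfolding B_def by (rule card_cone_points)
  then have fB: "finite B" by (intro card_ge_0_finite) simp
  have stab_cases: "stab w = 1 \<or> stab w = 3" for w by (simp add: stab_def)
  have lo: "local_degrees_over ?X ?X ?f y = P" if y: "y \<in> B" for y
  proof -
    from y obtain w where w: "y = orbit_map w" "stab w = 3" unfolding B_def by blast
    show ?thesis unfolding w(1) P by (rule local_degrees_over_lattes[OF \<alpha>(1) \<alpha>0 \<alpha>(2) w(2)])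
  qed
  have nB: "\<exists>w. y = orbit_map w \<and> stab w = 1" if "y \<in> usphere - B" for y
  proof -
    have "y \<in> usphere" using that by blast
    then obtain w where w: "orbit_map w = y" by (rule orbit_map_surj)
    then have "stab w \<noteq> 3" using that unfolding B_def by blast
    then show ?thesis using stab_cases[of w] w by blast
  qed
  have bp: "branching_points ?X ?X ?f = B"
  proof (intro equalityI subsetI)
    fix y assume y: "y \<in> branching_points ?X ?X ?f"
    show "y \<in> B"
    proof (rule ccontr)
      assume "y \<notin> B"
      moreover have "y \<in> usphere" using y by (simp add: branching_points_def)
      ultimately have "y \<in> usphere - B" by blast
      from nB[OF this] obtain w where w: "y = orbit_map w" "stab w = 1" by blast
      obtain x where x: "x \<in> fibre ?X ?f y" "local_degree ?X ?X ?f x > 1"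
        using y unfolding branching_points_def by blast
      then show False
        using local_degree_lattes_unramified[OF \<alpha>(1) \<alpha>0 w(2), of x] unfolding fib w(1) by simp
    qed
  next
    fix y assume y: "y \<in> B"
    then obtain w where "y = orbit_map w" unfolding B_def by blast
    then have yS: "y \<in> usphere" by (simp only: orbit_map_sphere)
    \<comment> \<open>Here k \<ge> 1 matters: the part 3 really occurs, so each cone point is a
      branching point.\<close>
    have "3 \<in># local_degrees_over ?X ?X ?f y"
      unfolding lo[OF y] P using k by (simp add: in_replicate_mset)
    then obtain x where x: "x \<in># mset_set (fibre ?X ?f y)" "local_degree ?X ?X ?f x = 3"
      unfolding local_degrees_over_def by auto
    then have "x \<in> fibre ?X ?f y" by (cases "finite (fibre ?X ?f y)") simp_all
    then show "y \<in> branching_points ?X ?X ?f" unfolding branching_points_def using yS x(2) by force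
  qed
  have "branched_cover ?X ?X ?f" unfolding branched_cover_def
  proof
    show "continuous_map ?X ?X ?f" by (rule lattes_continuous[OF \<alpha>(1)])
    show "\<forall>x\<in>topspace ?X. \<exists>k. locally_power_map ?X ?X ?f x k"
    proof
      fix x assume "x \<in> topspace ?X"
      then have "x \<in> usphere" by simp
      then obtain z where "orbit_map z = x" by (rule orbit_map_surj)
      then show "\<exists>k. locally_power_map ?X ?X ?f x k"
        using lattes_power_map[OF \<alpha>(1) \<alpha>0, of z] by blast
    qed
  qed
  moreover have "has_degree ?X ?X ?f (3 * k + 1)" unfolding has_degree_def bp
  proof
    fix y assume "y \<in> topspace ?X - B"
    then have "y \<in> usphere - B" by simp
    from nB[OF this] obtain w where w: "y = orbit_map w" "stab w = 1" by blast
    have s: "finite (usphere \<inter> ?f -` {y})" "(\<Sum>x\<in>usphere \<inter> ?f -` {y}. local_degree ?X ?X ?f x) = 3 * k + 1"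
      using fibre_local_degree_sum[OF \<alpha>(1) \<alpha>0 \<alpha>(2), of w] unfolding w(1) by blast+
    have "(\<Sum>x\<in>usphere \<inter> ?f -` {y}. local_degree ?X ?X ?f x) = (\<Sum>x\<in>usphere \<inter> ?f -` {y}. 1)"
      by (rule sum.cong[OF refl]) (rule local_degree_lattes_unramified[OF \<alpha>(1) \<alpha>0 w(2)], simp add: w(1))
    then show "finite (fibre ?X ?f y) \<and> card (fibre ?X ?f y) = 3 * k + 1"
      unfolding fib using s by simp
  qed
  moreover have "image_mset (local_degrees_over ?X ?X ?f) (mset_set B) = {#P, P, P#}"
  proof -
    have "image_mset (local_degrees_over ?X ?X ?f) (mset_set B) = image_mset (\<lambda>_. P) (mset_set B)"
      using lo fB by (intro image_mset_cong) simp
    also have "\<dots> = replicate_mset 3 P" by (simp add: image_mset_const_eq cB)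
    finally show ?thesis by (simp add: numeral_3_eq_3)
  qed
  ultimately show ?thesis
    unfolding realizable_def using bp fB by (intro exI[of _ ?f] conjI) simp_all
qed

section \<open>The sphere as a closed surface, and both directions combined\<close>

lemma nsphere_2_chart:
  assumes "x \<in> topspace (nsphere 2)"
  shows "\<exists>U D. openin (nsphere 2) U \<and> x \<in> U \<and> open (D :: complex set) \<and> subtopology (nsphere 2) U homeomorphic_space top_of_set D"
proof -
  let ?X = "nsphere 2"
  have "topspace ?X \<noteq> {x}"
    using non_contractible_space_nsphere[of 2] contractible_space_subtopology_singleton[of ?X x]
    by (metis subtopology_topspace)
  then obtain p where p: "p \<in> topspace ?X" "p \<noteq> x" using assms by blast
  have "closedin ?X {p}"
    using p(1) Hausdorff_imp_t1_space[OF Hausdorff_nsphere_2] by (simp add: t1_space_closedin_singleton)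
  then have "openin ?X (topspace ?X - {p})" by (rule openin_diff[OF openin_topspace])
  moreover have "subtopology ?X (topspace ?X - {p}) homeomorphic_space top_of_set (UNIV :: complex set)"
    by (rule nsphere_2_minus_point_homeomorphic_plane[OF p(1)])
  ultimately show ?thesis
    using assms p(2) by (intro exI[of _ "topspace ?X - {p}"] exI[of _ UNIV]) simp
qed

lemma closed_connected_surface_nsphere_2: "closed_connected_surface (nsphere 2)"
  unfolding closed_connected_surface_def
proof (intro conjI ballI)
  let ?S = "sphere (0::complex \<times> real) 1"
  obtain h g where "homeomorphic_maps (nsphere 2) (top_of_set ?S) h g"
    by (rule homeomorphic_nsphere_2)
  then have "nsphere 2 homeomorphic_space top_of_set ?S"
    unfolding homeomorphic_space_def by (intro exI)
  then show "compact_space (nsphere 2)"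
    by (simp only: homeomorphic_compact_space compact_space_subtopology compactin_euclidean_iff compact_sphere)
  show "topspace (nsphere 2) \<noteq> {}"
    by (simp only: null_topspace_iff_trivial nonempty_nsphere not_False_eq_True)
  show "connected_space (nsphere 2)"
    by (rule path_connected_imp_connected_space[OF path_connected_space_nsphere_2])
qed (rule Hausdorff_nsphere_2, rule nsphere_2_chart)

lemma eisenstein_of_norm_form:
  fixes x y :: nat
  obtains \<alpha> where "\<alpha> \<in> eisenstein" "(cmod \<alpha>)\<^sup>2 = real (x\<^sup>2 + x * y + y\<^sup>2)"
proof (rule that[of "of_nat x - of_nat y * omega"])
  have c: "coord1 (of_nat x - of_nat y * omega) = real x" "coord2 (of_nat x - of_nat y * omega) = - real y"
    using coord_expand by simp_all
  show "(cmod (of_nat x - of_nat y * omega))\<^sup>2 = real (x\<^sup>2 + x * y + y\<^sup>2)"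
    unfolding norm_coord c by (simp add: power2_eq_square)
qed simp

theorem theorem0p6:
  fixes k d :: nat and P :: "nat multiset"
  assumes "k \<ge> 1" and "d = 3 * k + 1"
    and "P = replicate_mset k 3 + {#1#}"
  shows "candidate_surface_branched_cover (nsphere 2) (nsphere 2) d {#P, P, P#} \<and>
         (realizable (nsphere 2) (nsphere 2) d {#P, P, P#} \<longleftrightarrow>
            (\<exists>x y :: nat. d = x\<^sup>2 + x * y + y\<^sup>2))"
proof
  have P: "is_partition_of P d" "size P = k + 1"
    using assms by (simp_all add: is_partition_of_def sum_mset_replicate_mset in_replicate_mset)
  \<comment> \<open>The Riemann-Hurwitz condition reads 2 - 3 (k + 1) = (3 k + 1) (2 - 3).\<close>
  then show "candidate_surface_branched_cover (nsphere 2) (nsphere 2) d {#P, P, P#}"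
    unfolding candidate_surface_branched_cover_def using assms(1,2)
    by (simp add: closed_connected_surface_nsphere_2 orientable_surface_nsphere_2 euler_characteristic_nsphere_2)
  let ?S = "sphere (0::complex \<times> real) 1"
  obtain h g where hg: "homeomorphic_maps (nsphere 2) (top_of_set ?S) h g"
    by (rule homeomorphic_nsphere_2)
  then have gh: "homeomorphic_maps (top_of_set ?S) (nsphere 2) g h"
    by (rule iffD1[OF homeomorphic_maps_sym])
  show "realizable (nsphere 2) (nsphere 2) d {#P, P, P#} \<longleftrightarrow> (\<exists>x y :: nat. d = x\<^sup>2 + x * y + y\<^sup>2)"
  proof
    assume "realizable (nsphere 2) (nsphere 2) d {#P, P, P#}"
    then have r: "realizable (top_of_set ?S) (top_of_set ?S) d {#P, P, P#}"
      by (rule realizable_homeomorphic_maps[OF hg hg])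
    have "d > 0" using assms(2) by simp
    then obtain x y :: nat where "d = x\<^sup>2 + x * y + y\<^sup>2"
      by (rule realizable_333_imp[OF assms(3) _ r])
    then show "\<exists>x y :: nat. d = x\<^sup>2 + x * y + y\<^sup>2" by (intro exI)
  next
    assume "\<exists>x y :: nat. d = x\<^sup>2 + x * y + y\<^sup>2"
    then obtain x y :: nat where d: "d = x\<^sup>2 + x * y + y\<^sup>2" by blast
    obtain \<alpha> where \<alpha>: "\<alpha> \<in> eisenstein" "(cmod \<alpha>)\<^sup>2 = real (x\<^sup>2 + x * y + y\<^sup>2)"
      by (rule eisenstein_of_norm_form)
    have "(cmod \<alpha>)\<^sup>2 = real (3 * k + 1)" unfolding \<alpha>(2) using d assms(2) by simp
    then have "realizable (top_of_set ?S) (top_of_set ?S) d {#P, P, P#}"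
      unfolding assms(2) by (rule realizable_333_if[OF assms(1) \<alpha>(1) _ assms(3)])
    then show "realizable (nsphere 2) (nsphere 2) d {#P, P, P#}"
      by (rule realizable_homeomorphic_maps[OF gh gh])
  qed
qed

end
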